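(* Let $T\in\mathscr{O}_C'(\mathbb{C}^n)$ be a rapidly decreasing distribution and let $K\subset\mathbb{C}^n$ be a linearly convex compact set. Suppose that for every $z\in\mathbb{C}^n\setminus K$ there exists a complex hyperplane $P=\{\lambda\in\mathbb{C}^n:\langle\lambda,w_0\rangle=s_0\}$ (with $w_0\in\mathbb{C}^n\setminus\{0\}$, $s_0\in\mathbb{C}$) satisfying the following conditions: (i) $P$ contains $z$; (ii) $P$ does not meet $K$; (iii) the set $\mathbb{C}\setminus K_{w_0}$ is connected, where $K_{w_0}=\{\langle\lambda,w_0\rangle:\lambda\in K\}\subset\mathbb{C}$. Then $T$ has support in $K$ if and only if its complex Radon transform $RT$ has support in $\hat K$.
   Context: Notation: for $z,w\in\mathbb{C}^n$, $\langle z,w\rangle=\sum_{j=1}^n z_jw_j$ (no complex conjugation). $S^{2n-1}$ is the unit sphere in $\mathbb{C}^n$ and $d\sigma$ its area element. For multi-indices $p,q$, $\partial^p\bar\partial^q$ denotes $\partial^{|p|+|q|}/\partial z_1^{p_1}\cdots\partial z_n^{p_n}\partial\bar z_1^{q_1}\cdots\partial\bar z_n^{q_n}$. Linear convexity: a set $A\subset\mathbb{C}^n$ is linearly convex if for every $w\notin A$ there is a complex hyperplane $\{z:\langle z,\xi\rangle=s\}$ ($\xi\neq0$) which contains $w$ and does not meet $A$. The set $\hat A$: for $A\subset\mathbb{C}^n$, $\hat A$ is the set of all $(\xi,s)\in(\mathbb{C}^n\setminus\{0\})\times\mathbb{C}$ such that the hyperplane $\{z:\langle z,\xi\rangle=s\}$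 meets $A$. When dealing with functions or functionals on $X=S^{2n-1}\times\mathbb{C}$, $\hat A$ is understood as its part in $X$ (i.e. $\xi\in S^{2n-1}$). Rapidly decreasing distributions: $T\in\mathscr{D}'(\mathbb{C}^n)$ belongs to $\mathscr{O}_C'(\mathbb{C}^n)$ if and only if for every $k\in\mathbb{Z}$ there are $m(k)\in\mathbb{N}$ and a finite family of bounded measures $\mu_{pq}(k)$ on $\mathbb{C}^n$ with $(1+|x|^2)^kT=\sum_{|p|+|q|\le m(k)}\partial^p\bar\partial^q\mu_{pq}(k)$. Such $T$ is applied to $C^\infty$ functions $f$ that vanish at infinity together with all their derivatives by $\langle T,f\rangle=\sum_{|p|+|q|\le m(0)}(-1)^{|p|+|q|}\int_{\mathbb{C}^n}\partial^p\bar\partial^q f\,d\mu_{pq}(0)$. Function spaces on $X=S^{2n-1}\times\mathbb{C}$: $\mathscr{E}(X)$ is the space of functions $\varphi(w,s)$ on $X$ that are infinitely differentiable in $s$, with all derivatives $\partial^{p+q}\varphi/\partial s^p\partial\bar s^q$ ($p,q\ge0$) continuous on $X$, and with $\varphi(we^{i\theta},se^{i\theta})=\varphi(w,s)$ for all $\theta\in[0,2\pi]$. $\mathscr{D}(X)$ is the space of compactly supported functions in $\mathscr{E}(X)$, with the inductive limit topology of the subspaces $\mathscr{D}_m$ of functions supported in $S^{2n-1}\times\{|s|\le m\}$, topologized by uniform convergence of all $s$-derivatives. Dual Radon transform: for $f\in\mathscr{E}(X)$, $[R^*f](z)=\int_{S^{2n-1}}f(w,\langle z,w\rangle)\,d\sigma(w)$,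 $z\in\mathbb{C}^n$. For $h\in\mathscr{D}(X)$, $R^*h$ is $C^\infty$ and vanishes at infinity together with all its derivatives. Radon transform of $T\in\mathscr{O}_C'(\mathbb{C}^n)$: $RT$ is the continuous linear functional on $\mathscr{D}(X)$ defined by $\langle RT,h\rangle=\langle T,R^*h\rangle$. (If $T$ is given by a rapidly decreasing $C^\infty$ function $f$, then $RT$ is given by the function $\hat f(w,s)=\int_{\langle z,w\rangle=s}f\,d\lambda$ on $X$, where $d\lambda$ is the area element on the hyperplane.) "$RT$ has support in $\hat K$" means $\langle RT,h\rangle=0$ for every $h\in\mathscr{D}(X)$ with $\mathrm{supp}(h)\subset X\setminus\hat K$. "$T$ has support in $K$" means $\mathrm{supp}(T)\subset K$ in the usual sense of distributions. *)

theory Defs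
  imports "HOL-Analysis.Analysis"
begin

text \<open>\<open>C_k k f\<close>: f is k times continuously differentiable in the real sense.\<close>

primrec C_k :: "nat \<Rightarrow> ('a::euclidean_space \<Rightarrow> 'b::real_normed_vector) \<Rightarrow> bool" where
  "C_k 0 f \<longleftrightarrow> continuous_on UNIV f"
| "C_k (Suc k) f \<longleftrightarrow> (\<forall>x. f differentiable (at x)) \<and>
     (\<forall>b\<in>Basis. C_k k (\<lambda>x. frechet_derivative f (at x) b))"

definition smooth :: "('a::euclidean_space \<Rightarrow> 'b::real_normed_vector) \<Rightarrow> bool" where
  "smooth f \<longleftrightarrow> (\<forall>k. C_k k f)"

definition supp :: "('a::topological_space \<Rightarrow> 'b::zero) \<Rightarrow> 'a set" where
  "supp f = closure {x. f x \<noteq> 0}"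

text \<open>For the real directions u, v of a complex coordinate \<open>z = x + \<i> y\<close>, these are
  \<open>\<partial>/\<partial>z = (\<partial>/\<partial>x - \<i> \<partial>/\<partial>y) / 2\<close> and \<open>\<partial>/\<partial>\<bar>z = (\<partial>/\<partial>x + \<i> \<partial>/\<partial>y) / 2\<close>.\<close>

definition wirtinger ::
  "'a::euclidean_space \<Rightarrow> 'a \<Rightarrow> ('a \<Rightarrow> complex) \<Rightarrow> 'a \<Rightarrow> complex" where
  "wirtinger u v f = (\<lambda>z. (frechet_derivative f (at z) u - \<i> * frechet_derivative f (at z) v) / 2)"

definition wirtinger_bar ::
  "'a::euclidean_space \<Rightarrow> 'a \<Rightarrow> ('a \<Rightarrow> complex) \<Rightarrow> 'a \<Rightarrow> complex" where
  "wirtinger_bar u v f = (\<lambda>z. (frechet_derivative f (at z) u + \<i> * frechet_derivative f (at z) v) / 2)"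

definition d_coord :: "'n \<Rightarrow> (complex ^ 'n \<Rightarrow> complex) \<Rightarrow> complex ^ 'n \<Rightarrow> complex" where
  "d_coord j = wirtinger (axis j 1) (axis j \<i>)"

definition dbar_coord :: "'n \<Rightarrow> (complex ^ 'n \<Rightarrow> complex) \<Rightarrow> complex ^ 'n \<Rightarrow> complex" where
  "dbar_coord j = wirtinger_bar (axis j 1) (axis j \<i>)"

text \<open>The derivative \<open>\<partial>\<^sup>p \<partial>\<bar>\<^sup>q\<close> for multi-indices p, q. The coordinates are taken in an arbitrary
  fixed order, which is immaterial for smooth functions as their partial derivatives commute.\<close>

definition coords :: "'n::finite list" where
  "coords = (SOME js. distinct js \<and> set js = UNIV)"

definition mixed_deriv ::
  "('n::finite \<Rightarrow> nat) \<Rightarrow> ('n \<Rightarrow> nat) \<Rightarrow> (complex ^ 'n \<Rightarrow> complex) \<Rightarrow> complex ^ 'n \<Rightarrow> complex" where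
  "mixed_deriv p q f =
     foldr (\<lambda>j. d_coord j ^^ p j) coords (foldr (\<lambda>j. dbar_coord j ^^ q j) coords f)"

definition mlen :: "('n::finite \<Rightarrow> nat) \<Rightarrow> nat" where
  "mlen p = (\<Sum>j\<in>UNIV. p j)"

definition mindices :: "nat \<Rightarrow> (('n::finite \<Rightarrow> nat) \<times> ('n \<Rightarrow> nat)) set" where
  "mindices m = {(p, q). mlen p + mlen q \<le> m}"

definition test_functions :: "(complex ^ 'n \<Rightarrow> complex) set" where
  "test_functions = {\<phi>. smooth \<phi> \<and> compact (supp \<phi>)}"

text \<open>Only the values of T on test functions matter.\<close>

definition distribution :: "((complex ^ 'n \<Rightarrow> complex) \<Rightarrow> complex) \<Rightarrow> bool" where
  "distribution T \<longleftrightarrow>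
     (\<forall>\<phi>\<in>test_functions. \<forall>\<psi>\<in>test_functions. \<forall>a b.
        T (\<lambda>x. a * \<phi> x + b * \<psi> x) = a * T \<phi> + b * T \<psi>) \<and>
     (\<forall>C. compact C \<longrightarrow> (\<exists>m B. \<forall>\<phi>\<in>test_functions. supp \<phi> \<subseteq> C \<longrightarrow>
        norm (T \<phi>) \<le> B * (\<Sum>(p, q)\<in>mindices m. SUP x. norm (mixed_deriv p q \<phi> x))))"

definition distr_support :: "((complex ^ 'n \<Rightarrow> complex) \<Rightarrow> complex) \<Rightarrow> (complex ^ 'n) set" where
  "distr_support T = - \<Union>{U. open U \<and> (\<forall>\<phi>\<in>test_functions. supp \<phi> \<subseteq> U \<longrightarrow> T \<phi> = 0)}"

text \<open>A bounded complex measure \<open>\<mu>\<^sub>1 - \<mu>\<^sub>2 + \<i> (\<mu>\<^sub>3 - \<mu>\<^sub>4)\<close>, given by four finite positive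
  Borel measures.\<close>

type_synonym 'a cmeasure = "'a measure \<times> 'a measure \<times> 'a measure \<times> 'a measure"

definition finite_borel_measure :: "'a::topological_space measure \<Rightarrow> bool" where
  "finite_borel_measure M \<longleftrightarrow> finite_measure M \<and> sets M = sets borel"

definition bounded_cmeasure :: "'a::topological_space cmeasure \<Rightarrow> bool" where
  "bounded_cmeasure = (\<lambda>(M1, M2, M3, M4).
     finite_borel_measure M1 \<and> finite_borel_measure M2 \<and>
     finite_borel_measure M3 \<and> finite_borel_measure M4)"

definition cintegral :: "'a cmeasure \<Rightarrow> ('a \<Rightarrow> complex) \<Rightarrow> complex" where
  "cintegral = (\<lambda>(M1, M2, M3, M4) f.
     (LINT x|M1. f x) - (LINT x|M2. f x) + \<i> * ((LINT x|M3. f x) - (LINT x|M4. f x)))"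

type_synonym 'n cmeasure_family = "('n \<Rightarrow> nat) \<Rightarrow> ('n \<Rightarrow> nat) \<Rightarrow> (complex ^ 'n) cmeasure"

text \<open>The value at f of \<open>\<Sum> \<partial>\<^sup>p \<partial>\<bar>\<^sup>q \<mu>\<^sub>p\<^sub>q\<close>, summed over \<open>|p| + |q| \<le> m\<close>.\<close>

definition deriv_measures ::
  "nat \<Rightarrow> 'n::finite cmeasure_family \<Rightarrow> (complex ^ 'n \<Rightarrow> complex) \<Rightarrow> complex" where
  "deriv_measures m \<mu> f =
     (\<Sum>(p, q)\<in>mindices m. (- 1) ^ (mlen p + mlen q) * cintegral (\<mu> p q) (mixed_deriv p q f))"

text \<open>\<open>(1 + |x|\<^sup>2)\<^sup>k T = \<Sum> \<partial>\<^sup>p \<partial>\<bar>\<^sup>q \<mu>\<^sub>p\<^sub>q\<close> as distributions, with bounded measures \<open>\<mu>\<^sub>p\<^sub>q\<close>.\<close>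

definition represents ::
  "((complex ^ 'n \<Rightarrow> complex) \<Rightarrow> complex) \<Rightarrow> int \<Rightarrow> nat \<Rightarrow> 'n::finite cmeasure_family \<Rightarrow> bool" where
  "represents T k m \<mu> \<longleftrightarrow>
     (\<forall>(p, q)\<in>mindices m. bounded_cmeasure (\<mu> p q)) \<and>
     (\<forall>\<phi>\<in>test_functions.
        T (\<lambda>x. complex_of_real ((1 + (norm x)\<^sup>2) powi k) * \<phi> x) = deriv_measures m \<mu> \<phi>)"

definition rapidly_decreasing :: "((complex ^ 'n \<Rightarrow> complex) \<Rightarrow> complex) \<Rightarrow> bool" where
  "rapidly_decreasing T \<longleftrightarrow> distribution T \<and> (\<forall>k. \<exists>m \<mu>. represents T k m \<mu>)"

text \<open>The extension of a rapidly decreasing T to smooth functions vanishing at infinity together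
  with all their derivatives. It does not depend on the chosen representation, since the test
  functions are dense in that space for uniform convergence of all derivatives.\<close>

definition pairing :: "((complex ^ 'n \<Rightarrow> complex) \<Rightarrow> complex) \<Rightarrow> (complex ^ 'n \<Rightarrow> complex) \<Rightarrow> complex" where
  "pairing T f = (case (SOME (m, \<mu>). represents T 0 m \<mu>) of (m, \<mu>) \<Rightarrow> deriv_measures m \<mu> f)"

text \<open>\<^const>\<open>scalar_product\<close> is the bilinear form \<open>\<Sum> z\<^sub>j w\<^sub>j\<close>, without conjugation.\<close>

definition chyperplane :: "complex ^ 'n \<Rightarrow> complex \<Rightarrow> (complex ^ 'n) set" where
  "chyperplane \<xi> s = {z. scalar_product z \<xi> = s}"

definition linearly_convex :: "(complex ^ 'n) set \<Rightarrow> bool" where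
  "linearly_convex A \<longleftrightarrow>
     (\<forall>w. w \<notin> A \<longrightarrow> (\<exists>\<xi> s. \<xi> \<noteq> 0 \<and> w \<in> chyperplane \<xi> s \<and> chyperplane \<xi> s \<inter> A = {}))"

definition hat :: "(complex ^ 'n) set \<Rightarrow> ((complex ^ 'n) \<times> complex) set" where
  "hat A = {(\<xi>, s). \<xi> \<noteq> 0 \<and> chyperplane \<xi> s \<inter> A \<noteq> {}}"

text \<open>The surface measure of the unit sphere, by polar coordinates: the measure of A is the
  dimension times the volume of the cone \<open>{t x | 0 < t < 1, x \<in> A}\<close>.\<close>

definition sphere_measure :: "'a::euclidean_space measure" where
  "sphere_measure = scale_measure (of_nat DIM('a))
     (distr (restrict_space lborel (ball 0 1 - {0})) (restrict_space borel (sphere 0 1))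
       (\<lambda>x. x /\<^sub>R norm x))"

definition X_space :: "((complex ^ 'n) \<times> complex) set" where
  "X_space = sphere 0 1 \<times> UNIV"

text \<open>Functions on \<^const>\<open>X_space\<close> are represented by functions on the ambient product, whose
  values outside \<^const>\<open>X_space\<close> are irrelevant.\<close>

definition E_X :: "((complex ^ 'n) \<times> complex \<Rightarrow> complex) set" where
  "E_X = {\<phi>.
     (\<forall>w\<in>sphere 0 1. smooth (\<lambda>s. \<phi> (w, s))) \<and>
     (\<forall>p q. continuous_on X_space
        (\<lambda>(w, s). (wirtinger 1 \<i> ^^ p) ((wirtinger_bar 1 \<i> ^^ q) (\<lambda>s. \<phi> (w, s))) s)) \<and>
     (\<forall>w\<in>sphere 0 1. \<forall>s. \<forall>\<theta>\<in>{0..2 * pi}. \<phi> (cis \<theta> *s w, s * cis \<theta>) = \<phi> (w, s))}"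

definition supp_X :: "((complex ^ 'n) \<times> complex \<Rightarrow> complex) \<Rightarrow> ((complex ^ 'n) \<times> complex) set" where
  "supp_X \<phi> = closure {x \<in> X_space. \<phi> x \<noteq> 0}"

definition D_X :: "((complex ^ 'n) \<times> complex \<Rightarrow> complex) set" where
  "D_X = {\<phi> \<in> E_X. compact (supp_X \<phi>)}"

definition dual_radon :: "((complex ^ 'n) \<times> complex \<Rightarrow> complex) \<Rightarrow> complex ^ 'n \<Rightarrow> complex" where
  "dual_radon f z = (LINT w|sphere_measure. f (w, scalar_product z w))"

definition radon ::
  "((complex ^ 'n \<Rightarrow> complex) \<Rightarrow> complex) \<Rightarrow> ((complex ^ 'n) \<times> complex \<Rightarrow> complex) \<Rightarrow> complex" where
  "radon T h = pairing T (dual_radon h)"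

definition X_supported_in ::
  "(((complex ^ 'n) \<times> complex \<Rightarrow> complex) \<Rightarrow> complex) \<Rightarrow> ((complex ^ 'n) \<times> complex) set \<Rightarrow> bool" where
  "X_supported_in F L \<longleftrightarrow> (\<forall>h\<in>D_X. supp_X h \<subseteq> X_space - L \<longrightarrow> F h = 0)"

end

theory Submission
  imports Defs "HOL-Complex_Analysis.Complex_Analysis"
begin

unbundle no fps_syntax

text \<open>
  If \<open>T\<close> is supported in \<open>K\<close> and the support of \<open>h\<close> avoids \<open>hat K\<close>, then \<open>R\<^sup>*h\<close> vanishes near \<open>K\<close>.

  For the converse, \<open>T\<close> is first shown to have compact support, as in Helgason's support theorem.
  A radial function \<open>G(|z - c|\<^sup>2)\<close> that vanishes near the ball about \<open>c\<close> of radius \<open>R + |c|\<close> is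
  the dual transform of \<open>g(|s - \<langle>c, w\<rangle>|\<^sup>2)\<close> for \<open>g\<close> a constant multiple of the \<open>(n-1)\<close>-st derivative of
  \<open>x\<^sup>n\<^sup>-\<^sup>1 G(x)\<close>, so \<open>T\<close> annihilates it. Because \<open>T\<close> decreases rapidly, \<open>G\<close> may be constant near
  infinity, and differentiating in the centre \<open>c\<close> shows that \<open>T\<close> annihilates \<open>p(z) G(|z - c|\<^sup>2)\<close> for every
  polynomial \<open>p\<close>. Such functions determine \<open>T\<close> outside a ball, since spheres are compact.

  Next, averaging over directions near \<open>\<omega>\<close> shows that \<open>T\<close> annihilates \<open>g(\<langle>z, \<omega>\<rangle> - s)\<close> whenever \<open>g\<close> is
  supported near 0 and \<open>s\<close> is away from \<open>K\<^sub>\<omega>\<close>. Differentiating in \<open>\<omega>\<close> near \<open>w\<^sub>0\<close> brings out factors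
  \<open>z\<^sub>j\<close> and their conjugates at the price of a Wirtinger derivative of \<open>g\<close>. That derivative is removed
  by the identity theorem: the resulting function of \<open>s\<close> is holomorphic or antiholomorphic along a path in
  the complement of \<open>K\<^sub>w\<^sub>0\<close> from \<open>s\<^sub>0\<close> to infinity, and it vanishes far out because \<open>T\<close> has compact
  support. Hence \<open>T\<close> annihilates all polynomials times \<open>g(\<langle>z, w\<^sub>0\<rangle> - s\<^sub>0)\<close>, and \<open>T\<close> vanishes near the
  hyperplane.
\<close>

subsection \<open>Families of smooth functions\<close>

text \<open>Few of the functions paired with \<open>T\<close> here have compact support: a plane
  wave is constant along hyperplanes, a radial function may be constant near infinity, and
  polynomial factors make both grow. Rapid decrease represents every \<open>(1 + |x|^2)^K T\<close>
  by bounded measures, so \<open>ext\<close> has a value on every function of polynomial growth; it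
  is continuous in parameters and commutes with integration over them. Derivatives in a centre, in a
  direction or in \<open>s\<close> are therefore reached through integrals along segments. Two
  obstacles shape the second half. A function on the space of hyperplanes is invariant under a
  common phase of \<open>w\<close> and \<open>s\<close>, so concentration near one direction must be
  built from data of complex lines. And a vanishing average over directions says nothing about a
  single direction unless the integrand is nonnegative; this is forced by weighting with the
  conjugate of the unknown value itself. Finally, all margins (support radius of \<open>g\<close>,
  ball of directions, connected set of \<open>s\<close>) are fixed once, so that no step of the
  induction over polynomials has to shrink them.\<close>

definition dir_deriv :: "'a::euclidean_space \<Rightarrow> ('a \<Rightarrow> complex) \<Rightarrow> 'a \<Rightarrow> complex" where
  "dir_deriv b f = (\<lambda>x. frechet_derivative f (at x) b)"

lemma dir_deriv_eqI: "(f has_derivative f') (at x) \<Longrightarrow> dir_deriv b f x = f' b"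
  unfolding dir_deriv_def using frechet_derivative_at by metis

lemma has_derivative_dir_deriv:
  "f differentiable (at x) \<Longrightarrow> (f has_derivative (\<lambda>h. dir_deriv h f x)) (at x)"
  unfolding dir_deriv_def using frechet_derivative_works by auto

lemma dir_deriv_expand:
  assumes "f differentiable (at x)"
  shows "dir_deriv v f x = (\<Sum>b\<in>Basis. of_real (v \<bullet> b) * dir_deriv b f x)"
proof -
  interpret bounded_linear "\<lambda>h. dir_deriv h f x"
    using has_derivative_dir_deriv[OF assms] by (rule has_derivative_bounded_linear)
  have "dir_deriv v f x = dir_deriv (\<Sum>b\<in>Basis. (v \<bullet> b) *\<^sub>R b) f x"
    by (simp add: euclidean_representation)
  also have "\<dots> = (\<Sum>b\<in>Basis. of_real (v \<bullet> b) * dir_deriv b f x)"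
    by (simp add: sum scaleR scaleR_conv_of_real)
  finally show ?thesis .
qed

lemma dir_deriv_add:
  assumes "f differentiable (at x)" "g differentiable (at x)"
  shows "dir_deriv b (\<lambda>x. f x + g x) x = dir_deriv b f x + dir_deriv b g x"
  using has_derivative_add[OF has_derivative_dir_deriv[OF assms(1)] has_derivative_dir_deriv[OF assms(2)]]
  by (rule dir_deriv_eqI)

lemma dir_deriv_mult:
  assumes "f differentiable (at x)" "g differentiable (at x)"
  shows "dir_deriv b (\<lambda>x. f x * g x) x = f x * dir_deriv b g x + dir_deriv b f x * g x"
  using has_derivative_mult[OF has_derivative_dir_deriv[OF assms(1)] has_derivative_dir_deriv[OF assms(2)]]
  by (rule dir_deriv_eqI)

lemma dir_deriv_cmult:
  assumes "f differentiable (at x)"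
  shows "dir_deriv b (\<lambda>x. c * f x) x = c * dir_deriv b f x"
  using has_derivative_mult_right[OF has_derivative_dir_deriv[OF assms(1)]]
  by (rule dir_deriv_eqI)

lemma dir_deriv_const [simp]: "dir_deriv b (\<lambda>x. c) = (\<lambda>x. 0)"
  by (rule ext, rule dir_deriv_eqI[where f'="\<lambda>h. 0"]) simp

lemma dir_deriv_coord [simp]:
  "dir_deriv b (\<lambda>x. complex_of_real (x \<bullet> c)) = (\<lambda>x. of_real (b \<bullet> c))"
  by (rule ext, rule dir_deriv_eqI) (auto intro!: derivative_eq_intros)

lemma dir_deriv_affine:
  assumes "bounded_linear L" "F differentiable (at (L x + t))"
  shows "dir_deriv b (\<lambda>x. F (L x + t)) x = dir_deriv (L b) F (L x + t)"
    and "(\<lambda>x. F (L x + t)) differentiable (at x)"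
proof -
  have "((\<lambda>x. L x + t) has_derivative L) (at x)"
    using assms(1) by (auto intro!: derivative_eq_intros bounded_linear_imp_has_derivative)
  from has_derivative_compose[OF this has_derivative_dir_deriv[OF assms(2)]]
  have "((\<lambda>x. F (L x + t)) has_derivative (\<lambda>h. dir_deriv (L h) F (L x + t))) (at x)" .
  then show "dir_deriv b (\<lambda>x. F (L x + t)) x = dir_deriv (L b) F (L x + t)"
    "(\<lambda>x. F (L x + t)) differentiable (at x)"
    by (auto intro: dir_deriv_eqI simp: differentiable_def)
qed

text \<open>Bounds are uniform in the parameter \<open>y\<close>, with one weight \<open>W\<close>
  for all orders, and continuity is joint in \<open>(y, x)\<close>: this is what dominated
  convergence, Fubini and differentiation under the integral ask for. Derivatives are taken in
  \<open>x\<close> only.\<close>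

primrec ck_family ::
  "nat \<Rightarrow> ('a::euclidean_space \<Rightarrow> real) \<Rightarrow> 'y::metric_space set \<Rightarrow> ('y \<Rightarrow> 'a \<Rightarrow> complex) \<Rightarrow> bool"
where
  "ck_family 0 W Y f \<longleftrightarrow> continuous_on (Y \<times> UNIV) (\<lambda>(y, x). f y x) \<and>
     (\<exists>C. \<forall>y\<in>Y. \<forall>x. norm (f y x) \<le> C * W x)"
| "ck_family (Suc m) W Y f \<longleftrightarrow> continuous_on (Y \<times> UNIV) (\<lambda>(y, x). f y x) \<and>
     (\<exists>C. \<forall>y\<in>Y. \<forall>x. norm (f y x) \<le> C * W x) \<and>
     (\<forall>y\<in>Y. \<forall>x. f y differentiable (at x)) \<and>
     (\<forall>b\<in>Basis. ck_family m W Y (\<lambda>y. dir_deriv b (f y)))"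

definition smooth_family ::
  "('a::euclidean_space \<Rightarrow> real) \<Rightarrow> 'y::metric_space set \<Rightarrow> ('y \<Rightarrow> 'a \<Rightarrow> complex) \<Rightarrow> bool" where
  "smooth_family W Y f \<longleftrightarrow> (\<forall>m. ck_family m W Y f)"

lemma ck_family_0: "ck_family m W Y f \<Longrightarrow> ck_family 0 W Y f"
  by (cases m) auto

lemma ck_family_mono: "ck_family (Suc m) W Y f \<Longrightarrow> ck_family m W Y f"
  by (induction m arbitrary: f) auto

lemma ck_family_cong:
  assumes "\<And>y. y \<in> Y \<Longrightarrow> f y = g y"
  shows "ck_family m W Y f \<longleftrightarrow> ck_family m W Y g"
  using assms
proof (induction m arbitrary: f g)
  case 0
  have "continuous_on (Y \<times> UNIV) (\<lambda>(y, x). f y x) = continuous_on (Y \<times> UNIV) (\<lambda>(y, x). g y x)"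
    by (rule continuous_on_cong) (auto simp: 0)
  then show ?case by (simp add: 0)
next
  case (Suc m)
  have 1: "continuous_on (Y \<times> UNIV) (\<lambda>(y, x). f y x) = continuous_on (Y \<times> UNIV) (\<lambda>(y, x). g y x)"
    by (rule continuous_on_cong) (auto simp: Suc.prems)
  have 2: "ck_family m W Y (\<lambda>y. dir_deriv b (f y)) = ck_family m W Y (\<lambda>y. dir_deriv b (g y))" for b
    by (rule Suc.IH) (simp add: Suc.prems)
  show ?case by (simp add: 1 2 Suc.prems)
qed

lemma ck_family_reindex:
  fixes f :: "'y::metric_space \<Rightarrow> 'a::euclidean_space \<Rightarrow> complex" and \<tau> :: "'z::metric_space \<Rightarrow> 'y"
  assumes "ck_family m W Y f" "continuous_on Z \<tau>" "\<tau> ` Z \<subseteq> Y"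
  shows "ck_family m W Z (\<lambda>z. f (\<tau> z))"
proof -
  have c: "continuous_on (Z \<times> UNIV) (\<lambda>(z, x). f (\<tau> z) x)"
    if "continuous_on (Y \<times> UNIV) (\<lambda>(y, x). f y x)" for f :: "'y \<Rightarrow> 'a \<Rightarrow> complex"
  proof -
    have "continuous_on (Z \<times> UNIV) (\<lambda>p. (\<tau> (fst p), snd p) :: 'y \<times> 'a)"
      by (intro continuous_intros continuous_on_compose2[OF assms(2)]) auto
    from continuous_on_compose2[OF that this] show ?thesis using assms(3)
      by (auto simp: case_prod_unfold image_subset_iff)
  qed
  show ?thesis using assms(1)
    by (induction m arbitrary: f) (use assms(3) c in \<open>fastforce+\<close>)
qed

lemma ck_family_add:
  assumes "ck_family m W Y f" "ck_family m W Y g"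
  shows "ck_family m W Y (\<lambda>y x. f y x + g y x)"
  using assms
proof (induction m arbitrary: f g)
  case 0
  then obtain C D where CD: "\<And>y x. y \<in> Y \<Longrightarrow> norm (f y x) \<le> C * W x" "\<And>y x. y \<in> Y \<Longrightarrow> norm (g y x) \<le> D * W x"
    unfolding ck_family.simps by metis
  have "norm (f y x + g y x) \<le> (C + D) * W x" if "y \<in> Y" for y x
    using norm_triangle_mono[OF CD[OF that]] by (simp add: algebra_simps)
  moreover have "continuous_on (Y \<times> UNIV) (\<lambda>(y, x). f y x + g y x)"
    using 0 by (auto simp: case_prod_unfold intro!: continuous_intros)
  ultimately show ?case by auto
next
  case (Suc m)
  then obtain C D where CD: "\<And>y x. y \<in> Y \<Longrightarrow> norm (f y x) \<le> C * W x" "\<And>y x. y \<in> Y \<Longrightarrow> norm (g y x) \<le> D * W x"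
    unfolding ck_family.simps by metis
  have "norm (f y x + g y x) \<le> (C + D) * W x" if "y \<in> Y" for y x
    using norm_triangle_mono[OF CD[OF that]] by (simp add: algebra_simps)
  moreover have "continuous_on (Y \<times> UNIV) (\<lambda>(y, x). f y x + g y x)"
    using Suc.prems by (auto simp: case_prod_unfold intro!: continuous_intros)
  moreover have "ck_family m W Y (\<lambda>y. dir_deriv b (\<lambda>x. f y x + g y x))" if b: "b \<in> Basis" for b
  proof -
    have "ck_family m W Y (\<lambda>y x. dir_deriv b (f y) x + dir_deriv b (g y) x)"
      using Suc.IH Suc.prems b by simp
    then show ?thesis
      by (subst ck_family_cong[where g="\<lambda>y x. dir_deriv b (f y) x + dir_deriv b (g y) x"])
        (use Suc.prems in \<open>auto simp: dir_deriv_add\<close>)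
  qed
  ultimately show ?case using Suc.prems by (auto intro!: derivative_intros)
qed

lemma ck_family_mult:
  assumes "ck_family m W Y f" "ck_family m V Y g"
  shows "ck_family m (\<lambda>x. W x * V x) Y (\<lambda>y x. f y x * g y x)"
  using assms
proof (induction m arbitrary: f g)
  case 0
  then obtain C D where CD: "\<And>y x. y \<in> Y \<Longrightarrow> norm (f y x) \<le> C * W x" "\<And>y x. y \<in> Y \<Longrightarrow> norm (g y x) \<le> D * V x"
    unfolding ck_family.simps by metis
  have "norm (f y x * g y x) \<le> (C * D) * (W x * V x)" if "y \<in> Y" for y x
    using mult_mono[OF CD(1)[OF that, of x] CD(2)[OF that, of x] order_trans[OF norm_ge_zero CD(1)[OF that, of x]] norm_ge_zero]
    by (simp add: norm_mult mult_ac)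
  moreover have "continuous_on (Y \<times> UNIV) (\<lambda>(y, x). f y x * g y x)"
    using 0 by (auto simp: case_prod_unfold intro!: continuous_intros)
  ultimately show ?case by auto
next
  case (Suc m)
  then obtain C D where CD: "\<And>y x. y \<in> Y \<Longrightarrow> norm (f y x) \<le> C * W x" "\<And>y x. y \<in> Y \<Longrightarrow> norm (g y x) \<le> D * V x"
    unfolding ck_family.simps by metis
  have "norm (f y x * g y x) \<le> (C * D) * (W x * V x)" if "y \<in> Y" for y x
    using mult_mono[OF CD(1)[OF that, of x] CD(2)[OF that, of x] order_trans[OF norm_ge_zero CD(1)[OF that, of x]] norm_ge_zero]
    by (simp add: norm_mult mult_ac)
  moreover have "continuous_on (Y \<times> UNIV) (\<lambda>(y, x). f y x * g y x)"
    using Suc.prems by (auto simp: case_prod_unfold intro!: continuous_intros)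
  moreover have "ck_family m (\<lambda>x. W x * V x) Y (\<lambda>y. dir_deriv b (\<lambda>x. f y x * g y x))" if b: "b \<in> Basis" for b
  proof -
    have "ck_family m (\<lambda>x. W x * V x) Y (\<lambda>y x. f y x * dir_deriv b (g y) x + dir_deriv b (f y) x * g y x)"
      using Suc.prems b by (intro ck_family_add Suc.IH ck_family_mono[of m _ _ f] ck_family_mono[of m _ _ g]) auto
    then show ?thesis
      by (subst ck_family_cong[where g="\<lambda>y x. f y x * dir_deriv b (g y) x + dir_deriv b (f y) x * g y x"])
        (use Suc.prems in \<open>auto simp: dir_deriv_mult\<close>)
  qed
  ultimately show ?case using Suc.prems by (auto intro!: derivative_intros)
qed

lemma ck_family_weight:
  assumes "ck_family m W Y f" "\<And>x. 0 \<le> W x" "\<And>x. W x \<le> c * V x"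
  shows "ck_family m V Y f"
proof -
  have b: "\<exists>C. \<forall>y\<in>Y. \<forall>x. norm (f y x) \<le> C * V x" if C: "\<exists>C. \<forall>y\<in>Y. \<forall>x. norm (f y x) \<le> C * W x"
    for f :: "'b \<Rightarrow> 'a \<Rightarrow> complex"
  proof -
    obtain C where C: "\<And>y x. y \<in> Y \<Longrightarrow> norm (f y x) \<le> C * W x" using C by auto
    have "norm (f y x) \<le> (\<bar>C\<bar> * c) * V x" if "y \<in> Y" for y x
    proof -
      have "norm (f y x) \<le> \<bar>C\<bar> * W x"
        using C[OF that, of x] assms(2)[of x] by (smt (verit) mult_right_mono)
      also have "\<dots> \<le> \<bar>C\<bar> * (c * V x)" using assms(3) by (intro mult_left_mono) auto
      finally show ?thesis by (simp add: mult_ac)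
    qed
    then show ?thesis by blast
  qed
  show ?thesis using assms(1)
    by (induction m arbitrary: f) (use b in auto)
qed

lemma smooth_family_0: "smooth_family W Y f \<Longrightarrow> ck_family 0 W Y f"
  unfolding smooth_family_def by blast

lemma smooth_family_continuous:
  "smooth_family W Y f \<Longrightarrow> continuous_on (Y \<times> UNIV) (\<lambda>(y, x). f y x)"
  using smooth_family_0 by auto

lemma smooth_family_continuous_param:
  fixes f :: "'y::metric_space \<Rightarrow> 'a::euclidean_space \<Rightarrow> complex"
  assumes "smooth_family W Y f"
  shows "continuous_on Y (\<lambda>y. f y x)"
proof -
  have "continuous_on Y (\<lambda>y. (y, x))" by (intro continuous_intros)
  from continuous_on_compose2[OF smooth_family_continuous[OF assms] this] show ?thesis by auto
qed

lemma smooth_family_continuous_arg: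
  fixes f :: "'y::metric_space \<Rightarrow> 'a::euclidean_space \<Rightarrow> complex"
  assumes "smooth_family W Y f" "y \<in> Y"
  shows "continuous_on A (f y)"
proof -
  have "continuous_on A (\<lambda>x. (y, x))" by (intro continuous_intros)
  from continuous_on_compose2[OF smooth_family_continuous[OF assms(1)] this] show ?thesis using assms(2) by auto
qed

lemma smooth_family_bound:
  assumes "smooth_family W Y f"
  obtains C where "\<And>y x. y \<in> Y \<Longrightarrow> norm (f y x) \<le> C * W x"
  using smooth_family_0[OF assms] by auto

lemma smooth_family_differentiable:
  "smooth_family W Y f \<Longrightarrow> y \<in> Y \<Longrightarrow> f y differentiable (at x)"
  unfolding smooth_family_def by (meson ck_family.simps(2))

lemma smooth_family_Basis_deriv:
  "smooth_family W Y f \<Longrightarrow> b \<in> Basis \<Longrightarrow> smooth_family W Y (\<lambda>y. dir_deriv b (f y))"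
  unfolding smooth_family_def by (metis ck_family.simps(2))

lemma smooth_family_reindex:
  "smooth_family W Y f \<Longrightarrow> continuous_on Z \<tau> \<Longrightarrow> \<tau> ` Z \<subseteq> Y \<Longrightarrow> smooth_family W Z (\<lambda>z. f (\<tau> z))"
  unfolding smooth_family_def using ck_family_reindex by blast

lemma smooth_family_add:
  "smooth_family W Y f \<Longrightarrow> smooth_family W Y g \<Longrightarrow> smooth_family W Y (\<lambda>y x. f y x + g y x)"
  unfolding smooth_family_def using ck_family_add by blast

lemma smooth_family_mult:
  "smooth_family W Y f \<Longrightarrow> smooth_family V Y g \<Longrightarrow>
    smooth_family (\<lambda>x. W x * V x) Y (\<lambda>y x. f y x * g y x)"
  unfolding smooth_family_def using ck_family_mult by blast

lemma smooth_family_weight: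
  "smooth_family W Y f \<Longrightarrow> (\<And>x. 0 \<le> W x) \<Longrightarrow> (\<And>x. W x \<le> c * V x) \<Longrightarrow> smooth_family V Y f"
  unfolding smooth_family_def using ck_family_weight by blast

lemma smooth_family_mult1:
  "smooth_family (\<lambda>_. 1) Y f \<Longrightarrow> smooth_family (\<lambda>_. 1) Y g \<Longrightarrow>
    smooth_family (\<lambda>_. 1) Y (\<lambda>y x. f y x * g y x)"
  using smooth_family_mult[of "\<lambda>_. 1" Y f "\<lambda>_. 1" g] by simp

text \<open>No formula for higher derivatives is needed: it suffices to exhibit a class of families
  that is closed under one derivative and satisfies the order zero bounds.\<close>

lemma smooth_family_coinduct:
  assumes "P f"
    and "\<And>f. P f \<Longrightarrow> ck_family 0 W Y f"
    and "\<And>f y x. P f \<Longrightarrow> y \<in> Y \<Longrightarrow> f y differentiable (at x)"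
    and "\<And>f b. P f \<Longrightarrow> b \<in> Basis \<Longrightarrow> P (\<lambda>y. dir_deriv b (f y))"
  shows "smooth_family W Y f"
proof -
  have "ck_family m W Y f" if "P f" for m f
    using that
  proof (induction m arbitrary: f)
    case 0
    then show ?case by (rule assms(2))
  next
    case (Suc m)
    then show ?case using assms(2)[OF Suc.prems] assms(3,4) by auto
  qed
  then show ?thesis using assms(1) unfolding smooth_family_def by blast
qed

lemma smooth_family_zero: "smooth_family (\<lambda>_. 1) Y (\<lambda>y x. 0)"
  by (rule smooth_family_coinduct[where P="\<lambda>f. f = (\<lambda>y x. 0)"])
    (auto intro: exI[of _ 0] continuous_intros simp: case_prod_unfold)

lemma smooth_family_scalar:
  assumes "continuous_on Y a" "bounded (a ` Y)"
  shows "smooth_family (\<lambda>_. 1) Y (\<lambda>y x. a y)"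
proof -
  have c: "continuous_on (Y \<times> (UNIV::'b set)) (\<lambda>(y, x). a y)"
    unfolding case_prod_unfold by (rule continuous_on_compose2[OF assms(1)]) (auto intro: continuous_intros)
  have b: "\<exists>C. \<forall>y\<in>Y. \<forall>x::'b. norm (a y) \<le> C * 1" using assms(2) by (auto simp: bounded_iff)
  have z: "ck_family m (\<lambda>_. 1) Y (\<lambda>y (x::'b). 0)" for m
    using smooth_family_zero unfolding smooth_family_def by blast
  have "ck_family m (\<lambda>_. 1) Y (\<lambda>y (x::'b). a y)" for m
    using c b z by (cases m) auto
  then show ?thesis unfolding smooth_family_def by blast
qed

lemma smooth_family_const: "smooth_family (\<lambda>_. 1) Y (\<lambda>y x. c)"
  by (rule smooth_family_scalar) (auto simp: image_constant_conv)

lemma smooth_family_cmult: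
  assumes "smooth_family W Y f" "continuous_on Y a" "bounded (a ` Y)"
  shows "smooth_family W Y (\<lambda>y x. a y * f y x)"
  using smooth_family_mult[OF smooth_family_scalar[OF assms(2,3)] assms(1)] by simp

lemma smooth_family_sum:
  assumes "finite I" "I \<noteq> {}" "\<And>i. i \<in> I \<Longrightarrow> smooth_family W Y (f i)"
  shows "smooth_family W Y (\<lambda>y x. \<Sum>i\<in>I. f i y x)"
  using assms by (induction I rule: finite_ne_induct) (auto intro: smooth_family_add)

text \<open>Substitution of affine maps that depend on the parameter covers translations, dilations
  and plane waves alike.\<close>

lemma smooth_family_affine:
  fixes F :: "'y::metric_space \<Rightarrow> 'c::euclidean_space \<Rightarrow> complex"
    and L :: "'y \<Rightarrow> 'a::euclidean_space \<Rightarrow> 'c"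
  assumes F: "smooth_family (\<lambda>_. 1) Y F"
    and L: "\<And>y. y \<in> Y \<Longrightarrow> bounded_linear (L y)"
    and Lc: "\<And>b. b \<in> Basis \<Longrightarrow> continuous_on Y (\<lambda>y. L y b)"
    and Lb: "\<And>b. b \<in> Basis \<Longrightarrow> bounded ((\<lambda>y. L y b) ` Y)"
    and t: "continuous_on Y \<tau>"
  shows "smooth_family (\<lambda>_. 1) Y (\<lambda>y x. F y (L y x + \<tau> y))"
proof -
  have c: "continuous_on (Y \<times> UNIV) (\<lambda>(y, x). F y (L y x + \<tau> y))"
    if "continuous_on (Y \<times> UNIV) (\<lambda>(y, x). F y x)" for F :: "'y \<Rightarrow> 'c \<Rightarrow> complex"
  proof -
    \<comment> \<open>By linearity \<open>L y\<close> is governed by its finitely many values on the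
      basis, so their continuity in \<open>y\<close> yields joint continuity.\<close>
    have e: "L y x = (\<Sum>b\<in>Basis. (x \<bullet> b) *\<^sub>R L y b)" if "y \<in> Y" for y x
    proof -
      interpret bounded_linear "L y" using L[OF that] .
      show ?thesis
        by (metis (no_types, lifting) euclidean_representation scaleR sum sum.cong)
    qed
    have "continuous_on (Y \<times> (UNIV::'a set)) (\<lambda>p. \<Sum>b\<in>Basis. (snd p \<bullet> b) *\<^sub>R L (fst p) b)"
      by (intro continuous_intros continuous_on_compose2[OF Lc]) auto
    moreover have "continuous_on (Y \<times> (UNIV::'a set)) (\<lambda>p. \<Sum>b\<in>Basis. (snd p \<bullet> b) *\<^sub>R L (fst p) b)
      = continuous_on (Y \<times> (UNIV::'a set)) (\<lambda>p. L (fst p) (snd p))"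
      by (rule continuous_on_cong) (auto simp: e)
    ultimately have "continuous_on (Y \<times> (UNIV::'a set)) (\<lambda>p. (fst p, L (fst p) (snd p) + \<tau> (fst p)))"
      by (intro continuous_intros continuous_on_compose2[OF t]) auto
    from continuous_on_compose2[OF that this] show ?thesis
      by (simp add: case_prod_unfold image_subset_iff)
  qed
  have "ck_family m (\<lambda>_. 1) Y (\<lambda>y x. F y (L y x + \<tau> y))" if "smooth_family (\<lambda>_. 1) Y F" for m F
    using that
  proof (induction m arbitrary: F)
    case 0
    then show ?case using c[of F] smooth_family_continuous[OF 0]
      by (auto elim!: smooth_family_bound)
  next
    case (Suc m)
    note d = smooth_family_differentiable[OF Suc.prems]
    have "ck_family m (\<lambda>_. 1) Y (\<lambda>y. dir_deriv b (\<lambda>x. F y (L y x + \<tau> y)))" if b: "b \<in> Basis" for b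
    proof -
      \<comment> \<open>Chain rule: the derivative of the composite along \<open>b\<close> is the
        derivative of \<open>F y\<close> along \<open>L y b\<close>. Expanded in the basis it is
        again a composite of the same kind, with \<open>G\<close> in place of \<open>F\<close>, so
        the induction continues.\<close>
      define G where "G y x = (\<Sum>e\<in>Basis. of_real (L y b \<bullet> e) * dir_deriv e (F y) x)" for y x
      have G: "smooth_family (\<lambda>_. 1) Y G"
        unfolding G_def
      proof (intro smooth_family_sum smooth_family_cmult smooth_family_Basis_deriv Suc.prems)
        fix e :: 'c assume "e \<in> Basis"
        show "continuous_on Y (\<lambda>y. complex_of_real (L y b \<bullet> e))"
          by (intro continuous_intros Lc b)
        have "(\<lambda>y. complex_of_real (L y b \<bullet> e)) ` Y = (\<lambda>v. complex_of_real (v \<bullet> e)) ` (\<lambda>y. L y b) ` Y"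
          by (simp add: image_image)
        also have "bounded \<dots>"
          by (rule bounded_linear_image[OF Lb[OF b]])
            (intro bounded_linear_compose[OF bounded_linear_of_real] bounded_linear_inner_left)
        finally show "bounded ((\<lambda>y. complex_of_real (L y b \<bullet> e)) ` Y)" .
      qed auto
      have "dir_deriv b (\<lambda>x. F y (L y x + \<tau> y)) x = G y (L y x + \<tau> y)" if "y \<in> Y" for y x
        unfolding G_def by (subst dir_deriv_affine[OF L]) (use that d in \<open>auto intro: dir_deriv_expand\<close>)
      then show ?thesis using Suc.IH[OF G]
        by (subst ck_family_cong[where g="\<lambda>y x. G y (L y x + \<tau> y)"]) auto
    qed
    moreover have "(\<lambda>x. F y (L y x + \<tau> y)) differentiable (at x)" if "y \<in> Y" for x y
      by (rule dir_deriv_affine(2)[OF L]) (use that d in auto)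
    moreover obtain C where "\<And>y x. y \<in> Y \<Longrightarrow> norm (F y x) \<le> C * 1"
      using smooth_family_bound[OF Suc.prems] by metis
    ultimately show ?case using c[of F] smooth_family_continuous[OF Suc.prems]
      by (auto intro!: exI[of _ C])
  qed
  then show ?thesis using F unfolding smooth_family_def by blast
qed

subsection \<open>Integrals over a parameter\<close>

lemma sets_eq_borel_measurable_cong:
  "sets M = sets borel \<Longrightarrow> f \<in> borel_measurable M \<longleftrightarrow> f \<in> borel_measurable borel"
  by (metis measurable_cong_sets)

text \<open>One setting for the two kinds of parameter that occur: unit vectors with surface
  measure, and intervals or balls with Lebesgue measure. The measure lives on all Borel sets and
  only its mass on \<open>Y\<close> has to be finite; sigma-finiteness is there for Fubini.\<close>

locale compact_parameter = sigma_finite_measure \<nu>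
  for \<nu> :: "'y::euclidean_space measure" +
  fixes Y :: "'y set"
  assumes sets_nu: "sets \<nu> = sets borel"
    and compact_Y: "compact Y"
    and finite_nu_Y: "emeasure \<nu> Y < \<infinity>"
begin

lemma Y_sets: "Y \<in> sets \<nu>"
  using compact_Y sets_nu by (simp add: borel_compact)

lemma set_integrable_continuous:
  fixes g :: "'y \<Rightarrow> complex"
  assumes "continuous_on Y g"
  shows "set_integrable \<nu> Y g"
proof -
  have "bounded (g ` Y)"
    using compact_continuous_image[OF assms compact_Y] by (rule compact_imp_bounded)
  then obtain B where B: "\<And>y. y \<in> Y \<Longrightarrow> norm (g y) \<le> B" by (auto simp: bounded_iff)
  have "integrable \<nu> (\<lambda>y. B *\<^sub>R indicator Y y :: real)"
    using Y_sets finite_nu_Y by (intro integrable_scaleR_right integrable_real_indicator) auto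
  moreover have "(\<lambda>y. indicator Y y *\<^sub>R g y) \<in> borel_measurable \<nu>"
    unfolding sets_eq_borel_measurable_cong[OF sets_nu]
    using compact_Y assms by (intro borel_measurable_continuous_on_indicator) (auto simp: borel_compact)
  ultimately show ?thesis
    unfolding set_integrable_def
    by (rule Bochner_Integration.integrable_bound) (use order_trans[OF B abs_ge_self] in \<open>auto simp: indicator_def\<close>)
qed

lemma norm_set_integral_le:
  fixes g :: "'y \<Rightarrow> complex"
  assumes "continuous_on Y g" "\<And>y. y \<in> Y \<Longrightarrow> norm (g y) \<le> B"
  shows "norm (LINT y:Y|\<nu>. g y) \<le> B * measure \<nu> Y"
proof -
  have i: "integrable \<nu> (\<lambda>y. B *\<^sub>R indicator Y y :: real)"
    using Y_sets finite_nu_Y by (intro integrable_scaleR_right integrable_real_indicator) auto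
  have "norm (LINT y:Y|\<nu>. g y) \<le> (LINT y|\<nu>. norm (indicator Y y *\<^sub>R g y))"
    unfolding set_lebesgue_integral_def by (rule integral_norm_bound)
  also have "\<dots> \<le> (LINT y|\<nu>. B *\<^sub>R indicator Y y :: real)"
    using set_integrable_continuous[OF assms(1)] assms(2) unfolding set_integrable_def
    by (intro integral_mono i integrable_norm) (auto simp: indicator_def)
  also have "\<dots> = B * measure \<nu> Y" using Y_sets finite_nu_Y sets.sets_into_space[OF Y_sets]
    by (simp add: Int_absorb2)
  finally show ?thesis .
qed

text \<open>Compactness of \<open>Y\<close> turns joint continuity into continuity at
  \<open>x\<close> with one radius for all parameters, as in the tube lemma.\<close>

lemma uniform_in_parameter:
  fixes k :: "'y \<Rightarrow> 'a::euclidean_space \<Rightarrow> complex"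
  assumes "continuous_on (Y \<times> UNIV) (\<lambda>(y, x). k y x)" "e > 0"
  obtains d where "d > 0" "\<And>y x'. y \<in> Y \<Longrightarrow> norm (x' - x) < d \<Longrightarrow> norm (k y x' - k y x) \<le> e"
proof -
  have "continuous_on (UNIV \<times> Y) (\<lambda>p. (snd p, fst p))" by (intro continuous_intros)
  from continuous_on_compose2[OF assms(1) this]
  have "continuous_on (UNIV \<times> Y) (\<lambda>(x, y). k y x)"
    by (simp add: case_prod_unfold image_subset_iff)
  from continuous_on_prod_compactE[OF this compact_Y UNIV_I \<open>e > 0\<close>, of x]
  obtain X0 where X0: "x \<in> X0" "open X0" "\<forall>x'\<in>X0 \<inter> UNIV. \<forall>t\<in>Y. dist (k t x') (k t x) \<le> e"
    by auto
  then obtain d where "d > 0" "ball x d \<subseteq> X0" by (meson open_contains_ball)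
  then show thesis using X0 that[of d]
    by (auto simp: dist_norm norm_minus_commute subset_iff)
qed

lemma continuous_integral:
  fixes k :: "'y \<Rightarrow> 'a::euclidean_space \<Rightarrow> complex"
  assumes k: "smooth_family W Y k"
  shows "continuous_on UNIV (\<lambda>x. LINT y:Y|\<nu>. k y x)"
  unfolding continuous_on_iff
proof (intro ballI allI impI)
  fix x :: 'a and e :: real assume "e > 0"
  \<comment> \<open>The added 1 keeps the denominator positive when \<open>Y\<close> is a null set,
    and the factor 1/2 makes the final estimate strict.\<close>
  define e' where "e' = e / 2 / (measure \<nu> Y + 1)"
  have e': "e' > 0" using \<open>e > 0\<close> by (simp add: e'_def add_nonneg_pos)
  obtain d where d: "d > 0" "\<And>y x'. y \<in> Y \<Longrightarrow> norm (x' - x) < d \<Longrightarrow> norm (k y x' - k y x) \<le> e'"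
    using uniform_in_parameter[OF smooth_family_continuous[OF k] e'] by metis
  note c = smooth_family_continuous_param[OF k]
  have "dist (LINT y:Y|\<nu>. k y x') (LINT y:Y|\<nu>. k y x) < e" if x': "dist x' x < d" for x'
  proof -
    have "norm (LINT y:Y|\<nu>. k y x' - k y x) \<le> e' * measure \<nu> Y"
      by (rule norm_set_integral_le) (use d x' in \<open>auto simp: dist_norm intro!: continuous_intros c\<close>)
    also have "\<dots> = e / 2 * (measure \<nu> Y / (measure \<nu> Y + 1))"
      by (simp add: e'_def)
    also have "\<dots> \<le> e / 2 * 1"
      using \<open>e > 0\<close> by (intro mult_left_mono) (auto simp: divide_le_eq_1 add_nonneg_pos)
    finally show ?thesis
      using \<open>e > 0\<close> by (simp add: dist_norm set_integral_diff[OF set_integrable_continuous set_integrable_continuous] c)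
  qed
  then show "\<exists>d>0. \<forall>x'\<in>UNIV. dist x' x < d \<longrightarrow> dist (LINT y:Y|\<nu>. k y x') (LINT y:Y|\<nu>. k y x) < e"
    using d(1) by blast
qed

text \<open>The basis derivatives are continuous at \<open>x\<close> uniformly in the parameter, so
  the mean value inequality bounds the error of linearisation of all \<open>k y\<close> at once, and
  this bound survives integration.\<close>

lemma has_derivative_integral:
  fixes k :: "'y \<Rightarrow> 'a::euclidean_space \<Rightarrow> complex"
  assumes k: "smooth_family W Y k"
  shows "((\<lambda>x. LINT y:Y|\<nu>. k y x) has_derivative
    (\<lambda>h. \<Sum>b\<in>Basis. of_real (h \<bullet> b) * (LINT y:Y|\<nu>. dir_deriv b (k y) x))) (at x)"
  unfolding has_derivative_at_alt
proof (intro conjI allI impI)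
  show "bounded_linear (\<lambda>h::'a. \<Sum>b\<in>Basis. complex_of_real (h \<bullet> b) * (LINT y:Y|\<nu>. dir_deriv b (k y) x))"
    by (intro bounded_linear_sum bounded_linear_compose[OF bounded_linear_mult_left]
        bounded_linear_compose[OF bounded_linear_of_real] bounded_linear_inner_left)
  fix e :: real assume "e > 0"
  let ?n = "real DIM('a)"
  \<comment> \<open>Division by the dimension: an error \<open>e'\<close> is allowed in each basis
    direction.\<close>
  define e' where "e' = e / (measure \<nu> Y + 1) / ?n"
  have e': "e' > 0" using \<open>e > 0\<close> by (simp add: e'_def add_nonneg_pos)
  have "\<exists>d>0. \<forall>y\<in>Y. \<forall>x'. norm (x' - x) < d \<longrightarrow> norm (dir_deriv b (k y) x' - dir_deriv b (k y) x) \<le> e'"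
    if "b \<in> Basis" for b
    using uniform_in_parameter[OF smooth_family_continuous[OF smooth_family_Basis_deriv[OF k that]] e'] by metis
  then obtain d where d: "\<And>b. b \<in> Basis \<Longrightarrow> d b > 0"
    "\<And>b y x'. b \<in> Basis \<Longrightarrow> y \<in> Y \<Longrightarrow> norm (x' - x) < d b \<Longrightarrow> norm (dir_deriv b (k y) x' - dir_deriv b (k y) x) \<le> e'"
    by metis
  define D where "D = Min (d ` Basis)"
  have D: "D > 0" unfolding D_def using d by auto
  have Dd: "D \<le> d b" if "b \<in> Basis" for b unfolding D_def using that by auto
  note c = smooth_family_continuous_param[OF k]
  note cd = smooth_family_continuous_param[OF smooth_family_Basis_deriv[OF k]]
  note df = smooth_family_differentiable[OF k]
  have lin: "norm (k y x' - k y x - dir_deriv (x' - x) (k y) x) \<le> norm (x' - x) * (?n * e')"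
    if y: "y \<in> Y" and x': "norm (x' - x) < D" for y x'
  proof (rule differentiable_bound_linearization[where S="ball x D" and f'="\<lambda>x h. dir_deriv h (k y) x"])
    fix t :: real assume t: "t \<in> {0..1}"
    have "norm (t *\<^sub>R (x' - x)) \<le> norm (x' - x)" using t by (simp add: mult_left_le_one_le)
    with x' show "x + t *\<^sub>R (x' - x) \<in> ball x D" by (simp add: dist_norm)
  next
    fix z show "(k y has_derivative (\<lambda>h. dir_deriv h (k y) z)) (at z within ball x D)"
      by (rule has_derivative_at_withinI[OF has_derivative_dir_deriv[OF df[OF y]]])
  next
    fix z assume z: "z \<in> ball x D"
    show "onorm ((\<lambda>h. dir_deriv h (k y) z) - (\<lambda>h. dir_deriv h (k y) x)) \<le> ?n * e'"
    proof (rule onorm_bound)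
      fix h :: 'a
      have "((\<lambda>h. dir_deriv h (k y) z) - (\<lambda>h. dir_deriv h (k y) x)) h
        = (\<Sum>b\<in>Basis. of_real (h \<bullet> b) * (dir_deriv b (k y) z - dir_deriv b (k y) x))"
        by (simp add: dir_deriv_expand[OF df[OF y], of h] sum_subtractf algebra_simps)
      also have "norm \<dots> \<le> (\<Sum>b\<in>(Basis::'a set). norm h * e')"
      proof (rule sum_norm_le)
        fix b :: 'a assume b: "b \<in> Basis"
        have "norm (z - x) < d b" using z Dd[OF b] by (simp add: dist_norm norm_minus_commute)
        then show "norm (complex_of_real (h \<bullet> b) * (dir_deriv b (k y) z - dir_deriv b (k y) x)) \<le> norm h * e'"
          unfolding norm_mult using d(2)[OF b y] Basis_le_norm[OF b] by (intro mult_mono) auto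
      qed
      finally show "norm (((\<lambda>h. dir_deriv h (k y) z) - (\<lambda>h. dir_deriv h (k y) x)) h) \<le> ?n * e' * norm h"
        by (simp add: mult_ac)
    qed (use e' in simp)
  qed (use D in auto)
  show "\<exists>d>0. \<forall>x'. norm (x' - x) < d \<longrightarrow>
      norm ((LINT y:Y|\<nu>. k y x') - (LINT y:Y|\<nu>. k y x) -
        (\<Sum>b\<in>Basis. of_real ((x' - x) \<bullet> b) * (LINT y:Y|\<nu>. dir_deriv b (k y) x))) \<le> e * norm (x' - x)"
  proof (intro exI[of _ D] conjI D allI impI)
    fix x' assume x': "norm (x' - x) < D"
    have cd': "continuous_on Y (\<lambda>y. dir_deriv (x' - x) (k y) x)"
      using cd by (subst continuous_on_cong[OF refl dir_deriv_expand[OF df]]) (auto intro!: continuous_intros)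
    have "(LINT y:Y|\<nu>. dir_deriv (x' - x) (k y) x) = (LINT y:Y|\<nu>. \<Sum>b\<in>Basis. of_real ((x' - x) \<bullet> b) * dir_deriv b (k y) x)"
      by (intro set_lebesgue_integral_cong Y_sets) (use df dir_deriv_expand in blast)
    also have "\<dots> = (\<Sum>b\<in>Basis. of_real ((x' - x) \<bullet> b) * (LINT y:Y|\<nu>. dir_deriv b (k y) x))"
      unfolding set_lebesgue_integral_def scaleR_sum_right
      by (subst Bochner_Integration.integral_sum)
        (auto intro!: set_integrable_continuous[unfolded set_integrable_def] continuous_intros cd
          simp flip: mult_scaleR_right)
    finally have 1: "(\<Sum>b\<in>Basis. of_real ((x' - x) \<bullet> b) * (LINT y:Y|\<nu>. dir_deriv b (k y) x))
      = (LINT y:Y|\<nu>. dir_deriv (x' - x) (k y) x)" ..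
    have "norm (LINT y:Y|\<nu>. k y x' - k y x - dir_deriv (x' - x) (k y) x) \<le> norm (x' - x) * (?n * e') * measure \<nu> Y"
      by (rule norm_set_integral_le) (use lin x' in \<open>auto intro!: continuous_intros c cd'\<close>)
    also have "\<dots> = norm (x' - x) * (e * (measure \<nu> Y / (measure \<nu> Y + 1)))"
      by (simp add: e'_def)
    also have "\<dots> \<le> norm (x' - x) * (e * 1)"
      using \<open>e > 0\<close> by (intro mult_left_mono) (auto simp: divide_le_eq_1 add_nonneg_pos)
    finally show "norm ((LINT y:Y|\<nu>. k y x') - (LINT y:Y|\<nu>. k y x) -
        (\<Sum>b\<in>Basis. of_real ((x' - x) \<bullet> b) * (LINT y:Y|\<nu>. dir_deriv b (k y) x))) \<le> e * norm (x' - x)"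
      unfolding 1
      by (simp add: set_integral_diff set_integrable_continuous continuous_intros c cd' mult_ac)
  qed
qed

lemma dir_deriv_integral:
  assumes "smooth_family W Y k" "b \<in> Basis"
  shows "dir_deriv b (\<lambda>x. LINT y:Y|\<nu>. k y x) x = (LINT y:Y|\<nu>. dir_deriv b (k y) x)"
  unfolding dir_deriv_eqI[OF has_derivative_integral[OF assms(1)]]
  using assms(2) by (simp add: inner_Basis if_distrib[of complex_of_real] if_distrib[of "\<lambda>x. x * _"] sum.delta' cong: if_cong)

text \<open>The integral depends on no parameter, but as a constant family over any index set
  \<open>Z\<close> it can be fed back into the calculus of families. The coinduction runs over the
  class of all such integrals.\<close>

lemma smooth_family_integral:
  fixes k :: "'y \<Rightarrow> 'a::euclidean_space \<Rightarrow> complex" and Z :: "'z::metric_space set"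
  assumes "smooth_family W Y k"
  shows "smooth_family W Z (\<lambda>_ x. LINT y:Y|\<nu>. k y x)"
proof (rule smooth_family_coinduct[where P="\<lambda>f. \<exists>k. smooth_family W Y k \<and> f = (\<lambda>_ x. LINT y:Y|\<nu>. k y x)"])
  show "\<exists>k'. smooth_family W Y k' \<and> (\<lambda>_ x. LINT y:Y|\<nu>. k y x) = (\<lambda>_ x. LINT y:Y|\<nu>. k' y x)"
    using assms by blast
next
  fix f :: "'z \<Rightarrow> 'a \<Rightarrow> complex"
  assume "\<exists>k. smooth_family W Y k \<and> f = (\<lambda>_ x. LINT y:Y|\<nu>. k y x)"
  then obtain k where k: "smooth_family W Y k" "f = (\<lambda>_ x. LINT y:Y|\<nu>. k y x)" by auto
  obtain C where C: "\<And>y x. y \<in> Y \<Longrightarrow> norm (k y x) \<le> C * W x" using smooth_family_bound[OF k(1)] by blast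
  have "norm (LINT y:Y|\<nu>. k y x) \<le> C * measure \<nu> Y * W x" for x
    using norm_set_integral_le[OF smooth_family_continuous_param[OF k(1)] C] by (simp add: mult_ac)
  moreover have "continuous_on (Z \<times> UNIV) (\<lambda>p. LINT y:Y|\<nu>. k y (snd p))"
    by (rule continuous_on_compose2[OF continuous_integral[OF k(1)]]) (auto intro: continuous_intros)
  ultimately show "ck_family 0 W Z f" by (auto simp: k(2) case_prod_unfold)
  show "f z differentiable (at x)" for z x
    unfolding k(2) using has_derivative_integral[OF k(1)] by (auto simp: differentiable_def)
  show "\<exists>k. smooth_family W Y k \<and> (\<lambda>z. dir_deriv b (f z)) = (\<lambda>_ x. LINT y:Y|\<nu>. k y x)" if "b \<in> Basis" for b
    by (intro exI[of _ "\<lambda>y. dir_deriv b (k y)"] conjI smooth_family_Basis_deriv k(1) that)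
      (simp add: k(2) fun_eq_iff dir_deriv_integral[OF k(1) that])
qed

end

subsection \<open>Smooth functions and bump functions\<close>

lemma C_k_Suc_dir_deriv:
  "C_k (Suc k) f \<longleftrightarrow> (\<forall>x. f differentiable (at x)) \<and> (\<forall>b\<in>Basis. C_k k (dir_deriv b f))"
  by (simp add: dir_deriv_def[abs_def])

lemma C_k_mono: "C_k (Suc k) f \<Longrightarrow> C_k k f"
proof (induction k arbitrary: f)
  case 0
  then have "\<forall>x. f differentiable (at x)" using C_k.simps(2) by blast
  then show ?case by (auto intro!: continuous_at_imp_continuous_on differentiable_imp_continuous_within)
next
  case (Suc k)
  then show ?case by (metis C_k.simps(2))
qed

lemma C_k_add:
  fixes f g :: "'a::euclidean_space \<Rightarrow> complex"
  shows "C_k k f \<Longrightarrow> C_k k g \<Longrightarrow> C_k k (\<lambda>x. f x + g x)"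
proof (induction k arbitrary: f g)
  case 0
  then show ?case by (auto intro: continuous_intros)
next
  case (Suc k)
  then have d: "\<And>x. f differentiable (at x)" "\<And>x. g differentiable (at x)"
    and C: "\<And>b. b \<in> Basis \<Longrightarrow> C_k k (dir_deriv b f)" "\<And>b. b \<in> Basis \<Longrightarrow> C_k k (dir_deriv b g)"
    by (simp_all only: C_k_Suc_dir_deriv)
  have e: "dir_deriv b (\<lambda>x. f x + g x) = (\<lambda>x. dir_deriv b f x + dir_deriv b g x)" for b
    using d by (auto simp: dir_deriv_add)
  show ?case unfolding C_k_Suc_dir_deriv e using d C Suc.IH by (auto intro: derivative_intros)
qed

lemma C_k_mult:
  fixes f g :: "'a::euclidean_space \<Rightarrow> complex"
  shows "C_k k f \<Longrightarrow> C_k k g \<Longrightarrow> C_k k (\<lambda>x. f x * g x)"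
proof (induction k arbitrary: f g)
  case 0
  then show ?case by (auto intro: continuous_intros)
next
  case (Suc k)
  then have d: "\<And>x. f differentiable (at x)" "\<And>x. g differentiable (at x)"
    and C: "\<And>b. b \<in> Basis \<Longrightarrow> C_k k (dir_deriv b f)" "\<And>b. b \<in> Basis \<Longrightarrow> C_k k (dir_deriv b g)"
    by (simp_all only: C_k_Suc_dir_deriv)
  have e: "dir_deriv b (\<lambda>x. f x * g x) = (\<lambda>x. f x * dir_deriv b g x + dir_deriv b f x * g x)" for b
    using d by (auto simp: dir_deriv_mult)
  show ?case unfolding C_k_Suc_dir_deriv e
    using d C Suc C_k_mono[OF Suc.prems(1)] C_k_mono[OF Suc.prems(2)]
    by (auto intro: derivative_intros C_k_add)
qed

lemma C_k_const: "C_k k (\<lambda>x. c::complex)"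
  by (induction k arbitrary: c) (simp_all only: C_k_Suc_dir_deriv dir_deriv_const, auto)

lemma C_k_coord: "C_k k (\<lambda>x. complex_of_real ((x - c) \<bullet> b))"
proof -
  have "C_k k (\<lambda>x. complex_of_real (x \<bullet> b))" for k
  proof (cases k)
    case (Suc j)
    then show ?thesis
      by (simp only: C_k_Suc_dir_deriv dir_deriv_coord)
        (auto simp: C_k_const intro!: bounded_linear_imp_differentiable
          bounded_linear_compose[OF bounded_linear_of_real] bounded_linear_inner_left)
  qed (auto intro: continuous_intros)
  from C_k_add[OF this C_k_const, of k "- complex_of_real (c \<bullet> b)"]
  show ?thesis by (simp add: inner_diff_left)
qed

lemma dir_deriv_radial:
  fixes \<phi> :: "real \<Rightarrow> complex" and c :: "'a::euclidean_space"
  assumes "\<phi> differentiable (at ((norm (x - c))\<^sup>2))"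
  shows "dir_deriv b (\<lambda>x. \<phi> ((norm (x - c))\<^sup>2)) x = dir_deriv 1 \<phi> ((norm (x - c))\<^sup>2) * of_real (2 * ((x - c) \<bullet> b))"
    and "(\<lambda>x. \<phi> ((norm (x - c))\<^sup>2)) differentiable (at x)"
proof -
  have "((\<lambda>x. (norm (x - c))\<^sup>2) has_derivative (\<lambda>h. 2 * ((x - c) \<bullet> h))) (at x)"
    unfolding power2_norm_eq_inner by (auto intro!: derivative_eq_intros simp: inner_commute)
  from has_derivative_compose[OF this has_derivative_dir_deriv[OF assms]]
  have "((\<lambda>x. \<phi> ((norm (x - c))\<^sup>2)) has_derivative
      (\<lambda>h. dir_deriv (2 * ((x - c) \<bullet> h)) \<phi> ((norm (x - c))\<^sup>2))) (at x)" .
  then show "dir_deriv b (\<lambda>x. \<phi> ((norm (x - c))\<^sup>2)) x = dir_deriv 1 \<phi> ((norm (x - c))\<^sup>2) * of_real (2 * ((x - c) \<bullet> b))"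
      "(\<lambda>x. \<phi> ((norm (x - c))\<^sup>2)) differentiable (at x)"
    using dir_deriv_expand[OF assms, of "2 * ((x - c) \<bullet> b)"]
    by (auto simp: dir_deriv_eqI mult_ac differentiable_def)
qed

lemma C_k_radial:
  fixes \<phi> :: "real \<Rightarrow> complex" and c :: "'a::euclidean_space"
  shows "C_k k \<phi> \<Longrightarrow> C_k k (\<lambda>x. \<phi> ((norm (x - c))\<^sup>2))"
proof (induction k arbitrary: \<phi>)
  case 0
  then have "continuous_on UNIV \<phi>" by simp
  moreover have "continuous_on UNIV (\<lambda>x::'a. (norm (x - c))\<^sup>2)" by (intro continuous_intros)
  ultimately show ?case using continuous_on_compose2 by fastforce
next
  case (Suc k)
  then have d: "\<And>x. \<phi> differentiable (at x)" and C: "C_k k (dir_deriv 1 \<phi>)"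
    by (simp_all only: C_k_Suc_dir_deriv) auto
  have e: "dir_deriv b (\<lambda>x. \<phi> ((norm (x - c))\<^sup>2)) =
    (\<lambda>x. dir_deriv 1 \<phi> ((norm (x - c))\<^sup>2) * (2 * of_real ((x - c) \<bullet> b)))" for b
    using dir_deriv_radial(1)[OF d] by (auto simp: fun_eq_iff)
  show ?case unfolding C_k_Suc_dir_deriv e
    by (intro conjI allI ballI dir_deriv_radial(2) d C_k_mult Suc.IH C C_k_const C_k_coord)
qed

lemma smooth_dir_deriv: "smooth f \<Longrightarrow> b \<in> Basis \<Longrightarrow> smooth (dir_deriv b f)"
  unfolding smooth_def by (metis C_k_Suc_dir_deriv)

lemma smooth_differentiable: "smooth f \<Longrightarrow> (f :: 'a::euclidean_space \<Rightarrow> complex) differentiable (at x)"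
  unfolding smooth_def by (metis C_k_Suc_dir_deriv)

lemma smooth_continuous: "smooth f \<Longrightarrow> continuous_on A f"
  unfolding smooth_def by (metis C_k.simps(1) continuous_on_subset subset_UNIV)

lemma smooth_add: "smooth f \<Longrightarrow> smooth g \<Longrightarrow> smooth (\<lambda>x. f x + g x :: complex)"
  and smooth_mult: "smooth f \<Longrightarrow> smooth g \<Longrightarrow> smooth (\<lambda>x. f x * g x :: complex)"
  and smooth_const: "smooth (\<lambda>x. c :: complex)"
  and smooth_coord: "smooth (\<lambda>x. complex_of_real ((x - e) \<bullet> b))"
  unfolding smooth_def by (auto intro: C_k_add C_k_mult C_k_const C_k_coord)

lemma smooth_radial: "smooth \<phi> \<Longrightarrow> smooth (\<lambda>x. \<phi> ((norm (x - c))\<^sup>2) :: complex)"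
  unfolding smooth_def by (auto intro: C_k_radial)

lemma smooth_of_real_vector_derivative:
  fixes G g :: "real \<Rightarrow> complex"
  assumes "\<And>x. (G has_vector_derivative g x) (at x)"
  shows "G differentiable (at x)" "dir_deriv 1 G = g"
  using assms dir_deriv_eqI[OF assms[unfolded has_vector_derivative_def]]
  by (auto simp: differentiable_def fun_eq_iff has_vector_derivative_def)

lemma smooth_antiderivative:
  fixes G g :: "real \<Rightarrow> complex"
  assumes "\<And>x. (G has_vector_derivative g x) (at x)" "smooth g"
  shows "smooth G"
proof -
  have "C_k (Suc k) G" for k
    using assms(2) smooth_of_real_vector_derivative[of G g, OF assms(1)]
    unfolding C_k_Suc_dir_deriv by (auto simp: smooth_def)
  then show ?thesis unfolding smooth_def using C_k_mono by blast
qed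

text \<open>To the right of the support the primitive is constant rather than zero. This plateau is
  what makes the smooth step, and it is also the reason why radial functions that are constant near
  infinity enter later.\<close>

lemma antiderivative_compact_support:
  fixes g :: "real \<Rightarrow> complex"
  assumes g: "smooth g" "\<And>x. x \<notin> {A..B} \<Longrightarrow> g x = 0" and "A \<le> B"
  obtains G where "smooth G" "dir_deriv 1 G = g" "\<And>x. x \<le> A \<Longrightarrow> G x = 0"
    "\<And>x. B \<le> x \<Longrightarrow> G x = integral {A..B} g"
proof -
  \<comment> \<open>Starting at \<open>A - 1\<close> makes \<open>A\<close> an interior point, so
    that the derivative there is two-sided.\<close>
  define G where "G x = integral {A - 1..x} g" for x
  have int: "g integrable_on {a..b}" for a b
    by (intro integrable_continuous_interval smooth_continuous g)
  have z: "G x = 0" if "x \<le> A" for x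
  proof -
    have "g y = 0" if "y \<in> {A - 1..x} - {A}" for y using that \<open>x \<le> A\<close> g(2)[of y] by auto
    then have "integral {A - 1..x} g = integral {A - 1..x} (\<lambda>_. 0)"
      by (intro integral_spike[of "{A}"]) auto
    then show ?thesis by (simp add: G_def)
  qed
  have d: "(G has_vector_derivative g x) (at x)" for x
  proof (cases "x < A")
    case True
    have "((\<lambda>_. 0) has_vector_derivative g x) (at x)" using g(2)[of x] True by simp
    then show ?thesis
      by (rule has_vector_derivative_transform_within_open[of _ _ _ "{..<A}"]) (use True z in auto)
  next
    case False
    have "((\<lambda>u. integral {A - 1..u} g) has_vector_derivative g x) (at x within {A - 1..x + 1})"
      by (rule integral_has_vector_derivative) (use False smooth_continuous[OF g(1)] in auto)
    then have "((\<lambda>u. integral {A - 1..u} g) has_vector_derivative g x) (at x)"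
      using False by (subst (asm) at_within_interior) (auto simp: interior_cbox[of "A - 1" "x + 1", simplified])
    then show ?thesis by (simp add: G_def[abs_def])
  qed
  have c: "G x = integral {A..B} g" if "B \<le> x" for x
  proof -
    have "integral {B..x} g = integral {B..x} (\<lambda>_. 0)"
      by (rule integral_spike[of "{B}"]) (use g(2) in auto)
    then have "integral {A..x} g = integral {A..B} g"
      using Henstock_Kurzweil_Integration.integral_combine[OF \<open>A \<le> B\<close> that int] by simp
    then show ?thesis unfolding G_def
      using Henstock_Kurzweil_Integration.integral_combine[of "A - 1" A x g, OF _ _ int] z[of A] that \<open>A \<le> B\<close>
      by (simp add: G_def)
  qed
  show thesis
    by (rule that[of G]) (use smooth_antiderivative[of G g, OF d g(1)] smooth_of_real_vector_derivative[of G g, OF d] z c in auto)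
qed

lemma smooth_affine_real:
  fixes f :: "real \<Rightarrow> complex"
  shows "smooth f \<Longrightarrow> smooth (\<lambda>x. f (a * x + b))"
proof -
  have "C_k k f \<Longrightarrow> C_k k (\<lambda>x. f (a * x + b))" for k and f :: "real \<Rightarrow> complex"
  proof (induction k arbitrary: f)
    case 0
    then have "continuous_on UNIV f" by simp
    moreover have "continuous_on UNIV (\<lambda>x. a * x + b)" by (intro continuous_intros)
    ultimately show ?case using continuous_on_compose2 by fastforce
  next
    case (Suc k)
    then have d: "\<And>x. f differentiable (at x)" and C: "C_k k (dir_deriv 1 f)"
      by (simp_all only: C_k_Suc_dir_deriv) auto
    have L: "bounded_linear (\<lambda>x. a * x)" by (rule bounded_linear_mult_right)
    have e: "dir_deriv 1 (\<lambda>x. f (a * x + b)) = (\<lambda>x. of_real a * dir_deriv 1 f (a * x + b))"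
      using dir_deriv_affine(1)[OF L d, of 1 b] dir_deriv_expand[OF d, of a] by (auto simp: fun_eq_iff)
    show ?case unfolding C_k_Suc_dir_deriv
      using dir_deriv_affine(2)[OF L d, of b] by (auto simp: e intro!: C_k_mult C_k_const Suc.IH C)
  qed
  then show "smooth f \<Longrightarrow> smooth (\<lambda>x. f (a * x + b))" by (simp add: smooth_def)
qed

text \<open>The functions \<open>p(1/x) e\<^sup>-\<^sup>1\<^sup>/\<^sup>x\<close>, extended by 0 to \<open>x \<le> 0\<close>, are closed under differentiation.\<close>

definition flat_exp :: "real poly \<Rightarrow> real \<Rightarrow> real" where
  "flat_exp p x = (if x > 0 then poly p (1 / x) * exp (- (1 / x)) else 0)"

lemma tendsto_poly_exp: "((\<lambda>u. poly p u * exp (- u)) \<longlongrightarrow> (0::real)) at_top"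
proof -
  have "((\<lambda>u. \<Sum>i\<le>degree p. coeff p i * (u ^ i / exp u)) \<longlongrightarrow> (\<Sum>i\<le>degree p. coeff p i * (0::real))) at_top"
    by (intro tendsto_intros tendsto_power_div_exp_0)
  moreover have "(\<lambda>u. \<Sum>i\<le>degree p. coeff p i * (u ^ i / exp u)) = (\<lambda>u::real. poly p u * exp (- u))"
    by (simp add: fun_eq_iff poly_altdef sum_distrib_right exp_minus divide_inverse mult.assoc)
  ultimately show ?thesis by simp
qed

text \<open>With \<open>u = 1/x\<close>, differentiation turns \<open>p(u) exp(-u)\<close> into
  \<open>u^2 (p - p')(u) exp(-u)\<close>, whence the factor \<open>[:0, 0, 1:]\<close>. At 0 the
  difference quotient costs one factor \<open>u\<close>, and the exponential beats every
  polynomial.\<close>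

lemma flat_exp_deriv:
  "(flat_exp p has_real_derivative flat_exp ([:0, 0, 1:] * (p - pderiv p)) x) (at x)"
proof -
  consider "x < 0" | "x > 0" | "x = 0" by linarith
  then show ?thesis
  proof cases
    case 1
    have "((\<lambda>_. 0) has_real_derivative flat_exp ([:0, 0, 1:] * (p - pderiv p)) x) (at x)"
      using 1 by (simp add: flat_exp_def)
    then show ?thesis
      by (rule has_field_derivative_transform_within_open[of _ _ _ "{..<0}"]) (use 1 in \<open>auto simp: flat_exp_def\<close>)
  next
    case 2
    have "((\<lambda>x. poly p (1 / x) * exp (- (1 / x))) has_real_derivative flat_exp ([:0, 0, 1:] * (p - pderiv p)) x) (at x)"
      using 2 by (auto intro!: derivative_eq_intros DERIV_chain2[OF poly_DERIV] simp: flat_exp_def divide_simps algebra_simps)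
    then show ?thesis
      by (rule has_field_derivative_transform_within_open[of _ _ _ "{0<..}"]) (use 2 in \<open>auto simp: flat_exp_def\<close>)
  next
    case 3
    have "((\<lambda>h. poly ([:0, 1:] * p) (inverse h) * exp (- inverse h)) \<longlongrightarrow> 0) (at_right (0::real))"
      by (rule filterlim_compose[OF tendsto_poly_exp filterlim_inverse_at_top_right])
    then have "((\<lambda>h. flat_exp p h / h) \<longlongrightarrow> 0) (at_right 0)"
      by (rule tendsto_cong[THEN iffD1, rotated])
        (auto simp: eventually_at_filter flat_exp_def divide_inverse mult_ac)
    moreover have "((\<lambda>h. flat_exp p h / h) \<longlongrightarrow> 0) (at_left 0)"
      by (rule tendsto_eventually) (auto simp: eventually_at_filter flat_exp_def)
    ultimately have "((\<lambda>h. flat_exp p h / h) \<longlongrightarrow> 0) (at 0)" by (simp add: filterlim_split_at)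
    then show ?thesis using 3 by (simp add: DERIV_def flat_exp_def)
  qed
qed

lemma smooth_flat_exp: "smooth (\<lambda>x. complex_of_real (flat_exp p x))"
proof -
  have "C_k k (\<lambda>x. complex_of_real (flat_exp p x))" for k
  proof (induction k arbitrary: p)
    case 0
    then show ?case
      using flat_exp_deriv by (auto intro!: continuous_intros DERIV_continuous_on[of _ "flat_exp p"])
  next
    case (Suc k)
    have "((\<lambda>x. complex_of_real (flat_exp p x)) has_vector_derivative
        complex_of_real (flat_exp ([:0, 0, 1:] * (p - pderiv p)) x)) (at x)" for x
      using flat_exp_deriv by (intro has_vector_derivative_of_real)
        (auto simp: has_real_derivative_iff_has_vector_derivative)
    from smooth_of_real_vector_derivative[OF this]
    show ?case unfolding C_k_Suc_dir_deriv using Suc.IH by auto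
  qed
  then show ?thesis unfolding smooth_def by blast
qed

lemma smooth_step_exists:
  "\<exists>\<theta>::real \<Rightarrow> complex. smooth \<theta> \<and> (\<forall>x\<le>1. \<theta> x = 1) \<and> (\<forall>x\<ge>2. \<theta> x = 0)"
proof -
  \<comment> \<open>Positive inside \<open>(0, 1)\<close> and flat at both ends; its normalised
    primitive is the step. The form \<open>- 1 * x + 1\<close> is the one expected by
    \<open>smooth_affine_real\<close>.\<close>
  define b :: "real \<Rightarrow> real" where "b x = flat_exp 1 x * flat_exp 1 (- 1 * x + 1)" for x
  have b: "smooth (\<lambda>x. complex_of_real (b x))"
    unfolding b_def of_real_mult by (intro smooth_mult smooth_flat_exp smooth_affine_real)
  have b0: "b x = 0" if "x \<notin> {0..1}" for x using that by (auto simp: b_def flat_exp_def)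
  obtain G where G: "smooth G" "dir_deriv 1 G = (\<lambda>x. of_real (b x))" "\<And>x. x \<le> 0 \<Longrightarrow> G x = 0"
    "\<And>x. 1 \<le> x \<Longrightarrow> G x = integral {0..1} (\<lambda>x. complex_of_real (b x))"
    using antiderivative_compact_support[OF b, of 0 1] b0 by auto
  have cb: "continuous_on {0..1} b"
    using smooth_continuous[OF b, of "{0..1}"] by (simp add: continuous_on_of_real_o_iff[unfolded o_def])
  have bpos: "b x \<ge> 0" for x by (auto simp: b_def flat_exp_def)
  have "integral {0..1} b \<noteq> 0"
  proof
    assume "integral {0..1} b = 0"
    then have "(b has_integral 0) (cbox 0 1)"
      using integrable_continuous_interval[OF cb] by (simp add: has_integral_integral)
    then have "b (1/2) = 0"
      by (rule has_integral_0_cbox_imp_0[rotated 2]) (use cb bpos in auto)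
    then show False by (simp add: b_def flat_exp_def)
  qed
  moreover have "integral {0..1} (\<lambda>x. complex_of_real (b x)) = of_real (integral {0..1} b)"
    using integral_linear[OF integrable_continuous_interval[OF cb] bounded_linear_of_real]
    by (simp add: o_def)
  ultimately have I: "integral {0..1} (\<lambda>x. complex_of_real (b x)) \<noteq> 0" by simp
  \<comment> \<open>The primitive passes from 0 at 0 to the full integral at 1. Normalised, reversed
    and shifted by 1, it passes from 1 at 1 to 0 at 2.\<close>
  define \<theta> where "\<theta> x = 1 + (- 1 / integral {0..1} (\<lambda>x. complex_of_real (b x))) * G (1 * x + (- 1))" for x
  have "smooth \<theta>" unfolding \<theta>_def
    by (intro smooth_add smooth_mult smooth_const smooth_affine_real G)
  moreover have "\<theta> x = 1" if "x \<le> 1" for x using that by (simp add: \<theta>_def G)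
  moreover have "\<theta> x = 0" if "x \<ge> 2" for x using that I by (simp add: \<theta>_def G)
  ultimately show ?thesis by blast
qed

definition smooth_step :: "real \<Rightarrow> complex" where
  "smooth_step = (SOME \<theta>. smooth \<theta> \<and> (\<forall>x\<le>1. \<theta> x = 1) \<and> (\<forall>x\<ge>2. \<theta> x = 0))"

lemma smooth_step:
  "smooth smooth_step" "x \<le> 1 \<Longrightarrow> smooth_step x = 1" "x \<ge> 2 \<Longrightarrow> smooth_step x = 0"
  using someI_ex[OF smooth_step_exists] unfolding smooth_step_def by auto

text \<open>Using the squared norm keeps the cut-off smooth at the origin, and makes its product
  with a radial function radial about the same centre.\<close>

definition bump :: "'a::euclidean_space \<Rightarrow> complex" where
  "bump x = smooth_step ((norm x)\<^sup>2)"

lemma smooth_bump: "smooth bump"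
  using smooth_radial[OF smooth_step(1), of 0] by (simp add: bump_def[abs_def])

lemma bump_1: "norm x \<le> 1 \<Longrightarrow> bump x = 1"
  by (simp add: bump_def smooth_step power_le_one)

lemma bump_0: "norm x \<ge> 2 \<Longrightarrow> bump x = 0"
  unfolding bump_def
proof (rule smooth_step(3))
  assume "norm x \<ge> 2"
  then have "2^2 \<le> (norm x)^2" by (intro power_mono) auto
  then show "2 \<le> (norm x)\<^sup>2" by simp
qed

subsection \<open>Differential operators and measures\<close>

lemma smooth_family_smooth:
  assumes "smooth_family W Y f" "y \<in> Y"
  shows "smooth (f y)"
proof -
  have "C_k m (f y)" if "ck_family m W Y f" for m f
    using that
  proof (induction m arbitrary: f)
    case 0
    have "continuous_on UNIV (\<lambda>x. (y, x))" by (intro continuous_intros)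
    from continuous_on_compose2[OF _ this, of "Y \<times> UNIV" "\<lambda>(y, x). f y x"] 0 assms(2)
    show ?case by auto
  next
    case (Suc m)
    then have "C_k m (dir_deriv b (f y))" if "b \<in> Basis" for b
      using Suc.IH[of "\<lambda>y. dir_deriv b (f y)"] that by auto
    then show ?case using Suc.prems assms(2) unfolding C_k_Suc_dir_deriv by auto
  qed
  then show ?thesis using assms(1) unfolding smooth_def smooth_family_def by blast
qed

lemma smooth_family_constant_param:
  assumes "smooth_family W Z (\<lambda>_. f)" "Z \<noteq> {}"
  shows "smooth_family W Y (\<lambda>_. f)"
proof -
  obtain z where "z \<in> Z" using assms(2) by blast
  then show ?thesis using smooth_family_reindex[OF assms(1), of Y "\<lambda>_. z"] by auto
qed

lemma smooth_family_member:
  "smooth_family W Y f \<Longrightarrow> y \<in> Y \<Longrightarrow> smooth_family W Z (\<lambda>_. f y)"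
  using smooth_family_reindex[of W Y f Z "\<lambda>_. y"] by auto

text \<open>The quotient \<open>f / W\<close> is bounded on the compact set \<open>C\<close>, so any
  positive continuous weight is admissible; derivatives of \<open>f\<close> vanish off the same
  \<open>C\<close>.\<close>

lemma smooth_family_compact_support:
  fixes f :: "'a::euclidean_space \<Rightarrow> complex"
  assumes f: "smooth f" "\<And>x. x \<notin> C \<Longrightarrow> f x = 0" and C: "compact C"
    and W: "continuous_on UNIV W" "\<And>x. W x > 0"
  shows "smooth_family W Y (\<lambda>_. f)"
proof (rule smooth_family_coinduct[where P="\<lambda>k. \<exists>f. smooth f \<and> (\<forall>x. x \<notin> C \<longrightarrow> f x = 0) \<and> k = (\<lambda>_. f)"])
  show "\<exists>g. smooth g \<and> (\<forall>x. x \<notin> C \<longrightarrow> g x = 0) \<and> (\<lambda>_. f) = (\<lambda>_. g)" using f by blast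
next
  fix k :: "'b \<Rightarrow> 'a \<Rightarrow> complex"
  assume "\<exists>f. smooth f \<and> (\<forall>x. x \<notin> C \<longrightarrow> f x = 0) \<and> k = (\<lambda>_. f)"
  then obtain f where f: "smooth f" "\<And>x. x \<notin> C \<Longrightarrow> f x = 0" "k = (\<lambda>_. f)" by blast
  have "continuous_on C (\<lambda>x. f x / of_real (W x))"
    by (intro continuous_intros smooth_continuous[OF f(1)] continuous_on_subset[OF W(1)])
      (use W(2) in \<open>auto simp: less_imp_neq[symmetric]\<close>)
  then have "bounded ((\<lambda>x. f x / of_real (W x)) ` C)"
    using compact_imp_bounded compact_continuous_image C by blast
  then obtain B where B: "\<And>x. x \<in> C \<Longrightarrow> norm (f x / of_real (W x)) \<le> B" by (auto simp: bounded_iff)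
  have "norm (f x) \<le> \<bar>B\<bar> * W x" for x
  proof (cases "x \<in> C")
    case True
    then show ?thesis using B[OF True] W(2)[of x] by (simp add: norm_divide field_simps) (meson abs_ge_self mult_right_mono order_trans less_imp_le)
  qed (use f(2) W(2)[of x] in simp)
  moreover have "continuous_on (Y \<times> UNIV) (\<lambda>p. f (snd p))"
    by (rule continuous_on_compose2[OF smooth_continuous[OF f(1), of UNIV]]) (auto intro: continuous_intros)
  ultimately show "ck_family 0 W Y k" by (auto simp: f(3) case_prod_unfold)
  show "k y differentiable (at x)" for y x using smooth_differentiable[OF f(1)] f(3) by simp
  fix b :: 'a assume b: "b \<in> Basis"
  have "dir_deriv b f x = 0" if "x \<notin> C" for x
  proof -
    have "(f has_derivative (\<lambda>h. 0)) (at x)"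
      by (rule has_derivative_transform_within_open[of "\<lambda>_. 0" _ _ _ "- C"])
        (use f(2) that compact_imp_closed[OF C] in auto)
    then show ?thesis by (rule dir_deriv_eqI)
  qed
  then show "\<exists>f. smooth f \<and> (\<forall>x. x \<notin> C \<longrightarrow> f x = 0) \<and> (\<lambda>y. dir_deriv b (k y)) = (\<lambda>_. f)"
    using smooth_dir_deriv[OF f(1) b] f(3) by blast
qed

text \<open>Compositions of coordinate Wirtinger derivatives in any order. Linearity and commutation
  with integrals follow by induction here, and reach \<open>mixed_deriv\<close> without unfolding
  its folds over the list of coordinates.\<close>

inductive diff_op :: "((complex ^ 'n::finite \<Rightarrow> complex) \<Rightarrow> complex ^ 'n \<Rightarrow> complex) \<Rightarrow> bool" where
  "diff_op (\<lambda>f. f)"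
| "diff_op A \<Longrightarrow> diff_op (\<lambda>f. d_coord j (A f))"
| "diff_op A \<Longrightarrow> diff_op (\<lambda>f. dbar_coord j (A f))"

lemma diff_op_mixed_deriv:
  fixes p q :: "'n::finite \<Rightarrow> nat"
  shows "diff_op (mixed_deriv p q)"
proof -
  have d: "diff_op (\<lambda>f. (d_coord j ^^ k) (A f))" if "diff_op A" for A :: "(complex ^ 'n \<Rightarrow> complex) \<Rightarrow> _" and j k
    by (induction k) (auto intro: diff_op.intros that)
  have db: "diff_op (\<lambda>f. (dbar_coord j ^^ k) (A f))" if "diff_op A" for A :: "(complex ^ 'n \<Rightarrow> complex) \<Rightarrow> _" and j k
    by (induction k) (auto intro: diff_op.intros that)
  have fd: "diff_op (\<lambda>f. foldr (\<lambda>j. d_coord j ^^ p j) js (A f))"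
    if "diff_op A" for A :: "(complex ^ 'n \<Rightarrow> complex) \<Rightarrow> _" and js :: "'n list"
    by (induction js) (auto intro: d that)
  have fdb: "diff_op (\<lambda>f. foldr (\<lambda>j. dbar_coord j ^^ q j) js (A f))"
    if "diff_op A" for A :: "(complex ^ 'n \<Rightarrow> complex) \<Rightarrow> _" and js :: "'n list"
    by (induction js) (auto intro: db that)
  show ?thesis unfolding mixed_deriv_def[abs_def] by (intro fd fdb diff_op.intros)
qed

lemma wirtinger_dir_deriv:
  "wirtinger u v f = (\<lambda>x. (1/2) * dir_deriv u f x + (- \<i>/2) * dir_deriv v f x)"
  "wirtinger_bar u v f = (\<lambda>x. (1/2) * dir_deriv u f x + (\<i>/2) * dir_deriv v f x)"
  by (auto simp: wirtinger_def wirtinger_bar_def dir_deriv_def field_simps)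

lemma smooth_family_cmult_const:
  "smooth_family W Y f \<Longrightarrow> smooth_family W Y (\<lambda>y x. c * f y x)"
  using smooth_family_cmult[of W Y f "\<lambda>_. c"] by (simp add: image_constant_conv)

lemma smooth_family_wirtinger:
  assumes "smooth_family W Y f" "u \<in> Basis" "v \<in> Basis"
  shows "smooth_family W Y (\<lambda>y. wirtinger u v (f y))" "smooth_family W Y (\<lambda>y. wirtinger_bar u v (f y))"
  unfolding wirtinger_dir_deriv
  by (intro smooth_family_add smooth_family_cmult_const smooth_family_Basis_deriv assms)+

lemma axis_Basis: "axis j (1::complex) \<in> Basis" "axis j \<i> \<in> Basis"
  by (auto simp: axis_in_Basis_iff Basis_complex_def)

lemma smooth_family_diff_op:
  "diff_op A \<Longrightarrow> smooth_family W Y f \<Longrightarrow> smooth_family W Y (\<lambda>y. A (f y))"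
  by (induction rule: diff_op.induct) (auto simp: d_coord_def dbar_coord_def intro: smooth_family_wirtinger axis_Basis)

lemma dir_deriv_lincomb:
  assumes "f differentiable (at x)" "g differentiable (at x)"
  shows "dir_deriv b (\<lambda>x. c * f x + d * g x) x = c * dir_deriv b f x + d * dir_deriv b g x"
proof -
  have "(\<lambda>x. c * f x) differentiable (at x)" "(\<lambda>x. d * g x) differentiable (at x)"
    using assms by (auto intro!: derivative_intros)
  then show ?thesis using assms by (simp add: dir_deriv_add dir_deriv_cmult)
qed

text \<open>The set \<open>{0::real}\<close> is a dummy parameter space: a single function is
  treated as a family that does not depend on its parameter.\<close>

lemma smooth_family_differentiable_const:
  assumes "smooth_family W {0::real} (\<lambda>_. f)" shows "f differentiable (at x)"
  using smooth_family_differentiable[OF assms, of 0] by simp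

lemma diff_op_linear:
  assumes "diff_op A" "smooth_family W {0::real} (\<lambda>_. f)" "smooth_family W {0::real} (\<lambda>_. g)"
  shows "A (\<lambda>x. c * f x + d * g x) x = c * A f x + d * A g x"
  using assms(1)
proof (induction arbitrary: x rule: diff_op.induct)
  case 1
  then show ?case by simp
next
  case (2 A j)
  have "A f differentiable (at x)" "A g differentiable (at x)" for x
    using smooth_family_diff_op[OF 2(1)] assms(2,3) by (blast intro: smooth_family_differentiable_const)+
  then show ?case
    by (simp add: 2(2)[abs_def] d_coord_def wirtinger_dir_deriv dir_deriv_lincomb field_simps)
next
  case (3 A j)
  have "A f differentiable (at x)" "A g differentiable (at x)" for x
    using smooth_family_diff_op[OF 3(1)] assms(2,3) by (blast intro: smooth_family_differentiable_const)+
  then show ?case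
    by (simp add: 3(2)[abs_def] dbar_coord_def wirtinger_dir_deriv dir_deriv_lincomb field_simps)
qed

context compact_parameter
begin

lemma set_integral_lincomb:
  fixes f g :: "'y \<Rightarrow> complex"
  assumes "continuous_on Y f" "continuous_on Y g"
  shows "(LINT y:Y|\<nu>. c * f y + d * g y) = c * (LINT y:Y|\<nu>. f y) + d * (LINT y:Y|\<nu>. g y)"
proof -
  have "(LINT y:Y|\<nu>. c * f y + d * g y) = (LINT y:Y|\<nu>. c * f y) + (LINT y:Y|\<nu>. d * g y)"
    using assms by (intro set_integral_add set_integrable_continuous continuous_intros)
  then show ?thesis by (simp only: set_integral_mult_right)
qed

lemma wirtinger_integral:
  assumes k: "smooth_family W Y k" and uv: "u \<in> Basis" "v \<in> Basis"
  shows "wirtinger u v (\<lambda>x. LINT y:Y|\<nu>. k y x) x = (LINT y:Y|\<nu>. wirtinger u v (k y) x)"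
    "wirtinger_bar u v (\<lambda>x. LINT y:Y|\<nu>. k y x) x = (LINT y:Y|\<nu>. wirtinger_bar u v (k y) x)"
proof -
  note c = smooth_family_continuous_param[OF smooth_family_Basis_deriv[OF k]]
  show "wirtinger u v (\<lambda>x. LINT y:Y|\<nu>. k y x) x = (LINT y:Y|\<nu>. wirtinger u v (k y) x)"
    "wirtinger_bar u v (\<lambda>x. LINT y:Y|\<nu>. k y x) x = (LINT y:Y|\<nu>. wirtinger_bar u v (k y) x)"
    unfolding wirtinger_dir_deriv using uv c
    by (simp_all only: dir_deriv_integral[OF k] set_integral_lincomb)
qed

lemma diff_op_integral:
  assumes "diff_op A" "smooth_family W Y k"
  shows "A (\<lambda>x. LINT y:Y|\<nu>. k y x) = (\<lambda>x. LINT y:Y|\<nu>. A (k y) x)"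
  using assms(1)
proof (induction rule: diff_op.induct)
  case (2 A j)
  show ?case using wirtinger_integral(1)[OF smooth_family_diff_op[OF 2(1) assms(2)] axis_Basis]
    by (simp add: 2(2) d_coord_def fun_eq_iff)
next
  case (3 A j)
  show ?case using wirtinger_integral(2)[OF smooth_family_diff_op[OF 3(1) assms(2)] axis_Basis]
    by (simp add: 3(2) dbar_coord_def fun_eq_iff)
qed simp

end

section \<open>Integration of families against bounded measures\<close>

lemma finite_borel_measureD:
  assumes "finite_borel_measure M"
  shows "finite_measure M" "sets M = sets borel" "space M = UNIV"
  using assms sets_eq_imp_space_eq[of M borel] by (auto simp: finite_borel_measure_def)

lemma integrable_smooth_family:
  assumes M: "finite_borel_measure M" and k: "smooth_family (\<lambda>_. 1) Y k" and "y \<in> Y"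
  shows "integrable M (k y)"
proof -
  interpret finite_measure M using finite_borel_measureD(1)[OF M] .
  obtain C where "\<And>y x. y \<in> Y \<Longrightarrow> norm (k y x) \<le> C * 1" using smooth_family_bound[OF k] by blast
  moreover have "k y \<in> borel_measurable M"
    unfolding sets_eq_borel_measurable_cong[OF finite_borel_measureD(2)[OF M]]
    using smooth_family_continuous_arg[OF k assms(3)] by (rule borel_measurable_continuous_onI)
  ultimately show ?thesis using assms(3) by (intro integrable_const_bound[of _ C]) auto
qed

lemma continuous_on_integral_family:
  fixes k :: "'y::metric_space \<Rightarrow> 'a::euclidean_space \<Rightarrow> complex"
  assumes M: "finite_borel_measure M" and k: "smooth_family (\<lambda>_. 1) Y k"
  shows "continuous_on Y (\<lambda>y. LINT x|M. k y x)"
  unfolding continuous_on_sequentially comp_def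
proof (intro ballI allI impI, elim conjE)
  fix u :: "nat \<Rightarrow> 'y" and y assume y: "y \<in> Y" "\<forall>n. u n \<in> Y" and lim: "u \<longlonglongrightarrow> y"
  interpret finite_measure M using finite_borel_measureD(1)[OF M] .
  obtain C where C: "\<And>y x. y \<in> Y \<Longrightarrow> norm (k y x) \<le> C * 1" using smooth_family_bound[OF k] by blast
  show "(\<lambda>n. LINT x|M. k (u n) x) \<longlonglongrightarrow> (LINT x|M. k y x)"
  proof (rule integral_dominated_convergence[where w="\<lambda>_. C"])
    show "AE x in M. (\<lambda>n. k (u n) x) \<longlonglongrightarrow> k y x"
      using smooth_family_continuous_param[OF k] y lim
      unfolding continuous_on_sequentially comp_def by blast
  qed (use y C integrable_smooth_family[OF M k] in \<open>auto intro: borel_measurable_integrable\<close>)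
qed

lemma (in compact_parameter) integral_swap:
  fixes k :: "'y \<Rightarrow> 'a::euclidean_space \<Rightarrow> complex"
  assumes M: "finite_borel_measure M" and k: "smooth_family (\<lambda>_. 1) Y k"
  shows "(LINT x|M. (LINT y:Y|\<nu>. k y x)) = (LINT y:Y|\<nu>. (LINT x|M. k y x))"
proof -
  interpret M: finite_measure M using finite_borel_measureD(1)[OF M] .
  interpret pair_sigma_finite \<nu> M ..
  obtain C where C: "\<And>y x. y \<in> Y \<Longrightarrow> norm (k y x) \<le> C * 1" using smooth_family_bound[OF k] by blast
  \<comment> \<open>The product sigma-algebra is the Borel one, so that joint continuity gives the
    measurability required by Fubini.\<close>
  have s: "sets (\<nu> \<Otimes>\<^sub>M M) = sets (borel :: ('y \<times> 'a) measure)"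
    using sets_pair_measure_cong[OF sets_nu finite_borel_measureD(2)[OF M]] unfolding borel_prod .
  have "(\<lambda>p. indicator (Y \<times> UNIV) p *\<^sub>R (case p of (y, x) \<Rightarrow> k y x)) \<in> borel_measurable borel"
    using smooth_family_continuous[OF k] compact_imp_closed[OF compact_Y]
    by (intro borel_measurable_continuous_on_indicator borel_closed closed_Times) auto
  then have m: "(\<lambda>p. indicator (Y \<times> UNIV) p *\<^sub>R (case p of (y, x) \<Rightarrow> k y x)) \<in> borel_measurable (\<nu> \<Otimes>\<^sub>M M)"
    using sets_eq_borel_measurable_cong[OF s] by blast
  have YU: "Y \<times> UNIV \<in> sets (\<nu> \<Otimes>\<^sub>M M)"
    using Y_sets finite_borel_measureD(2)[OF M] by (intro pair_measureI) auto
  have "emeasure (\<nu> \<Otimes>\<^sub>M M) (Y \<times> UNIV) = emeasure \<nu> Y * emeasure M UNIV"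
    using Y_sets finite_borel_measureD(2)[OF M] by (intro M.emeasure_pair_measure_Times) auto
  also have "\<dots> < \<infinity>"
    using finite_nu_Y by (simp add: ennreal_mult_eq_top_iff less_top[symmetric])
  finally have "integrable (\<nu> \<Otimes>\<^sub>M M) (\<lambda>p. C *\<^sub>R indicator (Y \<times> UNIV) p :: real)"
    using YU by (intro integrable_scaleR_right integrable_real_indicator) auto
  then have "integrable (\<nu> \<Otimes>\<^sub>M M) (\<lambda>p. indicator (Y \<times> UNIV) p *\<^sub>R (case p of (y, x) \<Rightarrow> k y x))"
    using m by (rule Bochner_Integration.integrable_bound)
      (use order_trans[OF C] in \<open>auto simp: indicator_def\<close>)
  then have "integrable (\<nu> \<Otimes>\<^sub>M M) (case_prod (\<lambda>y x. indicator Y y *\<^sub>R k y x))"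
    by (simp add: case_prod_unfold indicator_times)
  from Fubini_integral[OF this] show ?thesis
    by (simp add: set_lebesgue_integral_def)
qed

lemma continuous_on_cintegral:
  assumes "bounded_cmeasure \<mu>" "smooth_family (\<lambda>_. 1) Y k"
  shows "continuous_on Y (\<lambda>y. cintegral \<mu> (k y))"
  using assms unfolding bounded_cmeasure_def cintegral_def
  by (auto simp: case_prod_unfold intro!: continuous_intros continuous_on_integral_family)

lemma (in compact_parameter) cintegral_swap:
  assumes "bounded_cmeasure \<mu>" "smooth_family (\<lambda>_. 1) Y k"
  shows "cintegral \<mu> (\<lambda>x. LINT y:Y|\<nu>. k y x) = (LINT y:Y|\<nu>. cintegral \<mu> (k y))"
proof -
  obtain M1 M2 M3 M4 where \<mu>: "\<mu> = (M1, M2, M3, M4)" by (cases \<mu>)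
  have M: "finite_borel_measure M1" "finite_borel_measure M2" "finite_borel_measure M3" "finite_borel_measure M4"
    using assms(1) by (auto simp: \<mu> bounded_cmeasure_def)
  note i = set_integrable_continuous[OF continuous_on_integral_family[OF _ assms(2)]]
  show ?thesis
    unfolding \<mu> cintegral_def prod.case
    by (simp add: integral_swap[OF _ assms(2)] set_integral_diff set_integral_add i M)
qed

lemma cintegral_linear:
  assumes \<mu>: "bounded_cmeasure \<mu>"
    and f: "smooth_family (\<lambda>_. 1) {0::real} (\<lambda>_. f)" and g: "smooth_family (\<lambda>_. 1) {0::real} (\<lambda>_. g)"
  shows "cintegral \<mu> (\<lambda>x. c * f x + d * g x) = c * cintegral \<mu> f + d * cintegral \<mu> g"
proof -
  have i: "integrable M f" "integrable M g" if "finite_borel_measure M" for M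
    using integrable_smooth_family[OF that f] integrable_smooth_family[OF that g] by auto
  show ?thesis using \<mu>
    by (auto simp: bounded_cmeasure_def cintegral_def case_prod_unfold i algebra_simps)
qed

section \<open>Polynomial weights and their inverses\<close>

definition weight :: "nat \<Rightarrow> 'a::euclidean_space \<Rightarrow> real" where
  "weight K x = (1 + (norm x)\<^sup>2) ^ K"

lemma weight_0 [simp]: "weight 0 = (\<lambda>_. 1)" by (simp add: weight_def fun_eq_iff)

lemma weight_ge_1: "weight K x \<ge> 1" by (simp add: weight_def)

lemma weight_pos: "weight K x > 0" using weight_ge_1[of K x] by linarith

lemma weight_add: "weight (K + L) x = weight K x * weight L x" by (simp add: weight_def power_add)

lemma weight_mono: "K \<le> L \<Longrightarrow> weight K x \<le> weight L x"
  unfolding weight_def by (rule power_increasing) auto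

lemma smooth_family_weight_mono:
  "smooth_family (weight K) Y f \<Longrightarrow> K \<le> L \<Longrightarrow> smooth_family (weight L) Y f"
  by (rule smooth_family_weight[where c=1]) (auto simp: weight_mono less_imp_le[OF weight_pos])

definition inv_weight :: "'a::euclidean_space \<Rightarrow> complex" where
  "inv_weight x = of_real (1 / (1 + (norm x)\<^sup>2))"

lemma one_plus_norm_pos: "1 + (norm x)\<^sup>2 > 0"
  by (simp add: add_pos_nonneg)

lemma smooth_family_coord:
  fixes Y :: "'y::metric_space set" and b :: "'a::euclidean_space"
  shows "smooth_family (weight 1) Y (\<lambda>_ x. complex_of_real (x \<bullet> b))"
proof -
  have "smooth_family (weight 1) Y (\<lambda>_ x::'a. c)" for c :: complex
    by (rule smooth_family_weight_mono[of 0]) (simp_all add: smooth_family_const)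
  moreover have "norm (complex_of_real (x \<bullet> b)) \<le> norm b * weight 1 x" for x :: 'a
  proof -
    have "2 * norm x \<le> 1 + (norm x)\<^sup>2" using sum_squares_bound[of 1 "norm x"] by simp
    then have "norm x \<le> 1 + (norm x)\<^sup>2" using norm_ge_zero[of x] by linarith
    then have "norm x * norm b \<le> (1 + (norm x)\<^sup>2) * norm b" by (rule mult_right_mono) auto
    then show ?thesis using Cauchy_Schwarz_ineq2[of x b] by (simp add: weight_def mult_ac)
  qed
  moreover have "continuous_on (Y \<times> UNIV) (\<lambda>p. complex_of_real ((snd p :: 'a) \<bullet> b))"
    by (intro continuous_intros)
  moreover have "(\<lambda>x. complex_of_real (x \<bullet> b)) differentiable (at x)" for x
    using smooth_differentiable[OF smooth_coord[of 0 b]] by simp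
  ultimately have "ck_family m (weight 1) Y (\<lambda>_ x. complex_of_real (x \<bullet> b))" for m
    by (cases m) (auto simp: case_prod_unfold smooth_family_def)
  then show ?thesis unfolding smooth_family_def by blast
qed

lemma inv_weight_deriv:
  "dir_deriv b inv_weight x = -2 * of_real (x \<bullet> b) * (inv_weight x * inv_weight x)"
  "inv_weight differentiable (at x)"
proof -
  have "((\<lambda>x. 1 / (1 + x \<bullet> x)) has_derivative (\<lambda>h. -2 * (x \<bullet> h) * (1 / (1 + x \<bullet> x))\<^sup>2)) (at x)"
    using one_plus_norm_pos[of x] unfolding power2_norm_eq_inner
    by (auto intro!: derivative_eq_intros simp: inner_commute power2_eq_square divide_simps)
  from has_derivative_of_real[OF this, where 'a=complex]
  have d: "(inv_weight has_derivative (\<lambda>h. of_real (-2 * (x \<bullet> h) * (1 / (1 + x \<bullet> x))\<^sup>2))) (at x)"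
    unfolding inv_weight_def[abs_def] power2_norm_eq_inner .
  from dir_deriv_eqI[OF d]
  show "dir_deriv b inv_weight x = -2 * of_real (x \<bullet> b) * (inv_weight x * inv_weight x)"
    unfolding inv_weight_def power2_norm_eq_inner by (simp add: power2_eq_square)
  show "inv_weight differentiable (at x)" using d by (auto simp: differentiable_def)
qed

text \<open>A derivative of \<open>inv_weight\<close> is \<open>-2 x_b\<close> times its square;
  growth of order \<open>weight 1\<close> against two factors of decay leaves the same decay. Hence
  all derivatives are bounded by the one weight, and the induction hypothesis serves for both
  factors.\<close>

lemma smooth_family_inv_weight:
  fixes Y :: "'y::metric_space set"
  shows "smooth_family (\<lambda>x::'b::euclidean_space. 1 / weight 1 x) Y (\<lambda>_. inv_weight)"
proof -
  have "ck_family m (\<lambda>x. 1 / weight 1 x) Y (\<lambda>_. inv_weight :: 'b \<Rightarrow> complex)" for m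
  proof (induction m)
    case 0
    have "continuous_on (Y \<times> UNIV) (\<lambda>p. inv_weight (snd p :: 'b))"
      by (rule continuous_on_compose2[of UNIV])
        (auto intro!: continuous_intros continuous_at_imp_continuous_on differentiable_imp_continuous_within inv_weight_deriv(2))
    moreover have "norm (inv_weight (x::'b)) \<le> 1 * (1 / weight 1 x)" for x
      using one_plus_norm_pos[of x] by (simp only: inv_weight_def norm_of_real weight_def) simp
    ultimately show ?case unfolding ck_family.simps by (auto simp: case_prod_unfold)
  next
    case (Suc m)
    have z: "ck_family 0 (\<lambda>x. 1 / weight 1 x) Y (\<lambda>_. inv_weight :: 'b \<Rightarrow> complex)"
      using Suc by (rule ck_family_0)
    have "ck_family m (\<lambda>x. 1 / weight 1 x) Y (\<lambda>_. dir_deriv b (inv_weight :: 'b \<Rightarrow> complex))" for b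
    proof -
      have "ck_family m (\<lambda>x. weight 1 x * (1 / weight 1 x * (1 / weight 1 x))) Y
          (\<lambda>_ x. (-2 * of_real (x \<bullet> b)) * (inv_weight x * inv_weight x))"
        using smooth_family_cmult_const[OF smooth_family_coord, of Y "-2" b]
        by (intro ck_family_mult Suc) (auto simp: smooth_family_def)
      moreover have "weight 1 x * (1 / weight 1 x * (1 / weight 1 x)) = 1 / weight 1 (x::'b)" for x
        using weight_pos[of 1 x] by simp
      ultimately show ?thesis by (simp add: inv_weight_deriv(1)[abs_def])
    qed
    then show ?case using z inv_weight_deriv(2) by auto
  qed
  then show ?thesis unfolding smooth_family_def by blast
qed

lemma smooth_family_inv_weight_power:
  fixes Y :: "'y::metric_space set"
  shows "smooth_family (\<lambda>x::'b::euclidean_space. 1 / weight K x) Y (\<lambda>_ x. inv_weight x ^ K)"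
proof (induction K)
  case 0
  then show ?case by (simp add: smooth_family_const)
next
  case (Suc K)
  have e: "1 / weight (Suc K) x = 1 / weight 1 x * (1 / weight K x)" for x :: 'b
    by (simp add: weight_def)
  show ?case unfolding e power_Suc by (rule smooth_family_mult[OF smooth_family_inv_weight Suc])
qed

lemma inv_weight_weight: "complex_of_real (weight K x) * inv_weight x ^ K = 1"
  using one_plus_norm_pos[of x] unfolding weight_def inv_weight_def of_real_power
  by (simp only: flip: power_mult_distrib of_real_mult) simp

lemma smooth_family_inv_weight_mult:
  fixes Y :: "'y::metric_space set" and f :: "'y \<Rightarrow> 'b::euclidean_space \<Rightarrow> complex"
  assumes "smooth_family (weight K) Y f"
  shows "smooth_family (\<lambda>_. 1) Y (\<lambda>y x. inv_weight x ^ K * f y x)"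
proof -
  have "1 / weight K x * weight K x = 1" for x :: 'b using weight_pos[of K x] by simp
  then show ?thesis using smooth_family_mult[OF smooth_family_inv_weight_power[of K Y] assms] by (simp only:)
qed

subsection \<open>Extension of a rapidly decreasing distribution\<close>

text \<open>One exponent \<open>K\<close> bounds the derivatives of all orders. For a single
  function this is the space of very slowly increasing functions, usually written
  \<open>O_C\<close>, of which the rapidly decreasing distributions are the dual.\<close>

definition tempered_family :: "'y::metric_space set \<Rightarrow> ('y \<Rightarrow> 'a::euclidean_space \<Rightarrow> complex) \<Rightarrow> bool" where
  "tempered_family Y f \<longleftrightarrow> (\<exists>K. smooth_family (weight K) Y f)"

abbreviation tempered :: "('a::euclidean_space \<Rightarrow> complex) \<Rightarrow> bool" where
  "tempered f \<equiv> tempered_family {0::real} (\<lambda>_. f)"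

lemma tempered_familyI: "smooth_family (\<lambda>_. 1) Y f \<Longrightarrow> tempered_family Y f"
  unfolding tempered_family_def by (rule exI[of _ 0]) simp

lemma tempered_family_add:
  assumes "tempered_family Y f" "tempered_family Y g"
  shows "tempered_family Y (\<lambda>y x. f y x + g y x)"
proof -
  obtain K L where "smooth_family (weight K) Y f" "smooth_family (weight L) Y g"
    using assms unfolding tempered_family_def by blast
  then have "smooth_family (weight (K + L)) Y f" "smooth_family (weight (K + L)) Y g"
    using smooth_family_weight_mono[of K Y f "K + L"] smooth_family_weight_mono[of L Y g "K + L"] by auto
  then show ?thesis unfolding tempered_family_def using smooth_family_add by blast
qed

lemma tempered_family_mult:
  assumes "tempered_family Y f" "tempered_family Y g"
  shows "tempered_family Y (\<lambda>y x. f y x * g y x)"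
proof -
  obtain K L where "smooth_family (weight K) Y f" "smooth_family (weight L) Y g"
    using assms unfolding tempered_family_def by blast
  then have "smooth_family (weight (K + L)) Y (\<lambda>y x. f y x * g y x)"
    unfolding weight_add[abs_def] by (rule smooth_family_mult)
  then show ?thesis unfolding tempered_family_def by blast
qed

lemma tempered_family_scalar:
  "continuous_on Y a \<Longrightarrow> bounded (a ` Y) \<Longrightarrow> tempered_family Y (\<lambda>y x. a y)"
  by (intro tempered_familyI smooth_family_scalar)

lemma tempered_family_const: "tempered_family Y (\<lambda>y x. c)"
  by (intro tempered_familyI smooth_family_const)

lemma tempered_family_diff:
  "tempered_family Y f \<Longrightarrow> tempered_family Y g \<Longrightarrow> tempered_family Y (\<lambda>y x. f y x - g y x)"
  using tempered_family_add[OF _ tempered_family_mult[OF tempered_family_const[of Y "-1"]], of f g] by simp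

lemma tempered_family_coord: "tempered_family Y (\<lambda>_ x. complex_of_real (x \<bullet> b))"
  unfolding tempered_family_def using smooth_family_coord by blast

lemma tempered_family_member: "tempered_family Y f \<Longrightarrow> y \<in> Y \<Longrightarrow> tempered_family Z (\<lambda>_. f y)"
  unfolding tempered_family_def using smooth_family_member by blast

lemma tempered_family_of_tempered: "tempered f \<Longrightarrow> tempered_family Y (\<lambda>_. f)"
  using tempered_family_member[of "{0::real}" "\<lambda>_. f" 0] by auto

lemma tempered_family_reindex:
  "tempered_family Y f \<Longrightarrow> continuous_on Z \<tau> \<Longrightarrow> \<tau> ` Z \<subseteq> Y \<Longrightarrow> tempered_family Z (\<lambda>z. f (\<tau> z))"
  unfolding tempered_family_def using smooth_family_reindex by blast

lemma tempered_family_smooth: "tempered_family Y f \<Longrightarrow> y \<in> Y \<Longrightarrow> smooth (f y)"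
  unfolding tempered_family_def using smooth_family_smooth by blast

lemma test_functionI:
  assumes "smooth \<phi>" "compact C" "\<And>x. x \<notin> C \<Longrightarrow> \<phi> x = 0"
  shows "\<phi> \<in> test_functions" "supp \<phi> \<subseteq> C"
proof -
  show s: "supp \<phi> \<subseteq> C" unfolding supp_def
    by (rule closure_minimal) (use assms compact_imp_closed in blast)+
  have "compact (C \<inter> supp \<phi>)"
    unfolding supp_def by (intro compact_Int_closed assms(2) closed_closure)
  then show "\<phi> \<in> test_functions"
    using s assms(1) by (simp add: test_functions_def Int_absorb1)
qed

lemma not_in_supp: "x \<notin> supp f \<Longrightarrow> f x = 0"
  unfolding supp_def using closure_subset[of "{x. f x \<noteq> 0}"] by blast

lemma test_functionD:
  assumes "\<phi> \<in> test_functions" shows "smooth \<phi>" "compact (supp \<phi>)"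
  using assms by (auto simp: test_functions_def)

lemma smooth_family_test:
  assumes "\<phi> \<in> test_functions"
  shows "smooth_family (\<lambda>_. 1) Y (\<lambda>_. \<phi>)"
  by (rule smooth_family_compact_support[OF test_functionD(1)[OF assms] not_in_supp[of _ \<phi>] test_functionD(2)[OF assms]])
    simp_all

lemma tempered_test: "\<phi> \<in> test_functions \<Longrightarrow> tempered_family Y (\<lambda>_. \<phi>)"
  by (intro tempered_familyI smooth_family_test)

lemma smooth_family_bump:
  fixes Y :: "'y::metric_space set"
  shows "smooth_family (\<lambda>_. 1) Y (\<lambda>_. bump :: 'a::euclidean_space \<Rightarrow> complex)"
proof (rule smooth_family_compact_support[OF smooth_bump])
  show "bump x = 0" if "x \<notin> cball 0 2" for x :: 'a using that by (intro bump_0) auto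
qed simp_all

lemma smooth_family_bump_scaled:
  "smooth_family (\<lambda>_. 1) {0..1::real} (\<lambda>t x. bump (t *\<^sub>R (x - c)))"
proof -
  have "smooth_family (\<lambda>_. 1) {0..1::real} (\<lambda>t x. bump (t *\<^sub>R x + t *\<^sub>R (- c)))"
    by (rule smooth_family_affine[OF smooth_family_bump])
      (intro bounded_linear_scaleR_right continuous_intros compact_imp_bounded compact_continuous_image compact_Icc)+
  then show ?thesis by (simp add: algebra_simps)
qed

lemma smooth_family_bump_dilate:
  "smooth_family (\<lambda>_. 1) Y (\<lambda>_ x. bump (a *\<^sub>R (x - c)))"
proof -
  have "smooth_family (\<lambda>_. 1) Y (\<lambda>_ x. bump (a *\<^sub>R x + a *\<^sub>R (- c)))"
    by (rule smooth_family_affine[OF smooth_family_bump])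
      (simp_all add: bounded_linear_scaleR_right image_constant_conv)
  then show ?thesis by (simp add: algebra_simps)
qed

lemma bump_mult_test:
  fixes f :: "complex ^ 'n \<Rightarrow> complex"
  assumes "tempered f" "a > 0"
  shows "(\<lambda>x. bump (a *\<^sub>R (x - c)) * f x) \<in> test_functions"
    and "supp (\<lambda>x. bump (a *\<^sub>R (x - c)) * f x) \<subseteq> cball c (2 / a)"
proof -
  have "smooth (\<lambda>x. bump (a *\<^sub>R (x - c)) * f x)"
    by (rule tempered_family_smooth[OF tempered_family_mult[OF tempered_familyI[OF smooth_family_bump_dilate] assms(1)]])
      auto
  moreover have "bump (a *\<^sub>R (x - c)) * f x = 0" if "x \<notin> cball c (2 / a)" for x
  proof -
    have "2 \<le> norm (a *\<^sub>R (x - c))"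
      using that assms(2) by (simp add: dist_norm norm_minus_commute pos_divide_less_eq not_le mult.commute)
    then show ?thesis by (simp only: bump_0) simp
  qed
  ultimately show "(\<lambda>x. bump (a *\<^sub>R (x - c)) * f x) \<in> test_functions"
    "supp (\<lambda>x. bump (a *\<^sub>R (x - c)) * f x) \<subseteq> cball c (2 / a)"
    using test_functionI[of _ "cball c (2 / a)"] by auto
qed

text \<open>The limit exists for tempered f, by \<open>ext_weighted_pairing\<close> below, and extends T.\<close>

definition ext ::
  "((complex ^ 'n \<Rightarrow> complex) \<Rightarrow> complex) \<Rightarrow> (complex ^ 'n \<Rightarrow> complex) \<Rightarrow> complex" where
  "ext T f = Lim (at_right (0::real)) (\<lambda>t. T (\<lambda>x. bump (t *\<^sub>R x) * f x))"

lemma ext_eq_0I: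
  assumes "\<And>t. t > 0 \<Longrightarrow> T (\<lambda>x. bump (t *\<^sub>R x) * f x) = 0"
  shows "ext T f = 0"
  unfolding ext_def
proof (rule tendsto_Lim)
  have "\<forall>\<^sub>F t in at_right (0::real). T (\<lambda>x. bump (t *\<^sub>R x) * f x) = 0"
    using eventually_at_right_less by (rule eventually_mono) (rule assms)
  then show "((\<lambda>t. T (\<lambda>x. bump (t *\<^sub>R x) * f x)) \<longlongrightarrow> 0) (at_right (0::real))"
    by (rule tendsto_eventually)
qed simp

locale rapidly_decreasing_distribution =
  fixes T :: "(complex ^ 'n \<Rightarrow> complex) \<Rightarrow> complex"
  assumes rd: "rapidly_decreasing T"
begin

text \<open>\<open>f\<close> is divided by the weight and paired with the measures that represent
  the weighted distribution. The choice is made in the same form as in \<open>pairing\<close>, so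
  that the two agree for \<open>K = 0\<close>.\<close>

definition weighted_pairing :: "nat \<Rightarrow> (complex ^ 'n \<Rightarrow> complex) \<Rightarrow> complex" where
  "weighted_pairing K f = (case (SOME (m, \<mu>). represents T (int K) m \<mu>) of
     (m, \<mu>) \<Rightarrow> deriv_measures m \<mu> (\<lambda>x. inv_weight x ^ K * f x))"

lemma represents_obtain:
  obtains m \<mu> where "represents T (int K) m \<mu>"
    "\<And>f. weighted_pairing K f = deriv_measures m \<mu> (\<lambda>x. inv_weight x ^ K * f x)"
proof -
  obtain m \<mu> where r: "(SOME (m, \<mu>). represents T (int K) m \<mu>) = (m, \<mu>)" by fastforce
  have "\<exists>p. case p of (m, \<mu>) \<Rightarrow> represents T (int K) m \<mu>"
    using rd unfolding rapidly_decreasing_def by auto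
  from someI_ex[OF this] have "represents T (int K) m \<mu>" by (simp add: r)
  then show thesis using that[of m \<mu>] by (simp add: weighted_pairing_def r)
qed

lemma mixed_deriv_family:
  "smooth_family (weight K) Y f \<Longrightarrow>
    smooth_family (\<lambda>_. 1) Y (\<lambda>y. mixed_deriv p q (\<lambda>x. inv_weight x ^ K * f y x))"
  by (rule smooth_family_diff_op[OF diff_op_mixed_deriv smooth_family_inv_weight_mult])

lemma weighted_pairing_continuous:
  assumes "smooth_family (weight K) Y f"
  shows "continuous_on Y (\<lambda>y. weighted_pairing K (f y))"
proof -
  obtain m \<mu> where r: "represents T (int K) m \<mu>"
    "\<And>f. weighted_pairing K f = deriv_measures m \<mu> (\<lambda>x. inv_weight x ^ K * f x)"
    using represents_obtain[of K] by blast
  show ?thesis unfolding r(2) deriv_measures_def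
    using r(1) unfolding represents_def
    by (auto simp: case_prod_unfold intro!: continuous_intros continuous_on_cintegral mixed_deriv_family[OF assms])
qed

lemma weighted_pairing_linear:
  assumes "smooth_family (weight K) {0::real} (\<lambda>_. f)" "smooth_family (weight K) {0::real} (\<lambda>_. g)"
  shows "weighted_pairing K (\<lambda>x. c * f x + d * g x) = c * weighted_pairing K f + d * weighted_pairing K g"
proof -
  obtain m \<mu> where r: "represents T (int K) m \<mu>"
    "\<And>f. weighted_pairing K f = deriv_measures m \<mu> (\<lambda>x. inv_weight x ^ K * f x)"
    using represents_obtain[of K] by blast
  have b: "bounded_cmeasure (\<mu> p q)" if "(p, q) \<in> mindices m" for p q
    using r(1) that unfolding represents_def by auto
  note s = assms[THEN smooth_family_inv_weight_mult]
  have "cintegral (\<mu> p q) (mixed_deriv p q (\<lambda>x. inv_weight x ^ K * (c * f x + d * g x))) =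
    c * cintegral (\<mu> p q) (mixed_deriv p q (\<lambda>x. inv_weight x ^ K * f x)) +
    d * cintegral (\<mu> p q) (mixed_deriv p q (\<lambda>x. inv_weight x ^ K * g x))" if "(p, q) \<in> mindices m" for p q
  proof -
    have "mixed_deriv p q (\<lambda>x. inv_weight x ^ K * (c * f x + d * g x)) =
      (\<lambda>x. c * mixed_deriv p q (\<lambda>x. inv_weight x ^ K * f x) x + d * mixed_deriv p q (\<lambda>x. inv_weight x ^ K * g x) x)"
      using diff_op_linear[OF diff_op_mixed_deriv s, of p q c d] by (auto simp: algebra_simps)
    then show ?thesis
      using cintegral_linear[OF b[OF that] mixed_deriv_family[OF assms(1)] mixed_deriv_family[OF assms(2)]] by simp
  qed
  then show ?thesis unfolding r(2) deriv_measures_def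
    by (subst sum_distrib_left, subst sum_distrib_left, subst sum.distrib[symmetric], intro sum.cong)
      (auto simp: algebra_simps)
qed

text \<open>On test functions the weight cancels against \<open>inv_weight\<close>, so every
  \<open>K\<close> and every choice of representation gives back \<open>T\<close>.\<close>

lemma weighted_pairing_test:
  assumes "\<phi> \<in> test_functions"
  shows "weighted_pairing K \<phi> = T \<phi>"
proof -
  obtain m \<mu> where r: "represents T (int K) m \<mu>"
    "\<And>f. weighted_pairing K f = deriv_measures m \<mu> (\<lambda>x. inv_weight x ^ K * f x)"
    using represents_obtain[of K] by blast
  have "smooth (\<lambda>x. inv_weight x ^ K * \<phi> x)"
    by (rule smooth_family_smooth[OF smooth_family_mult[OF
          smooth_family_inv_weight_power[of K "{0::real}"] smooth_family_test[OF assms, of "{0::real}"]], of 0]) simp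
  then have "(\<lambda>x. inv_weight x ^ K * \<phi> x) \<in> test_functions"
    by (rule test_functionI(1)[OF _ test_functionD(2)[OF assms]]) (simp add: not_in_supp)
  then have "deriv_measures m \<mu> (\<lambda>x. inv_weight x ^ K * \<phi> x) =
      T (\<lambda>x. complex_of_real ((1 + (norm x)\<^sup>2) powi int K) * (inv_weight x ^ K * \<phi> x))"
    using r(1) unfolding represents_def by auto
  also have "(\<lambda>x. complex_of_real ((1 + (norm x)\<^sup>2) powi int K) * (inv_weight x ^ K * \<phi> x)) = \<phi>"
  proof
    fix x
    have "complex_of_real ((1 + (norm x)\<^sup>2) powi int K) * (inv_weight x ^ K * \<phi> x) =
      (complex_of_real (weight K x) * inv_weight x ^ K) * \<phi> x"
      by (simp add: weight_def mult_ac)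
    then show "complex_of_real ((1 + (norm x)\<^sup>2) powi int K) * (inv_weight x ^ K * \<phi> x) = \<phi> x"
      by (simp only: inv_weight_weight) simp
  qed
  finally show ?thesis by (simp add: r(2))
qed

text \<open>The functions \<open>bump (t x) f x\<close> form a smooth family over
  \<open>{0..1}\<close>, the value \<open>t = 0\<close> included, where the cut-off is 1. Continuity
  of the pairing at \<open>t = 0\<close> gives the limit; for \<open>t > 0\<close> they are test
  functions, on which the pairing is \<open>T\<close>. In particular the value does not depend on
  \<open>K\<close>.\<close>

lemma ext_weighted_pairing:
  assumes "smooth_family (weight K) {0::real} (\<lambda>_. f)"
  shows "ext T f = weighted_pairing K f"
proof -
  have "smooth_family (weight K) {0..1::real} (\<lambda>_. f)"
    using assms by (rule smooth_family_constant_param) simp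
  from smooth_family_mult[OF smooth_family_bump_scaled[of 0] this]
  have "continuous_on {0..1} (\<lambda>t. weighted_pairing K (\<lambda>x. bump (t *\<^sub>R x) * f x))"
    using weighted_pairing_continuous by simp
  then have "((\<lambda>t. weighted_pairing K (\<lambda>x. bump (t *\<^sub>R x) * f x)) \<longlongrightarrow> weighted_pairing K (\<lambda>x. bump ((0::real) *\<^sub>R x) * f x)) (at 0 within {0..1})"
    unfolding continuous_on by (rule bspec) simp
  then have "((\<lambda>t. weighted_pairing K (\<lambda>x. bump (t *\<^sub>R x) * f x)) \<longlongrightarrow> weighted_pairing K f) (at_right 0)"
    by (simp add: at_within_Icc_at_right bump_1)
  moreover have "tempered f" using assms unfolding tempered_family_def by blast
  then have "\<forall>\<^sub>F t in at_right 0. weighted_pairing K (\<lambda>x. bump (t *\<^sub>R x) * f x) = T (\<lambda>x. bump (t *\<^sub>R x) * f x)"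
    by (intro eventually_mono[OF eventually_at_right_less] weighted_pairing_test)
      (use bump_mult_test(1)[of f _ 0] in simp)
  ultimately have "((\<lambda>t. T (\<lambda>x. bump (t *\<^sub>R x) * f x)) \<longlongrightarrow> weighted_pairing K f) (at_right 0)"
    by (rule Lim_transform_eventually)
  then show ?thesis unfolding ext_def by (intro tendsto_Lim) auto
qed

lemma ext_continuous:
  assumes "tempered_family Y f"
  shows "continuous_on Y (\<lambda>y. ext T (f y))"
proof -
  obtain K where K: "smooth_family (weight K) Y f" using assms unfolding tempered_family_def by blast
  have "ext T (f y) = weighted_pairing K (f y)" if "y \<in> Y" for y
    using ext_weighted_pairing[OF smooth_family_member[OF K that]] .
  then show ?thesis using weighted_pairing_continuous[OF K] by (simp cong: continuous_on_cong)
qed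

lemma ext_linear:
  assumes "tempered f" "tempered g"
  shows "ext T (\<lambda>x. c * f x + d * g x) = c * ext T f + d * ext T g"
proof -
  obtain K L where "smooth_family (weight K) {0::real} (\<lambda>_. f)" "smooth_family (weight L) {0::real} (\<lambda>_. g)"
    using assms unfolding tempered_family_def by blast
  then have K: "smooth_family (weight (K + L)) {0::real} (\<lambda>_. f)" "smooth_family (weight (K + L)) {0::real} (\<lambda>_. g)"
    using smooth_family_weight_mono[of K "{0::real}" "\<lambda>_. f" "K + L"] smooth_family_weight_mono[of L "{0::real}" "\<lambda>_. g" "K + L"]
    by auto
  from smooth_family_add[OF smooth_family_cmult_const[OF this(1)] smooth_family_cmult_const[OF this(2)]]
  show ?thesis
    by (simp add: ext_weighted_pairing[OF K(1)] ext_weighted_pairing[OF K(2)] ext_weighted_pairing[of "K + L"]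
        weighted_pairing_linear[OF K])
qed

lemma ext_test: "\<phi> \<in> test_functions \<Longrightarrow> ext T \<phi> = T \<phi>"
  using ext_weighted_pairing[of 0 \<phi>] smooth_family_test[of \<phi> "{0::real}"] weighted_pairing_test[of \<phi> 0]
  by simp

lemma pairing_ext:
  assumes "smooth_family (\<lambda>_. 1) {0::real} (\<lambda>_. f)"
  shows "pairing T f = ext T f"
  using ext_weighted_pairing[of 0 f] assms by (simp add: pairing_def weighted_pairing_def)

text \<open>A single \<open>K\<close> serves the whole family, so one finite list of measures
  represents \<open>T\<close> for all parameters. The claim reduces to differentiation under the
  integral and Fubini for each measure.\<close>

lemma ext_swap:
  fixes k :: "'y::euclidean_space \<Rightarrow> complex ^ 'n \<Rightarrow> complex"
  assumes "compact_parameter \<nu> Y" "tempered_family Y k"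
  shows "ext T (\<lambda>x. LINT y:Y|\<nu>. k y x) = (LINT y:Y|\<nu>. ext T (k y))"
proof -
  interpret compact_parameter \<nu> Y by fact
  obtain K where K: "smooth_family (weight K) Y k" using assms(2) unfolding tempered_family_def by blast
  obtain m \<mu> where r: "represents T (int K) m \<mu>"
    "\<And>f. weighted_pairing K f = deriv_measures m \<mu> (\<lambda>x. inv_weight x ^ K * f x)"
    using represents_obtain[of K] by blast
  have b: "bounded_cmeasure (\<mu> p q)" if "(p, q) \<in> mindices m" for p q
    using r(1) that unfolding represents_def by auto
  have sw: "cintegral (\<mu> p q) (mixed_deriv p q (\<lambda>x. inv_weight x ^ K * (LINT y:Y|\<nu>. k y x))) =
    (LINT y:Y|\<nu>. cintegral (\<mu> p q) (mixed_deriv p q (\<lambda>x. inv_weight x ^ K * k y x)))"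
    if "(p, q) \<in> mindices m" for p q
  proof -
    have "(\<lambda>x. inv_weight x ^ K * (LINT y:Y|\<nu>. k y x)) = (\<lambda>x. LINT y:Y|\<nu>. inv_weight x ^ K * k y x)"
      by (simp only: set_integral_mult_right)
    then have "mixed_deriv p q (\<lambda>x. inv_weight x ^ K * (LINT y:Y|\<nu>. k y x)) =
        (\<lambda>x. LINT y:Y|\<nu>. mixed_deriv p q (\<lambda>x. inv_weight x ^ K * k y x) x)"
      using diff_op_integral[OF diff_op_mixed_deriv smooth_family_inv_weight_mult[OF K]] by simp
    then show ?thesis using cintegral_swap[OF b[OF that] mixed_deriv_family[OF K]] by simp
  qed
  have i: "set_integrable \<nu> Y (\<lambda>y. (-1) ^ e * cintegral (\<mu> p q) (mixed_deriv p q (\<lambda>x. inv_weight x ^ K * k y x)))"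
    if "(p, q) \<in> mindices m" for p q e
    by (intro set_integrable_continuous continuous_intros continuous_on_cintegral b that mixed_deriv_family[OF K])
  have "ext T (\<lambda>x. LINT y:Y|\<nu>. k y x) = weighted_pairing K (\<lambda>x. LINT y:Y|\<nu>. k y x)"
    by (rule ext_weighted_pairing[OF smooth_family_integral[OF K]])
  also have "\<dots> = (\<Sum>(p, q)\<in>mindices m. LINT y:Y|\<nu>. (-1) ^ (mlen p + mlen q) *
      cintegral (\<mu> p q) (mixed_deriv p q (\<lambda>x. inv_weight x ^ K * k y x)))"
    unfolding r(2) deriv_measures_def set_integral_mult_right by (intro sum.cong) (auto simp: sw)
  also have "\<dots> = (LINT y:Y|\<nu>. weighted_pairing K (k y))"
    unfolding r(2) deriv_measures_def set_lebesgue_integral_def scaleR_sum_right case_prod_unfold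
    by (subst Bochner_Integration.integral_sum) (use i in \<open>auto simp: set_integrable_def\<close>)
  also have "\<dots> = (LINT y:Y|\<nu>. ext T (k y))"
    by (intro set_lebesgue_integral_cong Y_sets) (auto simp: ext_weighted_pairing[OF smooth_family_member[OF K]])
  finally show ?thesis .
qed

end

subsection \<open>Functions on the space of hyperplanes\<close>

lemma dir_deriv_eq_0_open:
  assumes "open U" "\<And>x. x \<in> U \<Longrightarrow> f x = 0" "x \<in> U"
  shows "dir_deriv b f x = 0"
proof -
  have "(f has_derivative (\<lambda>h. 0)) (at x)"
    by (rule has_derivative_transform_within_open[of "\<lambda>_. 0" _ _ _ U]) (use assms in auto)
  then show ?thesis by (rule dir_deriv_eqI)
qed

lemma smooth_line_derivative:
  fixes f :: "'a::euclidean_space \<Rightarrow> complex"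
  assumes "f differentiable (at (x + t *\<^sub>R v))"
  shows "((\<lambda>t. f (x + t *\<^sub>R v)) has_vector_derivative dir_deriv v f (x + t *\<^sub>R v)) (at t within S)"
proof -
  have "((\<lambda>t. x + t *\<^sub>R v) has_derivative (\<lambda>h. h *\<^sub>R v)) (at t within S)"
    by (auto intro!: derivative_eq_intros)
  from has_derivative_compose[OF this has_derivative_dir_deriv[OF assms]]
  have "((\<lambda>t. f (x + t *\<^sub>R v)) has_derivative (\<lambda>h. dir_deriv (h *\<^sub>R v) f (x + t *\<^sub>R v))) (at t within S)" .
  moreover have "dir_deriv (h *\<^sub>R v) f (x + t *\<^sub>R v) = h *\<^sub>R dir_deriv v f (x + t *\<^sub>R v)" for h
    using linear_cmul[OF bounded_linear.linear[OF has_derivative_bounded_linear[OF has_derivative_dir_deriv[OF assms]]]] .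
  ultimately show ?thesis unfolding has_vector_derivative_def by simp
qed

lemma has_integral_dir_deriv:
  fixes f :: "'a::euclidean_space \<Rightarrow> complex"
  assumes "\<And>x. f differentiable (at x)" "0 \<le> T"
  shows "((\<lambda>t. dir_deriv v f (x + t *\<^sub>R v)) has_integral (f (x + T *\<^sub>R v) - f x)) {0..T}"
  using fundamental_theorem_of_calculus[OF assms(2), of "\<lambda>t. f (x + t *\<^sub>R v)"]
    smooth_line_derivative[OF assms(1)] by auto

text \<open>Recovers a pointwise identity from identities of integrals; it is the device by which
  functions known only through segment integrals are compared.\<close>

lemma eq_of_integrals_eq:
  fixes f g :: "real \<Rightarrow> complex"
  assumes "continuous_on {0..e} f" "continuous_on {0..e} g" "e > 0"
    and "\<And>t. t \<in> {0..e} \<Longrightarrow> integral {0..t} f = integral {0..t} g"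
  shows "f 0 = g 0"
proof -
  have "((\<lambda>t. integral {0..t} f) has_vector_derivative f 0) (at 0 within {0..e})"
    using assms by (intro integral_has_vector_derivative) auto
  moreover have "((\<lambda>t. integral {0..t} g) has_vector_derivative g 0) (at 0 within {0..e})"
    using assms by (intro integral_has_vector_derivative) auto
  then have "((\<lambda>t. integral {0..t} f) has_vector_derivative g 0) (at 0 within {0..e})"
    by (rule has_vector_derivative_transform[rotated 2]) (use assms in auto)
  moreover have "at 0 within {0..e} \<noteq> bot"
    using assms(3) by (simp add: at_within_Icc_at_right)
  ultimately show ?thesis by (metis vector_derivative_unique_within)
qed

text \<open>Integrated along a segment in direction \<open>v\<close>, both mixed derivatives give
  the increment of \<open>dir_deriv u f\<close>: one by the fundamental theorem, the other by the
  Leibniz rule applied to the increment of \<open>f\<close>. Letting the segment shrink yields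
  equality at \<open>x\<close>.\<close>

lemma dir_deriv_commute:
  fixes f :: "'a::euclidean_space \<Rightarrow> complex"
  assumes f: "smooth f" and u: "u \<in> Basis" and v: "v \<in> Basis"
  shows "dir_deriv u (dir_deriv v f) x = dir_deriv v (dir_deriv u f) x"
proof -
  note df = smooth_differentiable[OF f] smooth_differentiable[OF smooth_dir_deriv[OF f]]
  have cl: "continuous_on A (\<lambda>t. dir_deriv a (dir_deriv b f) (x + t *\<^sub>R v))"
    if "a \<in> Basis" "b \<in> Basis" for A a b
    by (rule continuous_on_compose2[OF smooth_continuous[OF smooth_dir_deriv[OF smooth_dir_deriv[OF f that(2)] that(1)], of UNIV]])
      (auto intro!: continuous_intros)
  have "integral {0..T} (\<lambda>t. dir_deriv u (dir_deriv v f) (x + t *\<^sub>R v)) =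
    integral {0..T} (\<lambda>t. dir_deriv v (dir_deriv u f) (x + t *\<^sub>R v))" if "T \<in> {0..1}" for T
  proof -
    have c2: "continuous_on (UNIV \<times> cbox 0 T) (\<lambda>(s, t). dir_deriv u (dir_deriv v f) ((x + t *\<^sub>R v) + s *\<^sub>R u))"
      unfolding case_prod_unfold
      by (rule continuous_on_compose2[OF smooth_continuous[OF smooth_dir_deriv[OF smooth_dir_deriv[OF f v] u], of UNIV]])
        (auto intro!: continuous_intros)
    have 1: "((\<lambda>s. integral (cbox 0 T) (\<lambda>t. dir_deriv v f ((x + t *\<^sub>R v) + s *\<^sub>R u))) has_vector_derivative
        integral (cbox 0 T) (\<lambda>t. dir_deriv u (dir_deriv v f) ((x + t *\<^sub>R v) + 0 *\<^sub>R u))) (at 0 within UNIV)"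
    proof (rule leibniz_rule_vector_derivative[OF _ _ c2])
      fix s t :: real
      show "((\<lambda>s. dir_deriv v f ((x + t *\<^sub>R v) + s *\<^sub>R u)) has_vector_derivative
          dir_deriv u (dir_deriv v f) ((x + t *\<^sub>R v) + s *\<^sub>R u)) (at s within UNIV)"
        by (rule smooth_line_derivative[OF df(2)[OF v]])
      have "continuous_on (cbox 0 T) (\<lambda>t. dir_deriv v f ((x + t *\<^sub>R v) + s *\<^sub>R u))"
        by (rule continuous_on_compose2[OF smooth_continuous[OF smooth_dir_deriv[OF f v], of UNIV]])
          (auto intro!: continuous_intros)
      then show "(\<lambda>t. dir_deriv v f ((x + t *\<^sub>R v) + s *\<^sub>R u)) integrable_on cbox 0 T"
        by (rule integrable_continuous)
    qed auto
    have "integral (cbox 0 T) (\<lambda>t. dir_deriv v f ((x + t *\<^sub>R v) + s *\<^sub>R u)) = f ((x + T *\<^sub>R v) + s *\<^sub>R u) - f (x + s *\<^sub>R u)" for s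
    proof -
      have "((\<lambda>t. dir_deriv v f ((x + s *\<^sub>R u) + t *\<^sub>R v)) has_integral f ((x + s *\<^sub>R u) + T *\<^sub>R v) - f (x + s *\<^sub>R u)) {0..T}"
        using has_integral_dir_deriv[OF df(1), of T v "x + s *\<^sub>R u"] that by auto
      then show ?thesis by (simp add: integral_unique add_ac)
    qed
    then have "((\<lambda>s. f ((x + T *\<^sub>R v) + s *\<^sub>R u) - f (x + s *\<^sub>R u)) has_vector_derivative
        integral (cbox 0 T) (\<lambda>t. dir_deriv u (dir_deriv v f) ((x + t *\<^sub>R v) + 0 *\<^sub>R u))) (at 0)"
      using 1 by simp
    moreover have "((\<lambda>s. f ((x + T *\<^sub>R v) + s *\<^sub>R u) - f (x + s *\<^sub>R u)) has_vector_derivative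
        dir_deriv u f ((x + T *\<^sub>R v) + 0 *\<^sub>R u) - dir_deriv u f (x + 0 *\<^sub>R u)) (at 0)"
      by (intro has_vector_derivative_diff smooth_line_derivative df)
    ultimately have "integral (cbox 0 T) (\<lambda>t. dir_deriv u (dir_deriv v f) ((x + t *\<^sub>R v) + 0 *\<^sub>R u)) =
        dir_deriv u f ((x + T *\<^sub>R v) + 0 *\<^sub>R u) - dir_deriv u f (x + 0 *\<^sub>R u)"
      using vector_derivative_unique_at by blast
    moreover have "integral {0..T} (\<lambda>t. dir_deriv v (dir_deriv u f) (x + t *\<^sub>R v)) = dir_deriv u f (x + T *\<^sub>R v) - dir_deriv u f x"
      using has_integral_dir_deriv[OF df(2)[OF u], of T v x] that by (intro integral_unique) auto
    ultimately show ?thesis by simp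
  qed
  from eq_of_integrals_eq[OF cl[OF u v] cl[OF v u] zero_less_one this] show ?thesis by simp
qed

lemma smooth_wirtinger:
  assumes "smooth f" "u \<in> Basis" "v \<in> Basis"
  shows "smooth (wirtinger u v f)" "smooth (wirtinger_bar u v f)"
  unfolding wirtinger_dir_deriv by (intro smooth_add smooth_mult smooth_const smooth_dir_deriv assms)+

lemma complex_Basis: "1 \<in> (Basis :: complex set)" "\<i> \<in> (Basis :: complex set)"
  by (simp_all add: Basis_complex_def)

lemma wirtinger_commute:
  fixes f :: "complex \<Rightarrow> complex"
  assumes "smooth f"
  shows "wirtinger_bar 1 \<i> (wirtinger 1 \<i> f) = wirtinger 1 \<i> (wirtinger_bar 1 \<i> f)"
proof
  fix x
  note d = smooth_differentiable[OF smooth_dir_deriv[OF assms]]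
  have L: "dir_deriv b (\<lambda>x. c * dir_deriv 1 f x + e * dir_deriv \<i> f x) x =
    c * dir_deriv b (dir_deriv 1 f) x + e * dir_deriv b (dir_deriv \<i> f) x" for b c e
    by (intro dir_deriv_lincomb d complex_Basis)
  show "wirtinger_bar 1 \<i> (wirtinger 1 \<i> f) x = wirtinger 1 \<i> (wirtinger_bar 1 \<i> f) x"
    unfolding wirtinger_dir_deriv L
    by (simp add: dir_deriv_commute[OF assms complex_Basis(2,1)] algebra_simps)
qed

section \<open>The bilinear form and plane waves\<close>

lemma bounded_linear_scalar_product: "bounded_linear (\<lambda>z. scalar_product z w)"
  for w :: "complex ^ 'n::finite"
  unfolding scalar_product_def
  by (intro bounded_linear_sum bounded_linear_compose[OF bounded_linear_mult_left] bounded_linear_vec_nth)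

lemma scalar_product_commute: "scalar_product z w = scalar_product w (z :: complex ^ 'n::finite)"
  by (simp add: scalar_product_def mult.commute)

lemma continuous_on_scalar_product [continuous_intros]:
  fixes f g :: "_ \<Rightarrow> complex ^ 'n::finite"
  assumes "continuous_on S f" "continuous_on S g"
  shows "continuous_on S (\<lambda>x. scalar_product (f x) (g x))"
  unfolding scalar_product_def by (intro continuous_intros assms)

lemma norm_scalar_product_le: "norm (scalar_product z w) \<le> norm z * norm w"
  for z w :: "complex ^ 'n::finite"
proof -
  have "norm (scalar_product z w) \<le> (\<Sum>i\<in>UNIV. \<bar>norm (z $ i)\<bar> * \<bar>norm (w $ i)\<bar>)"
    unfolding scalar_product_def by (rule sum_norm_le) (simp add: norm_mult)
  also have "\<dots> \<le> L2_set (\<lambda>i. norm (z $ i)) UNIV * L2_set (\<lambda>i. norm (w $ i)) UNIV"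
    by (rule L2_set_mult_ineq)
  finally show ?thesis by (simp add: norm_vec_def)
qed

lemma scalar_product_simps:
  fixes z w y :: "complex ^ 'n::finite"
  shows "scalar_product (z + y) w = scalar_product z w + scalar_product y w"
    "scalar_product (z - y) w = scalar_product z w - scalar_product y w"
    "scalar_product w (z + y) = scalar_product w z + scalar_product w y"
    "scalar_product w (z - y) = scalar_product w z - scalar_product w y"
    "scalar_product (c *s z) w = c * scalar_product z w"
    "scalar_product w (c *s z) = c * scalar_product w z"
    "scalar_product (r *\<^sub>R z) w = r *\<^sub>R scalar_product z w"
    "scalar_product w (r *\<^sub>R z) = r *\<^sub>R scalar_product w z"
    "scalar_product 0 w = 0" "scalar_product w 0 = 0"
  by (simp_all add: scalar_product_def algebra_simps sum.distrib sum_subtractf sum_distrib_left scaleR_sum_right)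

lemma smooth_family_plane_wave:
  fixes F :: "'y::metric_space \<Rightarrow> complex \<Rightarrow> complex" and \<omega> :: "'y \<Rightarrow> complex ^ 'n::finite"
  assumes "smooth_family (\<lambda>_. 1) Y F" "continuous_on Y \<omega>" "bounded (\<omega> ` Y)" "continuous_on Y \<tau>"
  shows "smooth_family (\<lambda>_. 1) Y (\<lambda>y z. F y (scalar_product z (\<omega> y) + \<tau> y))"
proof (rule smooth_family_affine[OF assms(1) bounded_linear_scalar_product _ _ assms(4)])
  fix b :: "complex ^ 'n"
  show "continuous_on Y (\<lambda>y. scalar_product b (\<omega> y))" by (intro continuous_intros assms)
  have "(\<lambda>y. scalar_product b (\<omega> y)) ` Y = (\<lambda>w. scalar_product w b) ` \<omega> ` Y"
    by (simp add: image_image scalar_product_commute)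
  then show "bounded ((\<lambda>y. scalar_product b (\<omega> y)) ` Y)"
    using bounded_linear_image[OF assms(3) bounded_linear_scalar_product] by simp
qed

section \<open>Surface measure of the sphere\<close>

lemma sets_sphere_measure:
  "sets (sphere_measure :: 'a::euclidean_space measure) = sets (restrict_space borel (sphere 0 1))"
  by (simp add: sphere_measure_def)

lemma space_sphere_measure: "space (sphere_measure :: 'a::euclidean_space measure) = sphere 0 1"
  using sets_eq_imp_space_eq[OF sets_sphere_measure] by (simp add: space_restrict_space)

lemma normalize_measurable:
  "(\<lambda>x. x /\<^sub>R norm x) \<in> restrict_space lborel (ball 0 1 - {0}) \<rightarrow>\<^sub>M restrict_space borel (sphere (0::'a::euclidean_space) 1)"
  by (intro measurable_restrict_space2 measurable_restrict_space1) (auto simp: space_restrict_space)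

text \<open>The surface measure carried over to the Borel sets of the ambient space, the form
  demanded by \<open>compact_parameter\<close>.\<close>

definition sphere_borel :: "'a::euclidean_space measure" where
  "sphere_borel = distr sphere_measure borel (\<lambda>w. w)"

lemma sphere_id_measurable: "(\<lambda>w. w) \<in> sphere_measure \<rightarrow>\<^sub>M (borel :: 'a::euclidean_space measure)"
  using measurable_ident measurable_restrict_space1[of "\<lambda>w. w" borel borel "sphere 0 1"]
  by (simp add: measurable_cong_sets[OF sets_sphere_measure refl])

lemma finite_sphere_measure: "finite_measure (sphere_measure :: 'a::euclidean_space measure)"
proof
  let ?R = "restrict_space lborel (ball (0::'a) 1 - {0})"
  let ?E = "emeasure (distr ?R (restrict_space borel (sphere 0 1)) (\<lambda>x. x /\<^sub>R norm x)) (space (sphere_measure :: 'a measure))"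
  have "?E \<le> emeasure ?R (space ?R)"
  proof (subst emeasure_distr[OF normalize_measurable])
    show "space (sphere_measure :: 'a measure) \<in> sets (restrict_space borel (sphere 0 1))"
      unfolding sets_sphere_measure[symmetric] by (rule sets.top)
  qed (intro emeasure_mono sets.top Int_lower2)
  also have "emeasure ?R (space ?R) = emeasure lborel (ball (0::'a) 1 - {0})"
    by (subst emeasure_restrict_space) (auto simp: space_restrict_space)
  also have "\<dots> \<le> emeasure lborel (ball (0::'a) 1)" by (intro emeasure_mono) auto
  also have "\<dots> < \<infinity>" using emeasure_lborel_ball_finite by (simp add: less_top)
  finally have "of_nat DIM('a) * ?E \<noteq> top" by (simp add: ennreal_mult_eq_top_iff)
  then show "emeasure (sphere_measure :: 'a measure) (space sphere_measure) \<noteq> \<infinity>"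
    by (simp add: sphere_measure_def)
qed

lemma compact_parameter_sphere: "compact_parameter (sphere_borel :: 'a::euclidean_space measure) (sphere 0 1)"
proof -
  interpret finite_measure "sphere_measure :: 'a measure" by (rule finite_sphere_measure)
  interpret f: finite_measure "sphere_borel :: 'a measure"
    unfolding sphere_borel_def by (rule finite_measure_distr[OF sphere_id_measurable])
  show ?thesis
    by unfold_locales (auto simp: sphere_borel_def less_top[symmetric] f.emeasure_finite[unfolded sphere_borel_def])
qed

lemma sphere_integral:
  fixes F :: "'a::euclidean_space \<Rightarrow> complex"
  assumes "continuous_on (sphere 0 1) F"
  shows "(LINT w|sphere_measure. F w) = (LINT w:sphere 0 1|sphere_borel. F w)"
proof -
  have "(\<lambda>w. indicator (sphere 0 1) w *\<^sub>R F w) \<in> borel_measurable borel"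
    using assms by (intro borel_measurable_continuous_on_indicator) auto
  then have "(LINT w:sphere 0 1|sphere_borel. F w) = (LINT w|sphere_measure. indicator (sphere 0 1) w *\<^sub>R F w)"
    unfolding set_lebesgue_integral_def sphere_borel_def by (intro integral_distr sphere_id_measurable) auto
  also have "\<dots> = (LINT w|sphere_measure. F w)"
    by (rule Bochner_Integration.integral_cong) (auto simp: space_sphere_measure)
  finally show ?thesis ..
qed

lemma wirtinger_dir_deriv_inverse:
  fixes f :: "complex \<Rightarrow> complex"
  shows "dir_deriv 1 f = (\<lambda>s. wirtinger 1 \<i> f s + wirtinger_bar 1 \<i> f s)"
    "dir_deriv \<i> f = (\<lambda>s. \<i> * wirtinger 1 \<i> f s + (- \<i>) * wirtinger_bar 1 \<i> f s)"
  unfolding wirtinger_dir_deriv by (auto simp: fun_eq_iff field_simps)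

section \<open>The test functions on the space of hyperplanes\<close>

lemma closed_X_space: "closed X_space" unfolding X_space_def by (intro closed_Times) auto

lemma not_in_supp_X: "w \<in> sphere 0 1 \<Longrightarrow> (w, s) \<notin> supp_X h \<Longrightarrow> h (w, s) = 0"
  using subsetD[OF closure_subset[of "{x \<in> X_space. h x \<noteq> 0}"], of "(w, s)"]
  by (auto simp: X_space_def supp_X_def)

text \<open>Membership in \<open>E_X\<close> controls Wirtinger derivatives in one order only, the
  conjugate ones being applied first. Since they commute, the functions \<open>G p q\<close> are
  permuted by both operators, and real derivatives are combinations of these. The bounds come from
  compactness of the support, off which every \<open>G p q\<close> vanishes.\<close>

lemma D_X_smooth_family:
  fixes h :: "(complex ^ 'n::finite) \<times> complex \<Rightarrow> complex"
  assumes h: "h \<in> D_X"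
  shows "smooth_family (\<lambda>_. 1) (sphere 0 1) (\<lambda>w s. h (w, s))"
proof -
  define G where "G p q w = (wirtinger 1 \<i> ^^ p) ((wirtinger_bar 1 \<i> ^^ q) (\<lambda>s. h (w, s)))" for p q :: nat and w
  have sm: "smooth (\<lambda>s. h (w, s))" if "w \<in> sphere 0 1" for w
    using h that unfolding D_X_def E_X_def by blast
  have cont: "continuous_on (sphere 0 1 \<times> UNIV) (\<lambda>(w, s). G p q w s)" for p q
    using h unfolding D_X_def E_X_def X_space_def G_def by blast
  have smb: "smooth ((wirtinger_bar 1 \<i> ^^ q) (\<lambda>s. h (w, s)))" if "w \<in> sphere 0 1" for q w
    using sm[OF that] by (induction q) (auto intro: smooth_wirtinger complex_Basis)
  have smG: "smooth (G p q w)" if "w \<in> sphere 0 1" for p q w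
    unfolding G_def using smb[OF that] by (induction p) (auto intro: smooth_wirtinger complex_Basis)
  have S: "wirtinger 1 \<i> (G p q w) = G (Suc p) q w" for p q w by (simp add: G_def)
  have Sb: "wirtinger_bar 1 \<i> (G p q w) = G p (Suc q) w" if "w \<in> sphere 0 1" for p q w
  proof (induction p)
    case (Suc p)
    have "wirtinger_bar 1 \<i> (G (Suc p) q w) = wirtinger_bar 1 \<i> (wirtinger 1 \<i> (G p q w))" by (simp add: S)
    also have "\<dots> = wirtinger 1 \<i> (wirtinger_bar 1 \<i> (G p q w))" by (rule wirtinger_commute[OF smG[OF that]])
    finally show ?case by (simp add: Suc S)
  qed (simp add: G_def)
  have cs: "compact (supp_X h)" using h by (simp add: D_X_def)
  have G0: "G p q w s = 0" if w: "w \<in> sphere 0 1" and ws: "(w, s) \<notin> supp_X h" for p q w s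
  proof -
    define U where "U = {s. (w, s) \<notin> supp_X h}"
    have "U = (\<lambda>s. (w, s)) -` (- supp_X h)" by (auto simp: U_def)
    then have U: "open U"
      using cs by (auto intro!: open_vimage continuous_intros simp: compact_imp_closed open_Compl)
    have z: "wirtinger 1 \<i> f s = 0" "wirtinger_bar 1 \<i> f s = 0"
      if "\<And>s. s \<in> U \<Longrightarrow> f s = 0" "s \<in> U" for f s
      using dir_deriv_eq_0_open[OF U that] by (simp_all add: wirtinger_dir_deriv)
    have "(wirtinger_bar 1 \<i> ^^ q) (\<lambda>s. h (w, s)) s = 0" if "s \<in> U" for q s
      using that by (induction q arbitrary: s) (auto simp: U_def not_in_supp_X[OF w] intro: z(2))
    then have "G p q w s = 0" if "s \<in> U" for s
      unfolding G_def using that by (induction p arbitrary: s) (auto intro: z(1))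
    then show ?thesis using ws by (simp add: U_def)
  qed
  have bd: "\<exists>C. \<forall>w\<in>sphere 0 1. \<forall>s. norm (G p q w s) \<le> C * 1" for p q
  proof -
    have "supp_X h \<subseteq> X_space"
      unfolding supp_X_def by (rule closure_minimal[OF _ closed_X_space]) auto
    then have "compact ((\<lambda>(w, s). G p q w s) ` supp_X h)"
      by (intro compact_continuous_image cs continuous_on_subset[OF cont]) (simp add: X_space_def)
    then have "bounded ((\<lambda>(w, s). G p q w s) ` supp_X h)" by (rule compact_imp_bounded)
    then obtain B where "\<forall>x\<in>(\<lambda>(w, s). G p q w s) ` supp_X h. norm x \<le> B"
      unfolding bounded_iff by blast
    then have B: "norm (G p q w s) \<le> B" if "(w, s) \<in> supp_X h" for w s
      using that by fastforce
    have "norm (G p q w s) \<le> \<bar>B\<bar>" if "w \<in> sphere 0 1" for w s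
      using B[of w s] G0[OF that, of s p q] by (cases "(w, s) \<in> supp_X h") auto
    then show ?thesis by (intro exI[of _ "\<bar>B\<bar>"]) simp
  qed
  have "ck_family m (\<lambda>_. 1) (sphere 0 1) (G p q)" for m p q
  proof (induction m arbitrary: p q)
    case 0
    show ?case unfolding ck_family.simps by (intro conjI cont bd)
  next
    case (Suc m)
    have "ck_family m (\<lambda>_. 1) (sphere 0 1) (\<lambda>w. dir_deriv b (G p q w))" if "b \<in> Basis" for b :: complex
    proof -
      have c: "ck_family m (\<lambda>_. 1) (sphere 0 1) (\<lambda>w s. c * G p q w s)" for c p q
      proof -
        have "ck_family m (\<lambda>_::complex. 1) (sphere 0 1) (\<lambda>(w::complex ^ 'n) s. c)"
          using smooth_family_const unfolding smooth_family_def by blast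
        from ck_family_mult[OF this Suc] show ?thesis by simp
      qed
      have "ck_family m (\<lambda>_. 1) (sphere 0 1) (\<lambda>w s. c * G (Suc p) q w s + d * G p (Suc q) w s)" for c d
        by (intro ck_family_add c)
      note c2 = this[of 1 1, unfolded mult_1] this[of \<i> "- \<i>"]
      have "ck_family m (\<lambda>_. 1) (sphere 0 1) (\<lambda>w. dir_deriv 1 (G p q w))"
        by (subst ck_family_cong[OF _, where g="\<lambda>w s. G (Suc p) q w s + G p (Suc q) w s"])
          (simp_all only: c2 wirtinger_dir_deriv_inverse S Sb)
      moreover have "ck_family m (\<lambda>_. 1) (sphere 0 1) (\<lambda>w. dir_deriv \<i> (G p q w))"
        by (subst ck_family_cong[OF _, where g="\<lambda>w s. \<i> * G (Suc p) q w s + (- \<i>) * G p (Suc q) w s"])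
          (simp_all only: c2 wirtinger_dir_deriv_inverse S Sb)
      ultimately show ?thesis using that by (auto simp: Basis_complex_def)
    qed
    then show ?case unfolding ck_family.simps by (intro conjI cont bd ballI allI smooth_differentiable smG)
  qed
  moreover have "G 0 0 = (\<lambda>w s. h (w, s))" by (simp add: G_def fun_eq_iff)
  ultimately show ?thesis unfolding smooth_family_def by metis
qed

lemma D_X_I:
  fixes h :: "(complex ^ 'n::finite) \<times> complex \<Rightarrow> complex"
  assumes fam: "smooth_family (\<lambda>_. 1) (sphere 0 1) (\<lambda>w s. h (w, s))"
    and inv: "\<And>w s \<theta>. w \<in> sphere 0 1 \<Longrightarrow> h (cis \<theta> *s w, s * cis \<theta>) = h (w, s)"
    and C: "compact C" "\<And>w s. w \<in> sphere 0 1 \<Longrightarrow> (w, s) \<notin> C \<Longrightarrow> h (w, s) = 0"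
  shows "h \<in> D_X" "supp_X h \<subseteq> C"
proof -
  have "smooth_family (\<lambda>_. 1) (sphere 0 1) (\<lambda>w. (wirtinger_bar 1 \<i> ^^ q) (\<lambda>s. h (w, s)))" for q
    by (induction q) (auto intro: smooth_family_wirtinger complex_Basis fam)
  then have "smooth_family (\<lambda>_. 1) (sphere 0 1) (\<lambda>w. (wirtinger 1 \<i> ^^ p) ((wirtinger_bar 1 \<i> ^^ q) (\<lambda>s. h (w, s))))" for p q
    by (induction p) (auto intro: smooth_family_wirtinger complex_Basis)
  from smooth_family_continuous[OF this]
  have "h \<in> E_X" using inv smooth_family_smooth[OF fam] by (auto simp: E_X_def X_space_def)
  moreover have "x \<in> C" if "x \<in> X_space" "h x \<noteq> 0" for x
    using C(2)[of "fst x" "snd x"] that by (cases x) (auto simp: X_space_def)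
  then show s: "supp_X h \<subseteq> C"
    unfolding supp_X_def by (intro closure_minimal compact_imp_closed C) auto
  then have "compact (supp_X h)"
    using compact_Int_closed[OF C(1), of "supp_X h"] by (simp add: Int_absorb1 supp_X_def)
  ultimately show "h \<in> D_X" by (simp add: D_X_def)
qed

section \<open>Localisation of the distribution\<close>

context rapidly_decreasing_distribution
begin

lemma T_linear:
  assumes "\<phi> \<in> test_functions" "\<psi> \<in> test_functions"
  shows "T (\<lambda>x. a * \<phi> x + b * \<psi> x) = a * T \<phi> + b * T \<psi>"
  using rd assms unfolding rapidly_decreasing_def distribution_def by blast

lemma T_zero [simp]: "T (\<lambda>x. 0) = 0"
proof -
  have "(\<lambda>x. 0) \<in> test_functions"
    by (rule test_functionI(1)[OF smooth_const, of "{}"]) auto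
  from T_linear[OF this this, of 0 0] show ?thesis by simp
qed

text \<open>Instead of a partition of unity, \<open>\<phi>\<close> is multiplied successively by the
  factors \<open>1 - b x\<close>. Each factor subtracts a piece that \<open>T\<close> annihilates,
  and after finitely many of them nothing is left on the support.\<close>

lemma vanishes_off_support:
  assumes \<phi>: "\<phi> \<in> test_functions" and disj: "supp \<phi> \<inter> distr_support T = {}"
  shows "T \<phi> = 0"
proof -
  have "\<exists>r>0. \<forall>\<psi>\<in>test_functions. supp \<psi> \<subseteq> cball x (2 * r) \<longrightarrow> T \<psi> = 0" if x: "x \<in> supp \<phi>" for x
  proof -
    have "x \<notin> distr_support T" using disj x by blast
    then obtain U where U: "open U" "x \<in> U" "\<forall>\<psi>\<in>test_functions. supp \<psi> \<subseteq> U \<longrightarrow> T \<psi> = 0"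
      unfolding distr_support_def by blast
    then obtain e where "e > 0" "ball x e \<subseteq> U" by (meson open_contains_ball)
    \<comment> \<open>A bump of scale \<open>r\<close> is 1 up to radius \<open>r\<close> and may
      live up to \<open>2 r\<close>, hence a third of \<open>e\<close>.\<close>
    then have "cball x (2 * (e / 3)) \<subseteq> U" by auto
    then show ?thesis using U(3) \<open>e > 0\<close> by (intro exI[of _ "e / 3"]) auto
  qed
  then obtain r where r: "\<And>x. x \<in> supp \<phi> \<Longrightarrow> r x > 0"
    "\<And>x \<psi>. x \<in> supp \<phi> \<Longrightarrow> \<psi> \<in> test_functions \<Longrightarrow> supp \<psi> \<subseteq> cball x (2 * r x) \<Longrightarrow> T \<psi> = 0"
    by metis
  have "supp \<phi> \<subseteq> (\<Union>x\<in>supp \<phi>. ball x (r x))" using r(1) by force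
  then obtain F where F: "F \<subseteq> supp \<phi>" "finite F" "supp \<phi> \<subseteq> (\<Union>x\<in>F. ball x (r x))"
    using compactE_image[OF test_functionD(2)[OF \<phi>], of "supp \<phi>" "\<lambda>x. ball x (r x)"] by auto
  define b where "b x y = bump ((1 / r x) *\<^sub>R (y - x))" for x y
  have "(\<lambda>y. \<phi> y * (\<Prod>x\<in>F. 1 - b x y)) \<in> test_functions \<and> T (\<lambda>y. \<phi> y * (\<Prod>x\<in>F. 1 - b x y)) = T \<phi>"
    using F(2,1)
  proof (induction F rule: finite_induct)
    case empty
    then show ?case using \<phi> by simp
  next
    case (insert x F)
    define \<psi> where "\<psi> y = \<phi> y * (\<Prod>x\<in>F. 1 - b x y)" for y
    have IH: "\<psi> \<in> test_functions" "T \<psi> = T \<phi>" using insert by (simp_all add: \<psi>_def[abs_def])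
    have rx: "r x > 0" using r(1) insert.prems by simp
    have t: "(\<lambda>y. b x y * \<psi> y) \<in> test_functions" "supp (\<lambda>y. b x y * \<psi> y) \<subseteq> cball x (2 * r x)"
      using bump_mult_test[OF tempered_test[OF IH(1)], of "1 / r x" x] rx by (simp_all add: b_def)
    \<comment> \<open>The new factor changes \<open>\<psi>\<close> by \<open>b x * \<psi>\<close>, a
      test function supported in a ball on which \<open>T\<close> vanishes.\<close>
    have e: "(\<lambda>y. \<phi> y * (\<Prod>x\<in>insert x F. 1 - b x y)) = (\<lambda>y. 1 * \<psi> y + (-1) * (b x y * \<psi> y))"
      using insert by (auto simp: \<psi>_def algebra_simps)
    have "smooth (\<lambda>y. 1 * \<psi> y + (-1) * (b x y * \<psi> y))"
      by (intro smooth_add smooth_mult[OF smooth_const] test_functionD(1) IH t)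
    then have "(\<lambda>y. 1 * \<psi> y + (-1) * (b x y * \<psi> y)) \<in> test_functions"
      by (rule test_functionI(1)[OF _ test_functionD(2)[OF IH(1)]]) (simp add: not_in_supp[of _ \<psi>])
    moreover have "T (\<lambda>y. b x y * \<psi> y) = 0" using r(2) t insert.prems by blast
    ultimately show ?case unfolding e T_linear[OF IH(1) t(1)] using IH(2) by simp
  qed
  moreover have "\<phi> y * (\<Prod>x\<in>F. 1 - b x y) = 0" for y
  proof (cases "y \<in> supp \<phi>")
    case True
    then obtain x where x: "x \<in> F" "y \<in> ball x (r x)" using F(3) by blast
    then have "r x > 0" using F(1) r(1) by blast
    with x(2) have "b x y = 1"
      unfolding b_def by (intro bump_1) (simp add: dist_norm norm_minus_commute)
    then show ?thesis using x(1) F(2) by (auto intro!: prod_zero bexI[of _ x])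
  qed (simp add: not_in_supp)
  ultimately show ?thesis by simp
qed

end

subsection \<open>The dual Radon transform\<close>

lemma dual_radon_integral:
  fixes h :: "(complex ^ 'n::finite) \<times> complex \<Rightarrow> complex"
  assumes "smooth_family (\<lambda>_. 1) (sphere 0 1) (\<lambda>w s. h (w, s))"
  shows "dual_radon h = (\<lambda>z. LINT w:sphere 0 1|sphere_borel. h (w, scalar_product z w))"
    and "smooth_family (\<lambda>_. 1) (sphere 0 1) (\<lambda>w z. h (w, scalar_product z w))"
proof -
  have "smooth_family (\<lambda>_. 1) (sphere 0 1) (\<lambda>w z. h (w, scalar_product z w + 0))"
    by (rule smooth_family_plane_wave[OF assms]) (auto intro: continuous_intros simp: compact_imp_bounded)
  then show f: "smooth_family (\<lambda>_. 1) (sphere 0 1) (\<lambda>w z. h (w, scalar_product z w))" by simp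
  show "dual_radon h = (\<lambda>z. LINT w:sphere 0 1|sphere_borel. h (w, scalar_product z w))"
    unfolding dual_radon_def by (rule ext, rule sphere_integral) (rule smooth_family_continuous_param[OF f])
qed

lemma smooth_family_dual_radon:
  assumes "h \<in> D_X"
  shows "smooth_family (\<lambda>_. 1) Y (\<lambda>_. dual_radon h)"
  unfolding dual_radon_integral(1)[OF D_X_smooth_family[OF assms]]
  by (rule compact_parameter.smooth_family_integral[OF compact_parameter_sphere])
    (rule dual_radon_integral(2)[OF D_X_smooth_family[OF assms]])

context rapidly_decreasing_distribution
begin

lemma radon_ext: "h \<in> D_X \<Longrightarrow> radon T h = ext T (dual_radon h)"
  unfolding radon_def by (rule pairing_ext[OF smooth_family_dual_radon])

lemma radon_swap:
  assumes h: "h \<in> D_X"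
  shows "radon T h = (LINT w:sphere 0 1|sphere_borel. ext T (\<lambda>z. h (w, scalar_product z w)))"
  unfolding radon_ext[OF h] dual_radon_integral(1)[OF D_X_smooth_family[OF h]]
  by (rule ext_swap[OF compact_parameter_sphere])
    (rule tempered_familyI[OF dual_radon_integral(2)[OF D_X_smooth_family[OF h]]])

text \<open>The dual transform of \<open>h\<close> vanishes off the set of points through which some
  hyperplane of the support of \<open>h\<close> passes, and these points avoid \<open>K\<close>. As
  this function need not have compact support, the conclusion is drawn for its cut-offs.\<close>

lemma radon_supported:
  assumes K: "distr_support T \<subseteq> K"
  shows "X_supported_in (radon T) (hat K)"
  unfolding X_supported_in_def
proof (intro ballI impI)
  fix h assume h: "h \<in> D_X" and sh: "supp_X h \<subseteq> X_space - hat K"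
  let ?S = "sphere (0 :: complex ^ 'n) 1"
  \<comment> \<open>Closedness of \<open>V\<close> comes from projecting a closed set along the
    compact sphere.\<close>
  define V where "V = {z. \<exists>w. w \<in> ?S \<and> (w, z) \<in> {(w, z). w \<in> ?S \<and> (w, scalar_product z w) \<in> supp_X h}}"
  have "closed (supp_X h)" by (simp add: supp_X_def)
  then have "closed ((\<lambda>p. (fst p, scalar_product (snd p) (fst p))) -` supp_X h)"
    by (rule closed_vimage) (intro continuous_intros)
  then have "closed (((\<lambda>p. (fst p, scalar_product (snd p) (fst p))) -` supp_X h) \<inter> (?S \<times> UNIV))"
    by (intro closed_Int closed_Times) auto
  also have "((\<lambda>p. (fst p, scalar_product (snd p) (fst p))) -` supp_X h) \<inter> (?S \<times> UNIV) =
      {(w, z). w \<in> ?S \<and> (w, scalar_product z w) \<in> supp_X h}" by auto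
  finally have "closed V"
    unfolding V_def by (intro closed_compact_projection compact_sphere)
  have z: "dual_radon h z = 0" if "z \<notin> V" for z
  proof -
    have "h (w, scalar_product z w) = 0" if "w \<in> ?S" for w
      by (rule not_in_supp_X[OF that]) (use \<open>z \<notin> V\<close> that in \<open>auto simp: V_def\<close>)
    then have "dual_radon h z = (LINT w:?S|sphere_borel. 0)"
      unfolding dual_radon_integral(1)[OF D_X_smooth_family[OF h]]
      by (intro set_lebesgue_integral_cong compact_parameter.Y_sets[OF compact_parameter_sphere]) auto
    then show ?thesis by (simp add: set_lebesgue_integral_def)
  qed
  have "V \<inter> K = {}"
  proof -
    have "(w, scalar_product z w) \<in> hat K" if "z \<in> K" "w \<in> ?S" for z w
      using that by (auto simp: hat_def chyperplane_def)
    then show ?thesis using sh by (auto simp: V_def)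
  qed
  have "ext T (dual_radon h) = 0"
  proof (rule ext_eq_0I)
    fix t :: real assume "t > 0"
    have t: "(\<lambda>x. bump (t *\<^sub>R x) * dual_radon h x) \<in> test_functions"
      using bump_mult_test(1)[OF tempered_familyI[OF smooth_family_dual_radon[OF h]] \<open>t > 0\<close>, of 0] by simp
    have "supp (\<lambda>x. bump (t *\<^sub>R x) * dual_radon h x) \<subseteq> V"
      unfolding supp_def by (rule closure_minimal[OF _ \<open>closed V\<close>]) (use z in auto)
    then show "T (\<lambda>x. bump (t *\<^sub>R x) * dual_radon h x) = 0"
      using \<open>V \<inter> K = {}\<close> K by (intro vanishes_off_support t) blast
  qed
  then show "radon T h = 0" by (simp add: radon_ext[OF h])
qed

end

subsection \<open>Averages over the sphere\<close>

lemma nn_integral_lborel_affine: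
  fixes f :: "'a::euclidean_space \<Rightarrow> ennreal"
  assumes f: "f \<in> borel_measurable borel" and c: "\<bar>c\<bar> = 1"
  shows "(\<integral>\<^sup>+x. f (t + c *\<^sub>R x) \<partial>lborel) = (\<integral>\<^sup>+x. f x \<partial>lborel)"
proof -
  have m: "(\<lambda>x. t + c *\<^sub>R x) \<in> (lborel :: 'a measure) \<rightarrow>\<^sub>M borel" by simp
  have "lborel = density (distr lborel borel (\<lambda>x::'a. t + c *\<^sub>R x)) (\<lambda>_. 1)"
    using lborel_affine[of c t] c by auto
  then have "(\<integral>\<^sup>+x. f x \<partial>lborel) = (\<integral>\<^sup>+x. f x \<partial>distr lborel borel (\<lambda>x::'a. t + c *\<^sub>R x))"
    by (metis density_1)
  then show ?thesis using nn_integral_distr[OF m, of f] f by simp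
qed

text \<open>Fubini and translation invariance exchange the roles of a set A and the unit ball, whose
  preimage under U is the unit ball.\<close>

lemma lborel_linear_isometry:
  fixes U :: "'a::euclidean_space \<Rightarrow> 'a"
  assumes U: "linear U" "\<And>x. norm (U x) = norm x" and A: "A \<in> sets borel"
  shows "emeasure lborel (U -` A) = emeasure lborel A"
proof -
  have surj: "surj U"
    using U by (metis linear_injective_0 linear_injective_imp_surjective norm_eq_zero)
  have [measurable]: "U \<in> borel \<rightarrow>\<^sub>M borel"
    by (intro borel_measurable_continuous_onI linear_continuous_on linear_conv_bounded_linear[THEN iffD1] U)
  define B :: "'a set" where "B = ball 0 1"
  have [measurable]: "B \<in> sets borel" "A \<in> sets borel" using A by (auto simp: B_def)
  have UB: "U -` B = B" using U(2) by (auto simp: B_def)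
  have [measurable]: "U -` A \<in> sets borel" using measurable_sets_borel[of U borel A] by simp
  have "emeasure lborel (U -` A) * emeasure lborel B = (\<integral>\<^sup>+x. indicator A (U x) * (\<integral>\<^sup>+y. indicator B y \<partial>lborel) \<partial>lborel)"
    by (subst nn_integral_multc) (simp_all flip: indicator_vimage[of U A, unfolded o_def])
  also have "\<dots> = (\<integral>\<^sup>+x. (\<integral>\<^sup>+y. indicator A (U x) * indicator B (U x + y) \<partial>lborel) \<partial>lborel)"
    using nn_integral_lborel_affine[of "indicator B" 1] by (simp add: nn_integral_cmult)
  also have "\<dots> = (\<integral>\<^sup>+y. (\<integral>\<^sup>+x. indicator A (U x) * indicator B (U x + y) \<partial>lborel) \<partial>lborel)"
    by (rule lborel_pair.Fubini') measurable
  also have "\<dots> = (\<integral>\<^sup>+y. (\<integral>\<^sup>+x. indicator A (U x - y) * indicator B (U x) \<partial>lborel) \<partial>lborel)"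
  proof (rule nn_integral_cong)
    fix y :: 'a
    \<comment> \<open>Surjectivity of \<open>U\<close> turns a translation by \<open>y\<close> after
      \<open>U\<close> into a translation of the variable before \<open>U\<close>.\<close>
    obtain v where v: "y = U v" using surj by blast
    have "(\<integral>\<^sup>+x. indicator A (U x) * indicator B (U x + y) \<partial>lborel) =
      (\<integral>\<^sup>+x. indicator A (U (- v + 1 *\<^sub>R x)) * indicator B (U (- v + 1 *\<^sub>R x) + y) \<partial>lborel)"
      by (rule nn_integral_lborel_affine[symmetric, of "\<lambda>x. indicator A (U x) * indicator B (U x + y)"]) measurable
    then show "(\<integral>\<^sup>+x. indicator A (U x) * indicator B (U x + y) \<partial>lborel) =
      (\<integral>\<^sup>+x. indicator A (U x - y) * indicator B (U x) \<partial>lborel)"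
      by (simp add: v linear_diff[OF U(1)])
  qed
  also have "\<dots> = (\<integral>\<^sup>+x. (\<integral>\<^sup>+y. indicator A (U x - y) * indicator B (U x) \<partial>lborel) \<partial>lborel)"
    by (rule lborel_pair.Fubini') measurable
  also have "\<dots> = (\<integral>\<^sup>+x. (\<integral>\<^sup>+y. indicator A y \<partial>lborel) * indicator B (U x) \<partial>lborel)"
    using nn_integral_lborel_affine[of "indicator A" "-1"] by (simp add: nn_integral_multc)
  also have "\<dots> = emeasure lborel A * emeasure lborel (U -` B)"
    by (subst nn_integral_cmult) (simp_all flip: indicator_vimage[of U B, unfolded o_def] add: UB)
  finally have "emeasure lborel (U -` A) * emeasure lborel B = emeasure lborel A * emeasure lborel B"
    by (simp add: UB)
  moreover have "emeasure lborel B \<noteq> 0" "emeasure lborel B \<noteq> top"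
    using emeasure_lborel_ball_finite[of "0::'a" 1] order.strict_implies_not_eq[OF unit_ball_vol_pos[of "real DIM('a)"]]
    by (auto simp: B_def emeasure_ball less_top[symmetric])
  ultimately show ?thesis by (metis ennreal_mult_divide_eq)
qed

lemma emeasure_sphere_borel:
  assumes A: "A \<in> sets borel"
  shows "emeasure (sphere_borel :: 'a::euclidean_space measure) A =
    of_nat DIM('a) * emeasure lborel {x \<in> ball 0 1 - {0}. x /\<^sub>R norm x \<in> A}"
proof -
  have Ai: "A \<inter> sphere 0 1 \<in> sets (restrict_space borel (sphere (0::'a) 1))"
    using A by (auto simp: sets_restrict_space)
  have "emeasure (sphere_borel :: 'a measure) A = emeasure (sphere_measure :: 'a measure) (A \<inter> sphere 0 1)"
    unfolding sphere_borel_def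
    by (subst emeasure_distr[OF sphere_id_measurable A]) (simp add: space_sphere_measure)
  also have "\<dots> = of_nat DIM('a) * emeasure (restrict_space lborel (ball (0::'a) 1 - {0}))
      ((\<lambda>x. x /\<^sub>R norm x) -` (A \<inter> sphere 0 1) \<inter> (ball 0 1 - {0}))"
    unfolding sphere_measure_def
    by (simp add: emeasure_distr[OF normalize_measurable Ai] space_restrict_space)
  also have "((\<lambda>x. x /\<^sub>R norm x) -` (A \<inter> sphere 0 1) \<inter> (ball 0 1 - {0})) =
      {x \<in> ball 0 1 - {0::'a}. x /\<^sub>R norm x \<in> A}" by auto
  also have "emeasure (restrict_space lborel (ball (0::'a) 1 - {0})) {x \<in> ball 0 1 - {0}. x /\<^sub>R norm x \<in> A} =
      emeasure lborel {x \<in> ball 0 1 - {0::'a}. x /\<^sub>R norm x \<in> A}"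
    by (rule emeasure_restrict_space) auto
  finally show ?thesis .
qed

text \<open>\<open>U\<close> commutes with normalisation, so the cone over the preimage of
  \<open>A\<close> is the preimage of the cone over \<open>A\<close>, and invariance of Lebesgue
  measure applies.\<close>

lemma sphere_borel_linear_isometry:
  fixes U :: "'a::euclidean_space \<Rightarrow> 'a"
  assumes U: "linear U" "\<And>x. norm (U x) = norm x"
  shows "distr sphere_borel borel U = sphere_borel"
proof (rule measure_eqI)
  have m: "U \<in> borel \<rightarrow>\<^sub>M borel"
    by (intro borel_measurable_continuous_onI linear_continuous_on linear_conv_bounded_linear[THEN iffD1] U)
  then have m': "U \<in> sphere_borel \<rightarrow>\<^sub>M borel" by (simp add: sphere_borel_def)
  fix A assume "A \<in> sets (distr sphere_borel borel U)"
  then have A: "A \<in> sets borel" by simp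
  have UA: "U -` A \<in> sets borel" using measurable_sets_borel[OF m A] .
  have meas: "(\<lambda>x::'a. x /\<^sub>R norm x) \<in> borel \<rightarrow>\<^sub>M borel" by measurable
  have "{x \<in> ball 0 1 - {0}. x /\<^sub>R norm x \<in> A} = (ball 0 1 - {0}) \<inter> ((\<lambda>x. x /\<^sub>R norm x) -` A)" by auto
  also have "\<dots> \<in> sets borel" using measurable_sets_borel[OF meas A] by auto
  finally have C: "{x \<in> ball 0 1 - {0}. x /\<^sub>R norm x \<in> A} \<in> sets borel" .
  have "U x = 0 \<longleftrightarrow> x = 0" for x using U(2) by (metis norm_eq_zero)
  then have e: "{x \<in> ball 0 1 - {0}. x /\<^sub>R norm x \<in> U -` A} = U -` {x \<in> ball 0 1 - {0}. x /\<^sub>R norm x \<in> A}"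
    by (auto simp: U(2) linear_cmul[OF U(1)])
  have "emeasure (distr sphere_borel borel U) A = emeasure sphere_borel (U -` A)"
    by (simp add: emeasure_distr[OF m' A]) (simp add: sphere_borel_def)
  then show "emeasure (distr sphere_borel borel U) A = emeasure sphere_borel A"
    unfolding emeasure_sphere_borel[OF UA] emeasure_sphere_borel[OF A] e lborel_linear_isometry[OF U C] .
qed (simp add: sphere_borel_def)

lemma sphere_integral_isometry:
  fixes U :: "'a::euclidean_space \<Rightarrow> 'a" and F :: "'a \<Rightarrow> complex"
  assumes U: "linear U" "\<And>x. norm (U x) = norm x" and F: "continuous_on (sphere 0 1) F"
  shows "(LINT w:sphere 0 1|sphere_borel. F (U w)) = (LINT w:sphere 0 1|sphere_borel. F w)"
proof -
  have "U \<in> borel \<rightarrow>\<^sub>M borel"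
    by (intro borel_measurable_continuous_onI linear_continuous_on linear_conv_bounded_linear[THEN iffD1] U)
  then have m: "U \<in> sphere_borel \<rightarrow>\<^sub>M borel" by (simp add: sphere_borel_def)
  have "(\<lambda>w. indicator (sphere 0 1) w *\<^sub>R F w) \<in> borel_measurable borel"
    using F by (intro borel_measurable_continuous_on_indicator) auto
  then have "(LINT w|distr sphere_borel borel U. indicator (sphere 0 1) w *\<^sub>R F w) =
      (LINT w|sphere_borel. indicator (sphere 0 1) (U w) *\<^sub>R F (U w))"
    by (intro integral_distr m) auto
  moreover have "indicator (sphere 0 1) (U w) = (indicator (sphere 0 1) w :: real)" for w
    by (simp add: indicator_def U(2))
  ultimately show ?thesis
    by (simp add: set_lebesgue_integral_def sphere_borel_linear_isometry[OF U])
qed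

section \<open>Hermitian structure and reduction to one coordinate\<close>

definition vcnj :: "complex ^ 'n \<Rightarrow> complex ^ 'n" where
  "vcnj z = (\<chi> i. cnj (z $ i))"

text \<open>A conjugate in the second slot turns the bilinear form into the hermitian inner product;
  all norm computations below go through this identity.\<close>

lemma scalar_product_vcnj: "scalar_product z (vcnj z) = of_real ((norm z)\<^sup>2)"
  for z :: "complex ^ 'n::finite"
proof -
  have "scalar_product z (vcnj z) = (\<Sum>i\<in>UNIV. of_real ((norm (z $ i))\<^sup>2))"
    by (simp add: scalar_product_def vcnj_def complex_norm_square[symmetric])
  then show ?thesis by (simp add: norm_vec_def L2_set_def sum_nonneg)
qed

lemma vcnj_simps [simp]:
  fixes z w :: "complex ^ 'n::finite"
  shows "vcnj (z + w) = vcnj z + vcnj w" "vcnj (z - w) = vcnj z - vcnj w" "vcnj (c *s z) = cnj c *s vcnj z"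
    "vcnj (vcnj z) = z" "norm (vcnj z) = norm z" "vcnj 0 = 0"
    "cnj (scalar_product z w) = scalar_product (vcnj z) (vcnj w)"
  by (simp_all add: vcnj_def vec_eq_iff scalar_product_def norm_vec_def)

lemma vcnj_axis: "vcnj (axis i c) = axis i (cnj c)"
  by (simp add: vcnj_def axis_def vec_eq_iff)

lemma norm_scaleC: "norm (c *s z) = norm c * norm z" for z :: "complex ^ 'n::finite"
  by (simp add: norm_vec_def norm_mult L2_set_right_distrib)

lemma scalar_product_axis: "scalar_product (axis i c) w = c * w $ i"
  for w :: "complex ^ 'n::finite"
  by (simp add: scalar_product_def axis_def if_distrib[of "\<lambda>x. x * _"] cong: if_cong)

text \<open>A complex reflection carries z to a multiple of a basis vector. The phase c makes the
  hermitian product of z and the target real.\<close>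

lemma unitary_to_axis:
  fixes z :: "complex ^ 'n::finite" and i :: 'n
  obtains U :: "complex ^ 'n \<Rightarrow> complex ^ 'n" where "linear U" "\<And>w. norm (U w) = norm w"
    "\<And>w. norm (scalar_product z (U w)) = norm z * norm (w $ i)"
proof -
  define c where "c = (if z $ i = 0 then 1 else z $ i / of_real (norm (z $ i)))"
  have c: "norm c = 1" "z $ i * cnj c = of_real (norm (z $ i))"
  proof -
    show "norm c = 1" by (simp add: c_def norm_divide)
    show "z $ i * cnj c = of_real (norm (z $ i))"
    proof (cases "z $ i = 0")
      case False
      have "z $ i * cnj c = (z $ i * cnj (z $ i)) / of_real (norm (z $ i))"
        using False by (simp add: c_def)
      also have "\<dots> = of_real ((norm (z $ i))\<^sup>2 / norm (z $ i))"
        by (simp only: complex_norm_square[symmetric] of_real_divide)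
      also have "(norm (z $ i))\<^sup>2 / norm (z $ i) = norm (z $ i)"
        by (simp add: power2_eq_square)
      finally show ?thesis .
    qed (simp add: c_def)
  qed
  \<comment> \<open>The target: a vector on the \<open>i\<close>-th axis with the norm of
    \<open>z\<close> and the phase of its coordinate \<open>z $ i\<close>.\<close>
  define b where "b = (of_real (norm z) * c) *s axis i 1"
  have sp: "scalar_product b w = of_real (norm z) * c * (w $ i)" for w
    by (simp only: b_def scalar_product_simps scalar_product_axis mult_1)
  have nb: "norm b = norm z"
    by (simp add: b_def norm_scaleC norm_mult c(1))
  show thesis
  proof (cases "z = b")
    case True
    have "norm (scalar_product b w) = norm z * norm (w $ i)" for w
      by (simp add: sp norm_mult c(1))
    then show thesis
      using that[of "\<lambda>w. w"] True linear_id by (simp add: id_def)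
  next
    case False
    define p where "p = z - b"
    define d where "d = vcnj p"
    \<comment> \<open>The complex reflection that reverses \<open>d\<close> and fixes the hyperplane
      on which \<open>p\<close> vanishes. The conjugate in \<open>d\<close> adapts the hermitian
      reflection to the bilinear form.\<close>
    define U where "U w = w - (2 * scalar_product p w / of_real ((norm p)\<^sup>2)) *s d" for w
    have p0: "(norm p)\<^sup>2 \<noteq> 0" using False by (simp add: p_def)
    then have p0': "complex_of_real ((norm p)\<^sup>2) \<noteq> 0" by (metis of_real_eq_0_iff)
    have "linear U"
      by (rule linearI) (auto simp: U_def vec_eq_iff scalar_product_simps add_divide_distrib algebra_simps scaleR_conv_of_real[where 'a=complex])
    moreover have "norm (U w) = norm w" for w
    proof -
      define s where "s = scalar_product p w"
      define N where "N = complex_of_real ((norm p)\<^sup>2)"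
      have N: "N \<noteq> 0" "cnj N = N" using p0' by (simp_all add: N_def)
      have 1: "scalar_product d p = N" "scalar_product p d = N"
        using scalar_product_vcnj[of p] by (simp_all add: d_def N_def scalar_product_commute)
      have 2: "scalar_product w p = s" "scalar_product p w = s" "scalar_product d (vcnj w) = cnj s"
        by (simp_all add: s_def d_def scalar_product_commute)
      have U: "U w = w - (2 * s / N) *s d" by (simp add: U_def s_def N_def)
      have vU: "vcnj (U w) = vcnj w - (2 * cnj s / N) *s p"
        by (simp add: U N d_def)
      have "scalar_product (U w) (vcnj (U w)) = scalar_product w (vcnj w)"
        unfolding vU unfolding U using N(1) by (simp add: scalar_product_simps 1 2 field_simps)
      then have "complex_of_real ((norm (U w))\<^sup>2) = of_real ((norm w)\<^sup>2)" by (simp only: scalar_product_vcnj)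
      then have "(norm (U w))\<^sup>2 = (norm w)\<^sup>2" by (simp only: of_real_eq_iff)
      then show ?thesis by simp
    qed
    moreover have "norm (scalar_product z (U w)) = norm z * norm (w $ i)" for w
    proof -
      have zb: "scalar_product z (vcnj b) = of_real (norm z * norm (z $ i))"
      proof -
        have "vcnj b = (of_real (norm z) * cnj c) *s axis i 1"
          by (simp add: b_def vcnj_axis)
        then have "scalar_product z (vcnj b) = of_real (norm z) * (z $ i * cnj c)"
          unfolding scalar_product_commute[of z] by (simp add: scalar_product_simps(5) scalar_product_axis)
        then show ?thesis by (simp add: c(2))
      qed
      have bz: "scalar_product b (vcnj z) = of_real (norm z * norm (z $ i))"
        using arg_cong[OF zb, of cnj] by (simp add: scalar_product_commute)
      have "scalar_product p (vcnj p) = of_real (2 * (norm z)\<^sup>2 - 2 * (norm z * norm (z $ i)))"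
        unfolding p_def using scalar_product_vcnj[of z] scalar_product_vcnj[of b]
        by (simp add: scalar_product_simps zb bz nb)
      \<comment> \<open>Because \<open>z\<close> and \<open>b\<close> have equal norm and a real
        hermitian product, \<open>z\<close> pairs with \<open>d\<close> to half of the squared norm
        of \<open>p\<close>. This is exactly what makes \<open>z\<close> after the reflection act as
        \<open>b\<close>.\<close>
      then have "complex_of_real ((norm p)\<^sup>2) = 2 * scalar_product z d"
        unfolding scalar_product_vcnj using scalar_product_vcnj[of z]
        by (simp add: d_def p_def scalar_product_simps zb)
      then have "scalar_product z (U w) = scalar_product z w - scalar_product p w"
        unfolding U_def using p0' by (simp add: scalar_product_simps)
      also have "\<dots> = scalar_product b w" by (simp add: p_def scalar_product_simps)
      finally show ?thesis by (simp add: sp norm_mult c)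
    qed
    ultimately show thesis by (rule that)
  qed
qed

lemma sphere_average_axis:
  fixes g :: "real \<Rightarrow> complex" and z :: "complex ^ 'n::finite" and i :: 'n
  assumes g: "continuous_on UNIV g"
  shows "(LINT w:sphere 0 1|sphere_borel. g ((norm (scalar_product z w))\<^sup>2)) =
    (LINT w:sphere (0 :: complex ^ 'n) 1|sphere_borel. g ((norm z)\<^sup>2 * (norm (w $ i))\<^sup>2))"
proof -
  obtain U :: "complex ^ 'n \<Rightarrow> complex ^ 'n" where U: "linear U" "\<And>w. norm (U w) = norm w"
    "\<And>w. norm (scalar_product z (U w)) = norm z * norm (w $ i)"
    using unitary_to_axis[of z i] by blast
  have "continuous_on (sphere 0 1) (\<lambda>w. g ((norm (scalar_product z w))\<^sup>2))"
    by (rule continuous_on_compose2[OF g]) (intro continuous_intros, simp)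
  from sphere_integral_isometry[OF U(1,2) this]
  show ?thesis by (simp add: U(3) power_mult_distrib)
qed

section \<open>Moments of a coordinate on the sphere\<close>

lemma coeff_quadratic_power:
  fixes A B C :: "'a::field_char_0"
  shows "coeff ([:A, B, C:] ^ k) 0 = A ^ k"
    and "coeff ([:A, B, C:] ^ Suc k) 1 = of_nat (Suc k) * A ^ k * B"
    and "coeff ([:A, B, C:] ^ Suc (Suc k)) 2 =
      of_nat (k + 2) * A ^ Suc k * C + of_nat (k + 2) * of_nat (k + 1) / 2 * A ^ k * B\<^sup>2"
proof -
  have m: "coeff ([:A, B, C:] * q) 0 = A * coeff q 0" "coeff ([:A, B, C:] * q) 1 = A * coeff q 1 + B * coeff q 0"
    "coeff ([:A, B, C:] * q) 2 = A * coeff q 2 + B * coeff q 1 + C * coeff q 0" for q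
    by (simp_all add: coeff_mult numeral_2_eq_2)
  show 0: "coeff ([:A, B, C:] ^ k) 0 = A ^ k" for k
    by (induction k) (simp_all only: power_Suc power_0 m, simp_all)
  show 1: "coeff ([:A, B, C:] ^ Suc k) 1 = of_nat (Suc k) * A ^ k * B" for k
  proof (induction k)
    case (Suc k)
    then show ?case by (subst power_Suc, subst m) (simp only: 0, simp add: algebra_simps)
  qed simp
  show "coeff ([:A, B, C:] ^ Suc (Suc k)) 2 =
      of_nat (k + 2) * A ^ Suc k * C + of_nat (k + 2) * of_nat (k + 1) / 2 * A ^ k * B\<^sup>2"
  proof (induction k)
    case 0
    have "coeff ([:A, B, C:] ^ Suc (Suc 0)) 2 = A * coeff [:A, B, C:] 2 + B * coeff [:A, B, C:] 1 + C * coeff [:A, B, C:] 0"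
      by (simp only: power_Suc power_0 mult_1_right m)
    then show ?case by (simp add: numeral_2_eq_2 algebra_simps)
  next
    case (Suc k)
    show ?case by (subst power_Suc, subst m, subst Suc, subst 1, subst 0)
        (simp add: power2_eq_square field_simps)
  qed
qed

text \<open>The hypothesis removes the middle coefficients: what remains involves \<open>A\<close>
  and \<open>C\<close> only. It will hold for twice the real and twice the imaginary part of a
  product \<open>w_i cnj w_j\<close>.\<close>

lemma coeff_quadratic_power_sum:
  fixes A B B' C :: real
  assumes "k \<ge> 1" "B\<^sup>2 + B'\<^sup>2 = 4 * A * C"
  shows "coeff ([:A, B, C:] ^ k) 2 + coeff ([:A, B', C:] ^ k) 2 = 2 * (real k)\<^sup>2 * (A ^ (k - 1) * C)"
proof (cases "k = 1")
  case True
  then show ?thesis by (simp add: numeral_2_eq_2)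
next
  case False
  then obtain j where k: "k = Suc (Suc j)" using assms(1) by (metis One_nat_def Suc_le_D less_one not_less_eq_eq old.nat.exhaust)
  have "coeff ([:A, B, C:] ^ k) 2 + coeff ([:A, B', C:] ^ k) 2 =
      2 * (real (j + 2) * A ^ Suc j * C) + real (j + 2) * real (j + 1) / 2 * A ^ j * (B\<^sup>2 + B'\<^sup>2)"
    unfolding k coeff_quadratic_power by (simp add: field_simps)
  also have "\<dots> = 2 * (real (j + 2))\<^sup>2 * (A ^ Suc j * C)"
    unfolding assms(2) by (simp add: power2_eq_square field_simps)
  finally show ?thesis by (simp add: k)
qed

lemma continuous_coeff_quadratic_power:
  fixes A B C :: "'a::topological_space \<Rightarrow> real"
  assumes "continuous_on S A" "continuous_on S B" "continuous_on S C"
  shows "continuous_on S (\<lambda>w. coeff ([:A w, B w, C w:] ^ k) m)"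
proof (induction k arbitrary: m)
  case 0
  show ?case by (cases "m = 0") (simp_all add: coeff_1)
next
  case (Suc k)
  have "continuous_on S (\<lambda>w. coeff [:A w, B w, C w:] i)" for i
    using assms by (cases i; cases "i - 1"; cases "i - 2") (auto simp: coeff_pCons split: nat.split)
  then show ?case unfolding power_Suc coeff_mult by (intro continuous_intros Suc)
qed

lemma poly_quadratic_power_sum:
  fixes A B C :: real
  shows "poly ([:A, B, C:] ^ k) t = (\<Sum>m\<le>2 * k. coeff ([:A, B, C:] ^ k) m * t ^ m)"
proof -
  have "degree ([:A, B, C:] ^ k) \<le> degree [:A, B, C:] * k" by (rule degree_power_le)
  also have "\<dots> \<le> 2 * k" by (intro mult_right_mono) (auto simp: degree_pCons_eq_if)
  finally have d: "degree ([:A, B, C:] ^ k) \<le> 2 * k" .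
  show ?thesis unfolding poly_altdef
    by (rule sum.mono_neutral_left) (use d le_degree in auto)
qed

lemma norm_sum_square:
  fixes x y :: complex
  shows "(norm (x + of_real t * y))\<^sup>2 = poly [:(norm x)\<^sup>2, 2 * Re (x * cnj y), (norm y)\<^sup>2:] t"
proof -
  have "(norm (x + of_real t * y))\<^sup>2 = (Re x + t * Re y)\<^sup>2 + (Im x + t * Im y)\<^sup>2" by (simp add: cmod_power2)
  also have "\<dots> = poly [:(norm x)\<^sup>2, 2 * Re (x * cnj y), (norm y)\<^sup>2:] t"
    unfolding cmod_power2 by (simp add: power2_eq_square algebra_simps)
  finally show ?thesis .
qed

definition sphere_moment :: "'n::finite \<Rightarrow> nat \<Rightarrow> complex" where
  "sphere_moment i k = (LINT w:sphere (0 :: complex ^ 'n) 1|sphere_borel. of_real (((norm (w $ i))\<^sup>2) ^ k))"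

lemma sphere_power_average:
  fixes z :: "complex ^ 'n::finite" and i :: 'n
  shows "(LINT w:sphere 0 1|sphere_borel. complex_of_real (((norm (scalar_product z w))\<^sup>2) ^ k)) =
    of_real (((norm z)\<^sup>2) ^ k) * sphere_moment i k"
proof -
  have "continuous_on UNIV (\<lambda>x::real. complex_of_real (x ^ k))" by (intro continuous_intros)
  from sphere_average_axis[OF this, of z i] show ?thesis
    unfolding sphere_moment_def by (simp only: power_mult_distrib of_real_mult set_integral_mult_right)
qed

text \<open>By unitary invariance the average of \<open>|w_i + t c w_j|^(2 k)\<close> is
  \<open>(1 + t^2)^k\<close> times the moment. Both sides are polynomials in \<open>t\<close>, and
  their coefficients of \<open>t^2\<close> are compared.\<close>

lemma sphere_moment_coeff:
  fixes i j :: "'n::finite" and c :: complex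
  assumes ij: "i \<noteq> j" and c: "norm c = 1"
  shows "(LINT w:sphere (0 :: complex ^ 'n) 1|sphere_borel. complex_of_real
      (coeff ([:(norm (w $ i))\<^sup>2, 2 * Re (w $ i * cnj (c * w $ j)), (norm (w $ j))\<^sup>2:] ^ k) 2)) = of_nat k * sphere_moment i k"
proof -
  interpret compact_parameter "sphere_borel" "sphere (0 :: complex ^ 'n) 1" by (rule compact_parameter_sphere)
  let ?S = "sphere (0 :: complex ^ 'n) 1"
  define p where "p w = [:(norm (w $ i))\<^sup>2, 2 * Re (w $ i * cnj (c * w $ j)), (norm (w $ j))\<^sup>2:] ^ k" for w :: "complex ^ 'n"
  define I where "I m = (LINT w:?S|sphere_borel. complex_of_real (coeff (p w) m))" for m
  have cc: "continuous_on ?S (\<lambda>w. coeff (p w) m)" for m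
    unfolding p_def by (intro continuous_coeff_quadratic_power continuous_intros)
  have e: "(\<Sum>m\<le>2 * k. I m * of_real t ^ m) = of_real ((1 + t\<^sup>2) ^ k) * sphere_moment i k" for t
  proof -
    \<comment> \<open>The vector whose pairing with \<open>w\<close> is
      \<open>w_i + t c w_j\<close>; its squared norm is \<open>1 + t^2\<close> as \<open>c\<close>
      is a phase and \<open>i\<close>, \<open>j\<close> are distinct.\<close>
    define z where "z = axis i 1 + (of_real t * c) *s (axis j 1 :: complex ^ 'n)"
    have sz: "scalar_product z w = w $ i + of_real t * (c * w $ j)" for w
      unfolding z_def scalar_product_simps
      by (simp add: scalar_product_def axis_def if_distrib[of "\<lambda>x. x * _"] cong: if_cong)
    have "(norm z)\<^sup>2 = 1 + t\<^sup>2"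
    proof -
      have "scalar_product z (vcnj z) = cnj (z $ i) + of_real t * (c * cnj (z $ j))"
        by (simp add: sz vcnj_def)
      also have "\<dots> = 1 + of_real t * of_real t * (c * cnj c)"
        using ij by (simp add: z_def axis_def mult_ac)
      also have "c * cnj c = 1" using c by (simp add: complex_norm_square[symmetric])
      finally have "complex_of_real ((norm z)\<^sup>2) = of_real (1 + t\<^sup>2)"
        unfolding scalar_product_vcnj by (simp add: power2_eq_square)
      then show ?thesis by (simp only: of_real_eq_iff)
    qed
    moreover have "((norm (scalar_product z w))\<^sup>2) ^ k = (\<Sum>m\<le>2 * k. coeff (p w) m * t ^ m)" for w
      unfolding sz norm_sum_square p_def poly_power[symmetric] norm_mult c mult_1
      by (rule poly_quadratic_power_sum[where B="2 * Re (w $ i * cnj (c * w $ j))"])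
    moreover have "(LINT w:?S|sphere_borel. complex_of_real (\<Sum>m\<le>2 * k. coeff (p w) m * t ^ m)) = (\<Sum>m\<le>2 * k. I m * of_real t ^ m)"
      unfolding set_lebesgue_integral_def of_real_sum scaleR_sum_right I_def sum_distrib_right
      by (subst Bochner_Integration.integral_sum)
        (auto intro!: set_integrable_continuous[unfolded set_integrable_def] continuous_intros cc
          simp flip: mult_scaleR_left)
    ultimately show ?thesis using sphere_power_average[of z k i] by simp
  qed
  define P where "P = (\<Sum>m\<le>2 * k. monom (I m) m)"
  define Q where "Q = smult (sphere_moment i k) ([:1, 0, 1:] ^ k)"
  have PQ: "poly P (of_real t) = poly Q (of_real t)" for t
    using e[of t] by (simp add: P_def Q_def poly_sum poly_monom mult_ac power2_eq_square)
  \<comment> \<open>Equality is known for real arguments only, but these are infinitely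
    many.\<close>
  have "P - Q = 0"
  proof (rule ccontr)
    assume "P - Q \<noteq> 0"
    then have "finite {x. poly (P - Q) x = 0}" by (rule poly_roots_finite)
    moreover have "range complex_of_real \<subseteq> {x. poly (P - Q) x = 0}" using PQ by auto
    ultimately have "finite (range complex_of_real)" by (rule finite_subset[rotated])
    then show False using infinite_UNIV_char_0 inj_of_real finite_imageD by blast
  qed
  then have "coeff P 2 = coeff Q 2" by simp
  moreover have "coeff P 2 = I 2"
  proof (cases "2 \<le> 2 * k")
    case False
    then have "k = 0" by simp
    then have "I 2 = 0" by (simp add: I_def p_def set_lebesgue_integral_def)
    then show ?thesis using False by (simp add: P_def coeff_sum)
  qed (simp add: P_def coeff_sum)
  moreover have "coeff Q 2 = of_nat k * sphere_moment i k"
  proof (cases k)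
    case (Suc l)
    show ?thesis
    proof (cases l)
      case (Suc l')
      then show ?thesis using \<open>k = Suc l\<close> coeff_quadratic_power(3)[of "1::complex" 0 1 l']
        by (simp only: Q_def coeff_smult) simp
    qed (simp add: Q_def Suc numeral_2_eq_2)
  qed (simp add: Q_def numeral_2_eq_2)
  ultimately show ?thesis by (simp add: I_def p_def)
qed

text \<open>The phases \<open>c = 1\<close> and \<open>c = \<i>\<close> produce the real and the
  imaginary part of \<open>w_i cnj w_j\<close>. Adding the two instances of
  \<open>sphere_moment_coeff\<close> leaves a mixed moment of absolute values.\<close>

lemma sphere_moment_mixed:
  fixes i j :: "'n::finite"
  assumes ij: "i \<noteq> j" and k: "k \<ge> 1"
  shows "of_nat k * (LINT w:sphere (0 :: complex ^ 'n) 1|sphere_borel.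
    complex_of_real (((norm (w $ i))\<^sup>2) ^ (k - 1) * (norm (w $ j))\<^sup>2)) = sphere_moment i k"
proof -
  interpret compact_parameter "sphere_borel" "sphere (0 :: complex ^ 'n) 1" by (rule compact_parameter_sphere)
  let ?S = "sphere (0 :: complex ^ 'n) 1"
  let ?q = "\<lambda>c (w :: complex ^ 'n). coeff ([:(norm (w $ i))\<^sup>2, 2 * Re (w $ i * cnj (c * w $ j)), (norm (w $ j))\<^sup>2:] ^ k) 2"
  have c: "continuous_on ?S (\<lambda>w. complex_of_real (?q c w))" for c
    by (intro continuous_intros continuous_coeff_quadratic_power)
  have "?q 1 w + ?q \<i> w = 2 * (real k)\<^sup>2 * (((norm (w $ i))\<^sup>2) ^ (k - 1) * (norm (w $ j))\<^sup>2)" for w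
    unfolding cmod_power2 by (rule coeff_quadratic_power_sum[OF k]) (simp add: power2_eq_square algebra_simps)
  then have "complex_of_real (?q 1 w) + of_real (?q \<i> w) = (2 * (of_nat k)\<^sup>2) * of_real (((norm (w $ i))\<^sup>2) ^ (k - 1) * (norm (w $ j))\<^sup>2)" for w
    by (subst of_real_add[symmetric]) (simp only: of_real_mult of_real_power of_real_numeral of_real_of_nat_eq)
  then have "(2 * (of_nat k)\<^sup>2) * (LINT w:?S|sphere_borel. complex_of_real (((norm (w $ i))\<^sup>2) ^ (k - 1) * (norm (w $ j))\<^sup>2)) =
    (LINT w:?S|sphere_borel. complex_of_real (?q 1 w) + of_real (?q \<i> w))"
    by (simp only: set_integral_mult_right)
  also have "\<dots> = (LINT w:?S|sphere_borel. complex_of_real (?q 1 w)) + (LINT w:?S|sphere_borel. complex_of_real (?q \<i> w))"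
    by (intro set_integral_add set_integrable_continuous c)
  also have "\<dots> = of_nat k * sphere_moment i k + of_nat k * sphere_moment i k"
    by (intro arg_cong2[where f="(+)"] sphere_moment_coeff[OF ij]) simp_all
  also have "\<dots> = 2 * of_nat k * sphere_moment i k" by simp
  finally show ?thesis using k by (simp add: power2_eq_square)
qed

text \<open>On the sphere the squared absolute values of the coordinates add up to 1. Multiplied by
  the \<open>k\<close>-th power for coordinate \<open>i\<close> and integrated, this relates two
  consecutive moments, since each of the \<open>n - 1\<close> mixed terms is a multiple of the next
  moment.\<close>

lemma sphere_moment_Suc:
  fixes i :: "'n::finite"
  shows "of_nat (Suc k) * sphere_moment i k = of_nat (k + CARD('n)) * sphere_moment i (Suc k)"
proof -
  interpret compact_parameter "sphere_borel" "sphere (0 :: complex ^ 'n) 1" by (rule compact_parameter_sphere)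
  let ?S = "sphere (0 :: complex ^ 'n) 1"
  have "(\<Sum>j\<in>UNIV - {i}. (norm (w $ j))\<^sup>2) = 1 - (norm (w $ i))\<^sup>2" if "w \<in> ?S" for w
  proof -
    have "(\<Sum>j\<in>UNIV. (norm (w $ j))\<^sup>2) = (norm w)\<^sup>2" by (simp add: norm_vec_def L2_set_def sum_nonneg)
    then show ?thesis using that by (simp add: sum.remove[of UNIV i])
  qed
  then have "((norm (w $ i))\<^sup>2) ^ k - ((norm (w $ i))\<^sup>2) ^ Suc k = (\<Sum>j\<in>UNIV - {i}. ((norm (w $ i))\<^sup>2) ^ k * (norm (w $ j))\<^sup>2)" if "w \<in> ?S" for w
  proof -
    have "((norm (w $ i))\<^sup>2) ^ k - ((norm (w $ i))\<^sup>2) ^ Suc k = ((norm (w $ i))\<^sup>2) ^ k * (1 - (norm (w $ i))\<^sup>2)"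
      by (simp add: algebra_simps)
    then show ?thesis using \<open>\<And>w. w \<in> ?S \<Longrightarrow> (\<Sum>j\<in>UNIV - {i}. (norm (w $ j))\<^sup>2) = 1 - (norm (w $ i))\<^sup>2\<close>[OF that, symmetric]
      by (simp only: sum_distrib_left)
  qed
  then have "(LINT w:?S|sphere_borel. of_real (((norm (w $ i))\<^sup>2) ^ k) - complex_of_real (((norm (w $ i))\<^sup>2) ^ Suc k)) =
    (LINT w:?S|sphere_borel. (\<Sum>j\<in>UNIV - {i}. complex_of_real (((norm (w $ i))\<^sup>2) ^ k * (norm (w $ j))\<^sup>2)))"
    by (intro set_lebesgue_integral_cong Y_sets allI impI, subst of_real_diff[symmetric], subst of_real_sum[symmetric])
      (simp only:)
  also have "\<dots> = (\<Sum>j\<in>UNIV - {i}. (LINT w:?S|sphere_borel. complex_of_real (((norm (w $ i))\<^sup>2) ^ k * (norm (w $ j))\<^sup>2)))"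
    unfolding set_lebesgue_integral_def scaleR_sum_right
    by (subst Bochner_Integration.integral_sum)
      (auto intro!: set_integrable_continuous[unfolded set_integrable_def] continuous_intros)
  finally have "sphere_moment i k - sphere_moment i (Suc k) =
    (\<Sum>j\<in>UNIV - {i}. (LINT w:?S|sphere_borel. complex_of_real (((norm (w $ i))\<^sup>2) ^ k * (norm (w $ j))\<^sup>2)))"
    unfolding sphere_moment_def
    by (subst (asm) set_integral_diff) (auto intro!: set_integrable_continuous continuous_intros)
  then have "of_nat (Suc k) * (sphere_moment i k - sphere_moment i (Suc k)) =
      (\<Sum>j\<in>UNIV - {i}. of_nat (Suc k) * (LINT w:?S|sphere_borel. complex_of_real (((norm (w $ i))\<^sup>2) ^ (Suc k - 1) * (norm (w $ j))\<^sup>2)))"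
    by (simp add: sum_distrib_left)
  also have "\<dots> = (\<Sum>j\<in>UNIV - {i}. sphere_moment i (Suc k))"
    by (intro sum.cong sphere_moment_mixed) auto
  also have "\<dots> = of_nat (CARD('n) - 1) * sphere_moment i (Suc k)" by simp
  also have "of_nat (CARD('n) - 1) = (of_nat (CARD('n)) - 1 :: complex)" by (simp add: of_nat_diff Suc_le_eq)
  finally show ?thesis by (simp add: algebra_simps)
qed

text \<open>The \<open>k\<close>-th moment is a constant times \<open>k! / (k + n - 1)!\<close>,
  which is the coefficient produced by integrating \<open>x^k\<close> from 0 exactly
  \<open>n - 1\<close> times. This match is why an \<open>(n-1)\<close>-st derivative inverts the
  average.\<close>

lemma sphere_moment_closed_form:
  fixes i :: "'n::finite"
  shows "sphere_moment i k * fact (k + (CARD('n) - 1)) = sphere_moment i 0 * fact k * fact (CARD('n) - 1)"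
proof (induction k)
  case (Suc k)
  have c: "Suc k + (CARD('n) - 1) = Suc (k + (CARD('n) - 1))" "Suc (k + (CARD('n) - 1)) = k + CARD('n)"
    by (simp_all add: Suc_le_eq)
  have "sphere_moment i (Suc k) * fact (Suc k + (CARD('n) - 1)) =
      of_nat (k + CARD('n)) * sphere_moment i (Suc k) * fact (k + (CARD('n) - 1))"
    unfolding c(1) fact_Suc by (simp only: c(2) mult_ac)
  also have "\<dots> = of_nat (Suc k) * (sphere_moment i k * fact (k + (CARD('n) - 1)))"
    unfolding sphere_moment_Suc[symmetric] by simp
  also have "\<dots> = sphere_moment i 0 * fact (Suc k) * fact (CARD('n) - 1)"
    unfolding Suc by (simp add: algebra_simps)
  finally show ?case .
qed simp

text \<open>This is the total mass of the sphere, a positive multiple of the volume of the punctured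
  unit ball.\<close>

lemma sphere_moment_0: "sphere_moment (i :: 'n::finite) 0 \<noteq> 0"
proof -
  interpret compact_parameter "sphere_borel" "sphere (0 :: complex ^ 'n) 1" by (rule compact_parameter_sphere)
  have "{x \<in> ball (0 :: complex ^ 'n) 1 - {0}. x /\<^sub>R norm x \<in> sphere 0 1} = ball 0 1 - {0}" by auto
  then have "emeasure sphere_borel (sphere (0 :: complex ^ 'n) 1) =
      of_nat DIM(complex ^ 'n) * emeasure lborel (ball (0 :: complex ^ 'n) 1 - {0})"
    using emeasure_sphere_borel[of "sphere (0 :: complex ^ 'n) 1"] by auto
  also have "emeasure lborel (ball (0 :: complex ^ 'n) 1 - {0}) = emeasure lborel (ball (0 :: complex ^ 'n) 1)"
    by (intro emeasure_Diff_null_set) auto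
  also have "of_nat DIM(complex ^ 'n) * emeasure lborel (ball (0 :: complex ^ 'n) 1) \<noteq> 0"
    using order.strict_implies_not_eq[OF unit_ball_vol_pos[of "real DIM(complex ^ 'n)"]]
    by (auto simp: emeasure_ball)
  finally have "measure sphere_borel (sphere (0 :: complex ^ 'n) 1) \<noteq> 0"
    using finite_nu_Y by (simp add: measure_def enn2real_eq_0_iff)
  moreover have "(LINT w|sphere_borel. indicator (sphere (0 :: complex ^ 'n) 1) w *\<^sub>R (1::complex)) =
      measure sphere_borel (sphere (0 :: complex ^ 'n) 1) *\<^sub>R 1"
    using has_bochner_integral_integral_eq[OF has_bochner_integral_indicator[OF Y_sets finite_nu_Y]] .
  ultimately show ?thesis
    by (simp add: sphere_moment_def set_lebesgue_integral_def)
qed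

section \<open>From powers to smooth radial profiles\<close>

lemma iterated_antiderivative_bound:
  fixes R :: "nat \<Rightarrow> real \<Rightarrow> complex"
  assumes d: "\<And>l x. l < m \<Longrightarrow> (R l has_vector_derivative R (Suc l) x) (at x)"
    and z: "\<And>l. l < m \<Longrightarrow> R l 0 = 0"
    and b: "\<And>x. x \<in> {0..r} \<Longrightarrow> norm (R m x) \<le> e"
    and x: "x \<in> {0..r}"
  shows "norm (R 0 x) \<le> e * x ^ m"
  using d z b x
proof (induction m arbitrary: R x)
  case (Suc m)
  have "norm (R (Suc 0) y) \<le> e * y ^ m" if "y \<in> {0..r}" for y
    by (rule Suc.IH[of "\<lambda>l. R (Suc l)"]) (use Suc.prems that in auto)
  moreover have "0 \<le> e" using Suc.prems(3)[OF Suc.prems(4)] norm_ge_zero order_trans by blast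
  ultimately have B: "norm (R (Suc 0) y) \<le> e * x ^ m" if "y \<in> {0..x}" for y
    using that Suc.prems(4) by (meson atLeastAtMost_iff mult_left_mono order_trans power_mono)
  have "norm (R 0 x - R 0 0) \<le> (e * x ^ m) * norm (x - 0)"
  proof (rule differentiable_bound[of "{0..x}" "R 0" "\<lambda>y h. h *\<^sub>R R (Suc 0) y"])
    show "(R 0 has_derivative (\<lambda>h. h *\<^sub>R R (Suc 0) y)) (at y within {0..x})" for y
      using Suc.prems(1)[of 0 y] by (auto simp: has_vector_derivative_def intro: has_derivative_at_withinI)
    show "onorm (\<lambda>h. h *\<^sub>R R (Suc 0) y) \<le> e * x ^ m" if "y \<in> {0..x}" for y
      using B[OF that] by (intro onorm_le) (simp add: mult.commute mult_left_mono)
  qed (use Suc.prems(4) in auto)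
  then show ?case using Suc.prems(2)[of 0] Suc.prems(4) by (simp add: mult_ac)
qed auto

lemma complex_polynomial_approx:
  fixes g :: "real \<Rightarrow> complex"
  assumes "continuous_on {0..r} g" "e > 0"
  obtains c :: "nat \<Rightarrow> complex" and N where
    "\<And>x. x \<in> {0..r} \<Longrightarrow> norm (g x - (\<Sum>k\<le>N. c k * of_real (x ^ k))) \<le> e"
proof -
  have "continuous_on {0..r} (\<lambda>x. Re (g x))" "continuous_on {0..r} (\<lambda>x. Im (g x))"
    using assms(1) by (auto intro: continuous_intros)
  then obtain p q where p: "real_polynomial_function p" "\<And>x. x \<in> {0..r} \<Longrightarrow> \<bar>Re (g x) - p x\<bar> < e / 2"
    and q: "real_polynomial_function q" "\<And>x. x \<in> {0..r} \<Longrightarrow> \<bar>Im (g x) - q x\<bar> < e / 2"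
    using Stone_Weierstrass_real_polynomial_function[of "{0..r}" _ "e / 2"] \<open>e > 0\<close>
    by (metis compact_Icc half_gt_zero)
  obtain a n where a: "p = (\<lambda>x. \<Sum>i\<le>n. a i * x ^ i)" using p(1) real_polynomial_function_iff_sum by blast
  obtain b m where b: "q = (\<lambda>x. \<Sum>i\<le>m. b i * x ^ i)" using q(1) real_polynomial_function_iff_sum by blast
  define c where "c i = of_real (if i \<le> n then a i else 0) + \<i> * of_real (if i \<le> m then b i else 0)" for i
  have e: "(\<Sum>k\<le>max n m. c k * of_real (x ^ k)) = of_real (p x) + \<i> * of_real (q x)" for x
  proof -
    have "(\<Sum>k\<le>max n m. (if k \<le> n then a k else 0) * x ^ k) = p x"
      unfolding a by (rule sum.mono_neutral_cong_right) auto
    moreover have "(\<Sum>k\<le>max n m. (if k \<le> m then b k else 0) * x ^ k) = q x"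
      unfolding b by (rule sum.mono_neutral_cong_right) auto
    moreover have "(\<Sum>k\<le>max n m. c k * of_real (x ^ k)) =
      of_real (\<Sum>k\<le>max n m. (if k \<le> n then a k else 0) * x ^ k) +
      \<i> * of_real (\<Sum>k\<le>max n m. (if k \<le> m then b k else 0) * x ^ k)"
      unfolding c_def of_real_sum sum_distrib_left sum.distrib[symmetric]
      by (intro sum.cong) (simp_all add: algebra_simps)
    ultimately show ?thesis by simp
  qed
  have "norm (g x - (\<Sum>k\<le>max n m. c k * of_real (x ^ k))) \<le> e" if "x \<in> {0..r}" for x
  proof -
    have "norm (g x - (of_real (p x) + \<i> * of_real (q x))) \<le> \<bar>Re (g x) - p x\<bar> + \<bar>Im (g x) - q x\<bar>"
      using cmod_le[of "g x - (of_real (p x) + \<i> * of_real (q x))"] by simp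
    then show ?thesis using p(2)[OF that] q(2)[OF that] unfolding e by linarith
  qed
  then show thesis using that by blast
qed

lemma smooth_iterate: "smooth f \<Longrightarrow> smooth ((dir_deriv (1::real) ^^ l) f)"
  by (induction l) (auto intro: smooth_dir_deriv)

lemma smooth_real_has_vector_derivative:
  fixes f :: "real \<Rightarrow> complex"
  assumes "smooth f"
  shows "(f has_vector_derivative dir_deriv 1 f x) (at x)"
proof -
  note d = smooth_differentiable[OF assms]
  have "(\<lambda>h. dir_deriv h f x) = (\<lambda>h. h *\<^sub>R dir_deriv 1 f x)"
  proof
    show "dir_deriv h f x = h *\<^sub>R dir_deriv 1 f x" for h
      using dir_deriv_expand[OF d, of h x] by (simp add: scaleR_conv_of_real)
  qed
  then show ?thesis using has_derivative_dir_deriv[OF d, of x] unfolding has_vector_derivative_def by (simp only:)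
qed

text \<open>By the moment formula the identity holds for powers; since F and its polynomial approximation
  are recovered from their (n-1)-st derivatives, it extends to smooth F by the Weierstrass theorem.\<close>

lemma sphere_radial_average:
  fixes F :: "real \<Rightarrow> complex" and z :: "complex ^ 'n::finite" and i :: 'n
  assumes F: "smooth F" "\<And>x. x < A \<Longrightarrow> F x = 0" and A: "A > 0"
  defines "m \<equiv> CARD('n) - 1" and "\<rho> \<equiv> (norm z)\<^sup>2"
  shows "of_real (\<rho> ^ m) * (LINT w:sphere 0 1|sphere_borel. (dir_deriv 1 ^^ m) F ((norm (scalar_product z w))\<^sup>2))
    = sphere_moment i 0 * fact m * F \<rho>"
proof -
  interpret compact_parameter "sphere_borel" "sphere (0 :: complex ^ 'n) 1" by (rule compact_parameter_sphere)
  let ?S = "sphere (0 :: complex ^ 'n) 1"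
  define D where "D l = (dir_deriv 1 ^^ l) F" for l
  have sD: "smooth (D l)" for l unfolding D_def by (rule smooth_iterate[OF F(1)])
  have vD: "(D l has_vector_derivative D (Suc l) x) (at x)" for l x
    using smooth_real_has_vector_derivative[OF sD] by (simp add: D_def)
  have "D l x = 0" if "x < A" for l x
    using that
  proof (induction l arbitrary: x)
    case (Suc l)
    then show ?case using dir_deriv_eq_0_open[of "{..<A}" "D l" x 1] by (simp add: D_def)
  qed (simp add: D_def F)
  \<comment> \<open>Since \<open>F\<close> vanishes below \<open>A > 0\<close>, all derivatives
    vanish at 0: no constants of integration arise when \<open>F\<close> is recovered from its
    \<open>m\<close>-th derivative.\<close>
  then have D0: "D l 0 = 0" for l using A by simp
  have r0: "\<rho> \<ge> 0" by (simp add: \<rho>_def)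
  \<comment> \<open>Collects two errors: that of approximating the integrand on the sphere, and that
    of \<open>m\<close> integrations of the same approximation on
    \<open>{0..\<rho>}\<close>.\<close>
  define C where "C = \<rho> ^ m * measure sphere_borel ?S + norm (sphere_moment i 0) * fact m * \<rho> ^ m"
  let ?L = "of_real (\<rho> ^ m) * (LINT w:?S|sphere_borel. D m ((norm (scalar_product z w))\<^sup>2))"
  let ?R = "sphere_moment i 0 * fact m * F \<rho>"
  have est: "norm (?L - ?R) \<le> e * C" if e: "e > 0" for e
  proof -
    obtain c N where cN: "\<And>x. x \<in> {0..\<rho>} \<Longrightarrow> norm (D m x - (\<Sum>k\<le>N. c k * of_real (x ^ k))) \<le> e"
      using complex_polynomial_approx[OF smooth_continuous[OF sD] e] by blast
    \<comment> \<open>\<open>E 0\<close> is the \<open>m\<close>-fold primitive, from 0, of the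
      approximating polynomial, and \<open>E l\<close> is its \<open>l\<close>-th derivative for
      \<open>l \<le> m\<close>.\<close>
    define E where "E l x = (\<Sum>k\<le>N. c k * (fact k / fact (k + m - l)) * of_real (x ^ (k + m - l)))" for l x
    have vE: "(E l has_vector_derivative E (Suc l) x) (at x)" if "l < m" for l x
      unfolding E_def
    proof (rule has_vector_derivative_sum)
      fix k
      define j where "j = k + m - Suc l"
      have j: "k + m - l = Suc j" "k + m - Suc l = j" using that by (auto simp: j_def)
      have "((\<lambda>x. x ^ Suc j) has_real_derivative real (Suc j) * x ^ j) (at x)"
        using DERIV_pow[of "Suc j" x UNIV] by simp
      then have "((\<lambda>x. complex_of_real (x ^ Suc j)) has_vector_derivative of_real (real (Suc j) * x ^ j)) (at x)"
        by (intro has_vector_derivative_of_real) (simp add: has_real_derivative_iff_has_vector_derivative)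
      then have "((\<lambda>x. c k * (fact k / fact (Suc j)) * complex_of_real (x ^ Suc j)) has_vector_derivative
          c k * (fact k / fact (Suc j)) * of_real (real (Suc j) * x ^ j)) (at x)"
        by (rule has_vector_derivative_mult_right)
      moreover have "c k * (fact k / fact (Suc j)) * of_real (real (Suc j) * x ^ j) = c k * (fact k / fact j) * of_real (x ^ j)"
      proof -
        have "(of_nat (Suc j) :: complex) \<noteq> 0" by (rule of_nat_neq_0)
        then have "fact k / fact (Suc j) * of_nat (Suc j) = (fact k / fact j :: complex)"
          unfolding fact_Suc by (simp del: of_nat_Suc)
        then have "c k * (fact k / fact (Suc j) * of_nat (Suc j)) * of_real (x ^ j) = c k * (fact k / fact j) * of_real (x ^ j)"
          by (simp only:)
        then show ?thesis by (simp only: of_real_mult of_real_of_nat_eq mult.assoc)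
      qed
      ultimately show "((\<lambda>x. c k * (fact k / fact (k + m - l)) * complex_of_real (x ^ (k + m - l))) has_vector_derivative
          c k * (fact k / fact (k + m - Suc l)) * of_real (x ^ (k + m - Suc l))) (at x)"
        unfolding j by simp
    qed
    have E0: "E l 0 = 0" if "l < m" for l
      unfolding E_def using that by (intro sum.neutral) (auto simp: power_0_left)
    have Em: "E m x = (\<Sum>k\<le>N. c k * of_real (x ^ k))" for x unfolding E_def by simp
    define R where "R l x = D l x - E l x" for l x
    have "norm (R 0 \<rho>) \<le> e * \<rho> ^ m"
    proof (rule iterated_antiderivative_bound[of m R \<rho> e])
      show "(R l has_vector_derivative R (Suc l) x) (at x)" if "l < m" for l x
        unfolding R_def by (intro has_vector_derivative_diff vD vE that)
    qed (use cN r0 D0 E0 in \<open>auto simp: R_def Em\<close>)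
    then have FE: "norm (F \<rho> - E 0 \<rho>) \<le> e * \<rho> ^ m" by (simp add: R_def D_def)
    have c1: "continuous_on ?S (\<lambda>w. D m ((norm (scalar_product z w))\<^sup>2))"
      by (rule continuous_on_compose2[OF smooth_continuous[OF sD, of UNIV]]) (intro continuous_intros, simp)
    have c2: "continuous_on ?S (\<lambda>w. \<Sum>k\<le>N. c k * complex_of_real (((norm (scalar_product z w))\<^sup>2) ^ k))"
      by (intro continuous_intros)
    have "norm (LINT w:?S|sphere_borel. D m ((norm (scalar_product z w))\<^sup>2) - (\<Sum>k\<le>N. c k * complex_of_real (((norm (scalar_product z w))\<^sup>2) ^ k)))
      \<le> e * measure sphere_borel ?S"
    proof (rule norm_set_integral_le)
      fix w assume "w \<in> ?S"
      then have "norm (scalar_product z w) \<le> norm z" using norm_scalar_product_le[of z w] by simp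
      then have "(norm (scalar_product z w))\<^sup>2 \<in> {0..\<rho>}" by (auto simp: \<rho>_def intro: power_mono)
      then show "norm (D m ((norm (scalar_product z w))\<^sup>2) - (\<Sum>k\<le>N. c k * complex_of_real (((norm (scalar_product z w))\<^sup>2) ^ k))) \<le> e"
        by (rule cN)
    qed (intro continuous_on_diff c1 c2)
    moreover have P: "of_real (\<rho> ^ m) * (LINT w:?S|sphere_borel. (\<Sum>k\<le>N. c k * complex_of_real (((norm (scalar_product z w))\<^sup>2) ^ k)))
      = sphere_moment i 0 * fact m * E 0 \<rho>"
    proof -
      have "(LINT w:?S|sphere_borel. (\<Sum>k\<le>N. c k * complex_of_real (((norm (scalar_product z w))\<^sup>2) ^ k))) =
        (\<Sum>k\<le>N. LINT w:?S|sphere_borel. c k * complex_of_real (((norm (scalar_product z w))\<^sup>2) ^ k))"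
        unfolding set_lebesgue_integral_def scaleR_sum_right
        by (subst Bochner_Integration.integral_sum)
          (auto intro!: set_integrable_continuous[unfolded set_integrable_def] continuous_intros)
      also have "\<dots> = (\<Sum>k\<le>N. c k * (of_real (\<rho> ^ k) * sphere_moment i k))"
        by (simp only: set_integral_mult_right sphere_power_average[of z _ i] \<rho>_def)
      finally have "of_real (\<rho> ^ m) * (LINT w:?S|sphere_borel. (\<Sum>k\<le>N. c k * complex_of_real (((norm (scalar_product z w))\<^sup>2) ^ k)))
        = (\<Sum>k\<le>N. of_real (\<rho> ^ m) * (c k * (of_real (\<rho> ^ k) * sphere_moment i k)))"
        by (simp add: sum_distrib_left)
      also have "\<dots> = (\<Sum>k\<le>N. sphere_moment i 0 * fact m * (c k * (fact k / fact (k + m - 0)) * of_real (\<rho> ^ (k + m - 0))))"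
      proof (rule sum.cong[OF refl])
        fix k
        have "sphere_moment i k = sphere_moment i 0 * fact k * fact m / fact (k + m)"
          using sphere_moment_closed_form[of i k] unfolding m_def by (simp add: field_simps)
        then show "of_real (\<rho> ^ m) * (c k * (of_real (\<rho> ^ k) * sphere_moment i k)) =
          sphere_moment i 0 * fact m * (c k * (fact k / fact (k + m - 0)) * of_real (\<rho> ^ (k + m - 0)))"
          by (simp add: power_add)
      qed
      finally show ?thesis by (simp add: E_def sum_distrib_left)
    qed
    ultimately have "norm ((LINT w:?S|sphere_borel. D m ((norm (scalar_product z w))\<^sup>2)) -
        (LINT w:?S|sphere_borel. (\<Sum>k\<le>N. c k * complex_of_real (((norm (scalar_product z w))\<^sup>2) ^ k)))) \<le> e * measure sphere_borel ?S"
      by (simp only: set_integral_diff(2)[OF set_integrable_continuous[OF c1] set_integrable_continuous[OF c2]])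
    then have 1: "norm (?L - sphere_moment i 0 * fact m * E 0 \<rho>) \<le> \<rho> ^ m * (e * measure sphere_borel ?S)"
      unfolding P[symmetric] right_diff_distrib[symmetric] norm_mult using r0
      by (intro mult_mono) (auto simp: norm_power)
    have "norm (sphere_moment i 0 * fact m * E 0 \<rho> - ?R) = norm (sphere_moment i 0) * fact m * norm (F \<rho> - E 0 \<rho>)"
      unfolding right_diff_distrib[symmetric] norm_mult by (simp add: norm_minus_commute)
    also have "\<dots> \<le> norm (sphere_moment i 0) * fact m * (e * \<rho> ^ m)"
      by (intro mult_left_mono FE) auto
    finally have "norm (?L - ?R) \<le> \<rho> ^ m * (e * measure sphere_borel ?S) + norm (sphere_moment i 0) * fact m * (e * \<rho> ^ m)"
      using 1 norm_triangle_ineq[of "?L - sphere_moment i 0 * fact m * E 0 \<rho>" "sphere_moment i 0 * fact m * E 0 \<rho> - ?R"] by simp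
    then show ?thesis by (simp add: C_def algebra_simps)
  qed
  have "norm (?L - ?R) \<le> 0"
  proof (rule field_le_epsilon)
    fix e :: real assume "e > 0"
    have C: "C \<ge> 0" using r0 by (simp add: C_def)
    have "norm (?L - ?R) \<le> (e / (C + 1)) * C" using C \<open>e > 0\<close> by (intro est) simp
    also have "\<dots> = e * (C / (C + 1))" by simp
    also have "\<dots> \<le> e * 1" using C \<open>e > 0\<close> by (intro mult_left_mono) auto
    finally show "norm (?L - ?R) \<le> 0 + e" by simp
  qed
  then show ?thesis by (simp add: D_def)
qed

subsection \<open>Polynomials and density\<close>

lemma compact_parameter_lborel:
  assumes "compact Y"
  shows "compact_parameter (lborel :: 'a::euclidean_space measure) Y"
  by (intro compact_parameter.intro lborel.sigma_finite_measure_axioms compact_parameter_axioms.intro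
      sets_lborel assms emeasure_bounded_finite compact_imp_bounded)

lemma emeasure_lborel_open_nonzero:
  fixes U :: "'a::euclidean_space set"
  assumes "open U" "x \<in> U"
  shows "emeasure lborel U \<noteq> 0"
proof -
  obtain e where e: "e > 0" "ball x e \<subseteq> U" using assms by (meson open_contains_ball)
  have "emeasure lborel (ball x e) \<noteq> 0"
    using e(1) order.strict_implies_not_eq[OF unit_ball_vol_pos[of "real DIM('a)"]]
    by (auto simp: emeasure_ball)
  moreover have "emeasure lborel (ball x e) \<le> emeasure lborel U"
    using assms(1) e(2) by (intro emeasure_mono) auto
  ultimately show ?thesis by auto
qed

text \<open>The last hypothesis says that \<open>y0\<close> lies in the support of the measure on
  \<open>Y\<close>; a continuous nonnegative function that is zero almost everywhere vanishes
  there.\<close>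

lemma (in compact_parameter) nonneg_integral_zero:
  assumes F: "continuous_on Y F" "\<And>y. y \<in> Y \<Longrightarrow> 0 \<le> F y"
    and I: "(LINT y:Y|\<nu>. complex_of_real (F y)) = 0"
    and y0: "y0 \<in> Y" "\<And>U. open U \<Longrightarrow> y0 \<in> U \<Longrightarrow> emeasure \<nu> (U \<inter> Y) \<noteq> 0"
  shows "F y0 = 0"
proof (rule ccontr)
  assume "F y0 \<noteq> 0"
  have "continuous_on Y (\<lambda>y. complex_of_real (F y))" by (intro continuous_intros F)
  note i = set_integrable_continuous[OF this, unfolded set_integrable_def]
  have e: "indicator Y y *\<^sub>R complex_of_real (F y) = complex_of_real (indicator Y y * F y)" for y
    by (simp add: indicator_def)
  have i': "integrable \<nu> (\<lambda>y. indicator Y y * F y)" using i unfolding e complex_of_real_integrable_eq .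
  have "(LINT y|\<nu>. indicator Y y * F y) = 0"
    using I unfolding set_lebesgue_integral_def e integral_complex_of_real by simp
  then have AE: "AE y in \<nu>. indicator Y y * F y = 0"
    using integral_nonneg_eq_0_iff_AE[OF i'] F(2) by (auto simp: indicator_def)
  have "open (- {0::real})" by auto
  then obtain U where U: "open U" "U \<inter> Y = F -` (- {0}) \<inter> Y"
    using F(1) unfolding continuous_on_open_invariant by blast
  have "y0 \<in> U" using U(2) y0(1) \<open>F y0 \<noteq> 0\<close> by auto
  have "AE y in \<nu>. y \<notin> U \<inter> Y"
    using AE by eventually_elim (use U(2) in \<open>auto simp: indicator_def\<close>)
  moreover have "U \<inter> Y \<in> sets \<nu>" using U(1) Y_sets by (auto simp: sets_nu)
  ultimately have "emeasure \<nu> (U \<inter> Y) = 0" by (simp add: AE_iff_null_sets null_setsD1)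
  then show False using y0(2)[OF U(1) \<open>y0 \<in> U\<close>] by simp
qed

lemma continuous_zero_limit:
  fixes \<phi> :: "real \<Rightarrow> complex"
  assumes "continuous_on {0..1} \<phi>" "\<And>t. 0 < t \<Longrightarrow> t \<le> 1 \<Longrightarrow> \<phi> t = 0"
  shows "\<phi> 0 = 0"
proof -
  have "(\<phi> \<longlongrightarrow> \<phi> 0) (at 0 within {0..1})" using assms(1) unfolding continuous_on by (rule bspec) simp
  then have "(\<phi> \<longlongrightarrow> \<phi> 0) (at_right 0)" by (simp add: at_within_Icc_at_right)
  moreover have "\<forall>\<^sub>F t in at_right 0. \<phi> t = 0"
    using eventually_at_right_real[OF zero_less_one] by eventually_elim (use assms(2) in auto)
  then have "(\<phi> \<longlongrightarrow> 0) (at_right 0)" by (rule tendsto_eventually)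
  ultimately show ?thesis using tendsto_unique trivial_limit_at_right_real by blast
qed

section \<open>Differentiation under the distribution\<close>

context rapidly_decreasing_distribution
begin

lemma ext_cmult: "tempered f \<Longrightarrow> ext T (\<lambda>x. c * f x) = c * ext T f"
  using ext_linear[of f f c 0] by simp

lemma ext_add: "tempered f \<Longrightarrow> tempered g \<Longrightarrow> ext T (\<lambda>x. f x + g x) = ext T f + ext T g"
  using ext_linear[of f g 1 1] by simp

lemma ext_diff: "tempered f \<Longrightarrow> tempered g \<Longrightarrow> ext T (\<lambda>x. f x - g x) = ext T f - ext T g"
  using ext_linear[of f g 1 "-1"] by simp

text \<open>The fundamental theorem is applied pointwise in \<open>z\<close> and the integral is
  then pulled out of \<open>T\<close>. Thus uniformity in \<open>t\<close> is asked of the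
  derivative \<open>k\<close> alone, while \<open>f t\<close> need only be tempered for each
  \<open>t\<close>.\<close>

lemma ext_ftc:
  fixes f k :: "real \<Rightarrow> complex ^ 'n \<Rightarrow> complex"
  assumes t: "t \<in> {0..e}"
    and f: "\<And>t. t \<in> {0..e} \<Longrightarrow> tempered (f t)" and k: "tempered_family {0..e} k"
    and d: "\<And>t z. t \<in> {0..e} \<Longrightarrow> ((\<lambda>t. f t z) has_vector_derivative k t z) (at t within {0..e})"
  shows "ext T (f t) - ext T (f 0) = integral {0..t} (\<lambda>s. ext T (k s))"
proof -
  interpret compact_parameter lborel "{0..t}" by (rule compact_parameter_lborel) simp
  have kt: "tempered_family {0..t} k"
    using tempered_family_reindex[OF k, of "{0..t}" "\<lambda>s. s"] t by auto
  then obtain K where K: "smooth_family (weight K) {0..t} k" unfolding tempered_family_def by blast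
  have "(LINT s:{0..t}|lborel. k s z) = f t z - f 0 z" for z
  proof -
    have "set_integrable lborel {0..t} (\<lambda>s. k s z)"
      by (rule set_integrable_continuous[OF smooth_family_continuous_param[OF K]])
    then have "(LINT s:{0..t}|lborel. k s z) = integral {0..t} (\<lambda>s. k s z)"
      by (rule set_borel_integral_eq_integral(2))
    also have "\<dots> = f t z - f 0 z"
      using t by (intro integral_unique fundamental_theorem_of_calculus)
        (auto intro: has_vector_derivative_within_subset[OF d])
    finally show ?thesis .
  qed
  then have "(LINT s:{0..t}|lborel. ext T (k s)) = ext T (\<lambda>z. f t z - f 0 z)"
    using ext_swap[OF compact_parameter_lborel[OF compact_Icc] kt] by simp
  also have "\<dots> = ext T (f t) - ext T (f 0)" using f t by (subst ext_diff) auto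
  finally show ?thesis
    using set_borel_integral_eq_integral(2)[OF set_integrable_continuous[OF ext_continuous[OF kt]]] by simp
qed

lemma ext_derivative_0:
  fixes f k :: "real \<Rightarrow> complex ^ 'n \<Rightarrow> complex"
  assumes e: "e > 0"
    and f: "\<And>t. t \<in> {0..e} \<Longrightarrow> tempered (f t)" and k: "tempered_family {0..e} k"
    and d: "\<And>t z. t \<in> {0..e} \<Longrightarrow> ((\<lambda>t. f t z) has_vector_derivative k t z) (at t within {0..e})"
    and z: "\<And>t. t \<in> {0..e} \<Longrightarrow> ext T (f t) = 0"
  shows "ext T (k 0) = 0"
proof (rule eq_of_integrals_eq[OF ext_continuous[OF k] continuous_on_const e])
  fix t assume t: "t \<in> {0..e}"
  show "integral {0..t} (\<lambda>s. ext T (k s)) = integral {0..t} (\<lambda>s. 0)"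
    using ext_ftc[OF t f k d] z[OF t] z[of 0] e by simp
qed

end

section \<open>Polynomials and regularisation\<close>

text \<open>Generated by multiplying with one real coordinate at a time: each use of this rule
  corresponds to one differentiation in the centre or in the direction.\<close>

inductive cpoly :: "('a::euclidean_space \<Rightarrow> complex) \<Rightarrow> bool" where
  const: "cpoly (\<lambda>x. c)"
| coord: "cpoly p \<Longrightarrow> b \<in> Basis \<Longrightarrow> cpoly (\<lambda>x. p x * of_real (x \<bullet> b))"
| add: "cpoly p \<Longrightarrow> cpoly q \<Longrightarrow> cpoly (\<lambda>x. p x + q x)"

lemma cpoly_tempered: "cpoly p \<Longrightarrow> tempered_family Y (\<lambda>_. p)"
  by (induction rule: cpoly.induct)
    (intro tempered_family_const tempered_family_mult tempered_family_coord tempered_family_add; assumption)+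

lemma cpoly_cmult: "cpoly q \<Longrightarrow> cpoly (\<lambda>x. c * q x)"
proof (induction rule: cpoly.induct)
  case (coord p b)
  from cpoly.coord[OF coord.IH coord.hyps(2)] show ?case by (simp add: mult_ac)
next
  case (add p q)
  from cpoly.add[OF add.IH] show ?case by (simp add: algebra_simps)
qed (rule cpoly.const)

lemma cpoly_mult: "cpoly p \<Longrightarrow> cpoly q \<Longrightarrow> cpoly (\<lambda>x. p x * q x)"
proof (induction rule: cpoly.induct)
  case (const c)
  then show ?case by (rule cpoly_cmult)
next
  case (coord p b)
  from cpoly.coord[OF coord.IH[OF coord.prems] coord.hyps(2)] show ?case by (simp add: mult_ac)
next
  case (add p p')
  from cpoly.add[OF add.IH(1)[OF add.prems] add.IH(2)[OF add.prems]] show ?case by (simp add: algebra_simps)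
qed

lemma cpoly_sum: "finite I \<Longrightarrow> (\<And>i. i \<in> I \<Longrightarrow> cpoly (f i)) \<Longrightarrow> cpoly (\<lambda>x. \<Sum>i\<in>I. f i x)"
  by (induction I rule: finite_induct) (auto intro: cpoly.const cpoly.add)

lemma bounded_linear_coords:
  fixes f :: "'a::euclidean_space \<Rightarrow> real"
  assumes "bounded_linear f"
  shows "f x = (\<Sum>b\<in>Basis. (x \<bullet> b) * f b)"
proof -
  interpret bounded_linear f by fact
  have "f x = f (\<Sum>b\<in>Basis. (x \<bullet> b) *\<^sub>R b)" by (simp add: euclidean_representation)
  then show ?thesis by (simp add: sum scaleR)
qed

lemma translated_polynomial_linear:
  fixes f :: "'a::euclidean_space \<Rightarrow> real"
  assumes "bounded_linear f"
  shows "complex_of_real (f (x - y)) = (\<Sum>b\<in>Basis. of_real (f b) * of_real (x \<bullet> b)) + (- of_real (f y))"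
  using linear_diff[OF bounded_linear.linear[OF assms], of x y] bounded_linear_coords[OF assms, of x]
  by (simp add: mult.commute)

lemma translated_polynomial_cpoly:
  fixes q :: "'a::euclidean_space \<Rightarrow> real"
  shows "real_polynomial_function q \<Longrightarrow> cpoly (\<lambda>x. complex_of_real (q (x - y)))"
proof (induction rule: real_polynomial_function.induct)
  case (linear f)
  have "cpoly (\<lambda>x. of_real (f b) * complex_of_real (x \<bullet> b))" if "b \<in> Basis" for b
    using cpoly.coord[OF cpoly.const that] .
  then show ?case unfolding translated_polynomial_linear[OF linear]
    by (intro cpoly.add cpoly_sum cpoly.const) auto
next
  case (add f g)
  from cpoly.add[OF add.IH] show ?case by simp
next
  case (mult f g)
  from cpoly_mult[OF mult.IH] show ?case by simp
qed (rule cpoly.const)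

lemma tempered_family_sum:
  "finite I \<Longrightarrow> (\<And>i. i \<in> I \<Longrightarrow> tempered_family Y (f i)) \<Longrightarrow> tempered_family Y (\<lambda>y x. \<Sum>i\<in>I. f i y x)"
  by (induction I rule: finite_induct) (auto intro: tempered_family_const tempered_family_add)

text \<open>Here the translation is the parameter. The growth order in \<open>x\<close> is the same
  for all \<open>y\<close> in the compact set, as needed for interchanging \<open>T\<close> with an
  integral over \<open>y\<close>.\<close>

lemma translated_polynomial_tempered:
  fixes q :: "'a::euclidean_space \<Rightarrow> real" and Y :: "'a set"
  assumes "compact Y"
  shows "real_polynomial_function q \<Longrightarrow> tempered_family Y (\<lambda>y x. complex_of_real (q (x - y)))"
proof (induction rule: real_polynomial_function.induct)
  case (linear f)
  have c: "continuous_on Y (\<lambda>y. - complex_of_real (f y))"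
    by (intro continuous_intros linear_continuous_on linear)
  show ?case unfolding translated_polynomial_linear[OF linear]
    by (intro tempered_family_add tempered_family_sum tempered_family_mult tempered_family_const tempered_family_coord
        tempered_family_scalar c compact_imp_bounded compact_continuous_image assms finite_Basis)
next
  case (add f g)
  from tempered_family_add[OF add.IH] show ?case by simp
next
  case (mult f g)
  from tempered_family_mult[OF mult.IH] show ?case by simp
qed (rule tempered_family_const)

lemma smooth_family_translate:
  fixes f :: "'a::euclidean_space \<Rightarrow> complex" and \<tau> :: "'y::metric_space \<Rightarrow> 'a"
  assumes "smooth_family (\<lambda>_. 1) {0::real} (\<lambda>_. f)" "continuous_on Y \<tau>"
  shows "smooth_family (\<lambda>_. 1) Y (\<lambda>y x. f (x + \<tau> y))"
proof (rule smooth_family_affine[where L="\<lambda>_ x. x" and F="\<lambda>_. f"])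
  show "smooth_family (\<lambda>_. 1) Y (\<lambda>_. f)" using assms(1) by (rule smooth_family_constant_param) simp
qed (auto intro: assms(2) bounded_linear_ident simp: image_constant_conv)

lemma lebesgue_integral_reflect:
  fixes f :: "'a::euclidean_space \<Rightarrow> complex"
  assumes "f \<in> borel_measurable borel"
  shows "(LINT x|lborel. f (t - x)) = (LINT x|lborel. f x)"
proof -
  have m: "(\<lambda>x. t + (-1) *\<^sub>R x) \<in> (lborel :: 'a measure) \<rightarrow>\<^sub>M borel" by simp
  have "lborel = density (distr lborel borel (\<lambda>x::'a. t + (-1) *\<^sub>R x)) (\<lambda>_. 1)"
    using lborel_affine[of "-1" t] by simp
  then have "(LINT x|lborel. f x) = (LINT x|distr lborel borel (\<lambda>x::'a. t + (-1) *\<^sub>R x). f x)"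
    by (metis density_1)
  then show ?thesis using integral_distr[OF m, of f] assms by simp
qed

context rapidly_decreasing_distribution
begin

text \<open>A compactly supported distribution that annihilates the polynomials is zero. The function M
  of the proof is a regularisation of the distribution, which is orthogonal to all polynomials.\<close>

lemma annihilates_polynomials:
  assumes G: "G \<in> test_functions"
    and ann: "\<And>p. cpoly p \<Longrightarrow> ext T (\<lambda>z. p z * G z) = 0"
    and \<phi>: "\<phi> \<in> test_functions"
  shows "ext T (\<lambda>z. G z * \<phi> z) = 0"
proof -
  have "bounded (supp G \<union> supp \<phi>)"
    using compact_imp_bounded[OF test_functionD(2)[OF G]] compact_imp_bounded[OF test_functionD(2)[OF \<phi>]] by simp
  then obtain l where l: "l > 0" "\<And>z. z \<in> supp G \<union> supp \<phi> \<Longrightarrow> norm z \<le> l"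
    unfolding bounded_pos by blast
  have G0: "G z = 0" if "norm z > l" for z by (rule not_in_supp) (use l(2)[of z] that in auto)
  have \<phi>0: "\<phi> z = 0" if "norm z > l" for z by (rule not_in_supp) (use l(2)[of z] that in auto)
  \<comment> \<open>Radius \<open>2 * l\<close> contains every difference of a point of
    \<open>supp G\<close> and a point of \<open>supp \<phi>\<close>, so \<open>M\<close> captures
    the whole regularisation on \<open>B\<close>.\<close>
  define B where "B = cball (0 :: complex ^ 'n) (2 * l)"
  define B1 where "B1 = cball (0 :: complex ^ 'n) l"
  have cp: "compact_parameter lborel B" "compact_parameter lborel B1"
    unfolding B_def B1_def by (intro compact_parameter_lborel compact_cball)+
  interpret B: compact_parameter lborel B by (rule cp(1))
  interpret B1: compact_parameter lborel B1 by (rule cp(2))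
  have tr: "tempered_family B (\<lambda>u z. G z * \<phi> (z - u))"
  proof (rule tempered_family_mult[OF tempered_test[OF G] tempered_familyI])
    show "smooth_family (\<lambda>_. 1) B (\<lambda>u z. \<phi> (z - u))"
      using smooth_family_translate[OF smooth_family_test[OF \<phi>] continuous_on_minus[OF continuous_on_id], of B] by simp
  qed
  define M where "M u = ext T (\<lambda>z. G z * \<phi> (z - u))" for u
  have M: "continuous_on B M" unfolding M_def by (rule ext_continuous[OF tr])
  have trm: "tempered (\<lambda>z. G z * \<phi> (z - u))" if "u \<in> B" for u by (rule tempered_family_member[OF tr that])
  have orth: "(LINT u:B|lborel. of_real (q u) * M u) = 0" if q: "real_polynomial_function q" for q :: "complex ^ 'n \<Rightarrow> real"
  proof -
    have qc: "continuous_on A q" for A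
      by (intro continuous_at_imp_continuous_on ballI continuous_real_polymonial_function q)
    have cq: "continuous_on B (\<lambda>u. complex_of_real (q u))" by (rule continuous_on_of_real[OF qc])
    have tq: "tempered_family B (\<lambda>u z. of_real (q u) * (G z * \<phi> (z - u)))"
      by (rule tempered_family_mult[OF tempered_family_scalar[OF cq compact_imp_bounded[OF compact_continuous_image[OF cq B.compact_Y]]] tr])
    have c\<phi>: "continuous_on B1 \<phi>" by (rule smooth_continuous[OF test_functionD(1)[OF \<phi>]])
    have ts: "tempered_family B1 (\<lambda>y z. \<phi> y * (of_real (q (z - y)) * G z))"
      by (rule tempered_family_mult[OF tempered_family_scalar[OF c\<phi> compact_imp_bounded[OF compact_continuous_image[OF c\<phi> B1.compact_Y]]]
            tempered_family_mult[OF translated_polynomial_tempered[OF B1.compact_Y q] tempered_test[OF G]]])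
    \<comment> \<open>The substitution \<open>y = z - u\<close> moves the variable \<open>z\<close>
      into the polynomial: for fixed \<open>y\<close> the function \<open>q (z - y)\<close> is a
      polynomial in \<open>z\<close>, to which \<open>ann\<close> applies.\<close>
    have eq: "(LINT u:B|lborel. of_real (q u) * (G z * \<phi> (z - u))) = (LINT y:B1|lborel. \<phi> y * (of_real (q (z - y)) * G z))" for z
    proof (cases "norm z \<le> l")
      case False
      then show ?thesis by (simp add: G0 set_lebesgue_integral_def)
    next
      case True
      have m: "(\<lambda>u. of_real (q u) * (G z * \<phi> (z - u))) \<in> borel_measurable borel"
      proof (intro borel_measurable_continuous_onI continuous_on_mult continuous_on_of_real qc continuous_on_const)
        have "continuous_on UNIV (\<lambda>u. z - u)" by (intro continuous_intros)
        from continuous_on_compose2[OF smooth_continuous[OF test_functionD(1)[OF \<phi>], of UNIV] this]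
        show "continuous_on UNIV (\<lambda>u. \<phi> (z - u))" by simp
      qed
      have "\<phi> (z - u) = 0" if "u \<notin> B" for u
        using that True norm_triangle_ineq2[of u z] by (intro \<phi>0) (simp add: B_def norm_minus_commute)
      then have "(LINT u:B|lborel. of_real (q u) * (G z * \<phi> (z - u))) = (LINT u|lborel. of_real (q u) * (G z * \<phi> (z - u)))"
        unfolding set_lebesgue_integral_def
        by (intro Bochner_Integration.integral_cong) (auto simp: indicator_def)
      also have "\<dots> = (LINT y|lborel. of_real (q (z - y)) * (G z * \<phi> (z - (z - y))))"
        by (rule lebesgue_integral_reflect[OF m, symmetric])
      also have "\<dots> = (LINT y:B1|lborel. \<phi> y * (of_real (q (z - y)) * G z))"
        unfolding set_lebesgue_integral_def
        by (intro Bochner_Integration.integral_cong) (auto simp: indicator_def B1_def \<phi>0)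
      finally show ?thesis .
    qed
    have "(LINT u:B|lborel. of_real (q u) * M u) = (LINT u:B|lborel. ext T (\<lambda>z. of_real (q u) * (G z * \<phi> (z - u))))"
      by (intro set_lebesgue_integral_cong B.Y_sets) (simp add: M_def ext_cmult trm)
    also have "\<dots> = ext T (\<lambda>z. LINT u:B|lborel. of_real (q u) * (G z * \<phi> (z - u)))"
      by (rule ext_swap[OF cp(1) tq, symmetric])
    also have "\<dots> = (LINT y:B1|lborel. ext T (\<lambda>z. \<phi> y * (of_real (q (z - y)) * G z)))"
      unfolding eq by (rule ext_swap[OF cp(2) ts])
    also have "\<dots> = (LINT y:B1|lborel. 0)"
    proof (intro set_lebesgue_integral_cong B1.Y_sets allI impI)
      fix y assume "y \<in> B1"
      have p: "cpoly (\<lambda>z. complex_of_real (q (z - y)))" by (rule translated_polynomial_cpoly[OF q])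
      have "tempered (\<lambda>z. of_real (q (z - y)) * G z)"
        by (rule tempered_family_mult[OF cpoly_tempered[OF p] tempered_test[OF G]])
      then show "ext T (\<lambda>z. \<phi> y * (of_real (q (z - y)) * G z)) = 0"
        using ann[OF p] by (simp add: ext_cmult)
    qed
    finally show ?thesis by (simp add: set_lebesgue_integral_def)
  qed
  have "bounded (M ` B)" using compact_imp_bounded[OF compact_continuous_image[OF M B.compact_Y]] .
  then obtain C where C: "C > 0" "\<And>u. u \<in> B \<Longrightarrow> norm (M u) \<le> C" unfolding bounded_pos by blast
  \<comment> \<open>Weierstrass approximation carries orthogonality from polynomials over to all
    continuous real functions on \<open>B\<close>.\<close>
  have zero: "(LINT u:B|lborel. of_real (N u) * M u) = 0" if N: "continuous_on B N" for N :: "complex ^ 'n \<Rightarrow> real"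
  proof -
    have "norm (LINT u:B|lborel. of_real (N u) * M u) \<le> 0 + e" if e: "e > 0" for e
    proof -
      define e' where "e' = e / (C * measure lborel B + 1)"
      have pos: "C * measure lborel B + 1 > 0" using C(1) by (simp add: add_nonneg_pos)
      have e': "e' > 0" using e pos by (simp add: e'_def)
      obtain q where q: "real_polynomial_function q" "\<And>u. u \<in> B \<Longrightarrow> \<bar>N u - q u\<bar> < e'"
        using Stone_Weierstrass_real_polynomial_function[OF B.compact_Y N e'] by blast
      have qc: "continuous_on B q"
        by (intro continuous_at_imp_continuous_on ballI continuous_real_polymonial_function q(1))
      have i: "set_integrable lborel B (\<lambda>u. of_real (N u) * M u)" "set_integrable lborel B (\<lambda>u. of_real (q u) * M u)"
        by (intro B.set_integrable_continuous continuous_intros M N qc)+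
      have "(LINT u:B|lborel. of_real (N u) * M u) = (LINT u:B|lborel. of_real (N u) * M u - of_real (q u) * M u)"
        using orth[OF q(1)] set_integral_diff(2)[OF i] by simp
      also have "norm \<dots> \<le> e' * C * measure lborel B"
      proof (rule B.norm_set_integral_le)
        fix u assume u: "u \<in> B"
        have "norm (of_real (N u) * M u - of_real (q u) * M u) = \<bar>N u - q u\<bar> * norm (M u)"
          by (simp flip: left_diff_distrib of_real_diff add: norm_mult)
        also have "\<dots> \<le> e' * C" using q(2)[OF u] C(2)[OF u] e' by (intro mult_mono) auto
        finally show "norm (of_real (N u) * M u - of_real (q u) * M u) \<le> e' * C" .
      qed (intro continuous_intros M N qc)
      also have "\<dots> = e * (C * measure lborel B / (C * measure lborel B + 1))" by (simp add: e'_def)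
      also have "\<dots> \<le> e * 1" using e pos by (intro mult_left_mono) auto
      finally show ?thesis by simp
    qed
    then have "norm (LINT u:B|lborel. of_real (N u) * M u) \<le> 0" by (rule field_le_epsilon)
    then show ?thesis by simp
  qed
  have cRI: "continuous_on B (\<lambda>u. Re (M u))" "continuous_on B (\<lambda>u. Im (M u))" by (intro continuous_intros M)+
  \<comment> \<open>\<open>M\<close> is tested against its own real and imaginary part, as the
    squared modulus is \<open>Re M\<close> times \<open>M\<close> minus \<open>\<i>\<close> times
    \<open>Im M\<close> times \<open>M\<close>.\<close>
  have "(LINT u:B|lborel. complex_of_real ((norm (M u))\<^sup>2)) =
    (LINT u:B|lborel. of_real (Re (M u)) * M u - \<i> * (of_real (Im (M u)) * M u))"
    unfolding cmod_power2
    by (intro set_lebesgue_integral_cong B.Y_sets) (auto simp: complex_eq_iff power2_eq_square)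
  also have "\<dots> = (LINT u:B|lborel. of_real (Re (M u)) * M u) - \<i> * (LINT u:B|lborel. of_real (Im (M u)) * M u)"
    by (subst set_integral_diff(2)) (auto intro!: B.set_integrable_continuous continuous_intros M)
  also have "\<dots> = 0" by (simp only: zero[OF cRI(1)] zero[OF cRI(2)]) simp
  \<comment> \<open>The value at \<open>u = 0\<close> is the one wanted, and 0 is interior to
    \<open>B\<close>.\<close>
  finally have "(norm (M 0))\<^sup>2 = 0"
  proof (rule B.nonneg_integral_zero[rotated 2])
    show "continuous_on B (\<lambda>u. (norm (M u))\<^sup>2)" by (intro continuous_intros M)
    show "0 \<in> B" using l(1) by (simp add: B_def)
    fix U :: "(complex ^ 'n) set" assume U: "open U" "0 \<in> U"
    then have "emeasure lborel (U \<inter> ball 0 (2 * l)) \<noteq> 0"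
      using l(1) by (intro emeasure_lborel_open_nonzero[of _ 0]) auto
    moreover have "emeasure lborel (U \<inter> ball 0 (2 * l)) \<le> emeasure lborel (U \<inter> B)"
      using U(1) by (intro emeasure_mono) (auto simp: B_def)
    ultimately show "emeasure lborel (U \<inter> B) \<noteq> 0" by auto
  qed auto
  then show ?thesis by (simp add: M_def)
qed

end

subsection \<open>Vanishing outside a ball\<close>

lemma smooth_power_mult: "smooth G \<Longrightarrow> smooth (\<lambda>x::real. of_real (x ^ m) * G x :: complex)"
proof (induction m)
  case (Suc m)
  have "smooth (\<lambda>x::real. complex_of_real ((x - 0) \<bullet> 1) * (of_real (x ^ m) * G x))"
    by (intro smooth_mult smooth_coord Suc)
  then show ?case by (simp add: mult_ac)
qed simp

lemma iterate_deriv_vanishes: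
  fixes F :: "real \<Rightarrow> complex"
  assumes "\<And>x. x \<notin> {A..B} \<Longrightarrow> F x = 0" "x \<notin> {A..B}"
  shows "(dir_deriv 1 ^^ l) F x = 0"
  using assms(2)
proof (induction l arbitrary: x)
  case 0
  then show ?case using assms(1) by simp
next
  case (Suc l)
  then show ?case using dir_deriv_eq_0_open[of "- {A..B}" "(dir_deriv 1 ^^ l) F" x 1] by (simp add: open_Compl)
qed

lemma radial_compact_support:
  fixes c :: "'a::euclidean_space"
  assumes "\<And>x. x > B \<Longrightarrow> \<phi> x = 0" "z \<notin> cball c (sqrt B)"
  shows "\<phi> ((norm (z - c))\<^sup>2) = 0"
proof (rule assms(1))
  have "sqrt B < norm (z - c)" using assms(2) by (simp add: dist_norm norm_minus_commute)
  then have "sqrt B < sqrt ((norm (z - c))\<^sup>2)" by simp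
  then show "B < (norm (z - c))\<^sup>2" by (simp only: real_sqrt_less_iff)
qed

lemma smooth_family_radial:
  fixes c :: "'a::euclidean_space"
  assumes "smooth \<phi>" "\<And>x. x > B \<Longrightarrow> \<phi> x = 0"
  shows "smooth_family (\<lambda>_. 1) Y (\<lambda>_ z. \<phi> ((norm (z - c))\<^sup>2))"
  by (rule smooth_family_compact_support[OF smooth_radial[OF assms(1), of c] radial_compact_support[where B=B and \<phi>=\<phi> and c=c, OF assms(2)] compact_cball])
    simp_all

lemma radial_test_function:
  fixes c :: "complex ^ 'n::finite"
  assumes "smooth \<phi>" "\<And>x. x > B \<Longrightarrow> \<phi> x = 0"
  shows "(\<lambda>z. \<phi> ((norm (z - c))\<^sup>2)) \<in> test_functions"
  by (rule test_functionI(1)[OF smooth_radial[OF assms(1), of c] compact_cball radial_compact_support[where B=B and \<phi>=\<phi> and c=c, OF assms(2)]])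

lemma norm_cis_mult: "norm (s * cis \<theta> - t * cis \<theta>) = norm (s - t)"
  by (simp flip: left_diff_distrib add: norm_mult)

text \<open>For unit \<open>w\<close> the number \<open>|s - scalar_product c w|\<close> is the
  distance of the hyperplane from \<open>c\<close>. It is at most \<open>R + norm c\<close> for
  hyperplanes that meet \<open>K\<close>, and at least \<open>sqrt A\<close> where \<open>h\<close>
  may be nonzero.\<close>

lemma radial_D_X:
  fixes c :: "complex ^ 'n::finite" and g :: "real \<Rightarrow> complex"
  assumes g: "smooth g" "\<And>x. x \<notin> {A..B} \<Longrightarrow> g x = 0"
    and K: "K \<subseteq> cball 0 R" and R: "0 \<le> R" and A: "(R + norm c)\<^sup>2 < A"
  defines "h \<equiv> \<lambda>(w, s). g ((norm (s - scalar_product c w))\<^sup>2)"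
  shows "h \<in> D_X" "supp_X h \<subseteq> X_space - hat K"
proof -
  let ?S = "sphere (0 :: complex ^ 'n) 1"
  define C where "C = {p \<in> ?S \<times> UNIV. (norm (snd p - scalar_product c (fst p)))\<^sup>2 \<in> {A..B}}"
  have f: "smooth_family (\<lambda>_. 1) {0::real} (\<lambda>_ s. g ((norm (s - (0::complex)))\<^sup>2))"
    by (rule smooth_family_radial[OF g(1), of B]) (use g(2) in auto)
  have fam: "smooth_family (\<lambda>_. 1) ?S (\<lambda>w s. h (w, s))"
    using smooth_family_translate[OF f, of ?S "\<lambda>w. - scalar_product c w"]
    by (simp add: h_def continuous_on_minus continuous_on_scalar_product continuous_on_const continuous_on_id)
  have inv: "h (cis \<theta> *s w, s * cis \<theta>) = h (w, s)" for w s \<theta>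
    by (simp add: h_def scalar_product_simps norm_cis_mult mult.commute[of "cis \<theta>" "scalar_product c w"])
  have "closed ((\<lambda>p. (norm (snd p - scalar_product c (fst p)))\<^sup>2) -` {A..B} \<inter> (?S \<times> UNIV))"
    by (intro closed_Int closed_vimage closed_Times closed_sphere closed_UNIV closed_atLeastAtMost continuous_intros)
  moreover have "C = (\<lambda>p. (norm (snd p - scalar_product c (fst p)))\<^sup>2) -` {A..B} \<inter> (?S \<times> UNIV)"
    by (auto simp: C_def)
  ultimately have "closed C" by simp
  moreover have "C \<subseteq> ?S \<times> cball 0 (sqrt B + norm c)"
  proof
    fix p assume p: "p \<in> C"
    then have w: "norm (fst p) = 1" by (auto simp: C_def)
    have "sqrt ((norm (snd p - scalar_product c (fst p)))\<^sup>2) \<le> sqrt B"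
      using p by (intro real_sqrt_le_mono) (auto simp: C_def)
    then have "norm (snd p - scalar_product c (fst p)) \<le> sqrt B" by simp
    moreover have "norm (scalar_product c (fst p)) \<le> norm c" using norm_scalar_product_le[of c "fst p"] w by simp
    ultimately have "norm (snd p) \<le> sqrt B + norm c"
      using norm_triangle_sub[of "snd p" "scalar_product c (fst p)"] by linarith
    then show "p \<in> ?S \<times> cball 0 (sqrt B + norm c)" using w by (cases p) auto
  qed
  moreover have "compact (?S \<times> cball (0::complex) (sqrt B + norm c))" by (intro compact_Times compact_sphere compact_cball)
  ultimately have C: "compact C" by (metis compact_Int_closed inf.absorb2)
  have h0: "h (w, s) = 0" if "w \<in> ?S" "(w, s) \<notin> C" for w s
    using that g(2) by (auto simp: C_def h_def)
  show "h \<in> D_X" by (rule D_X_I(1)[OF fam inv C h0])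
  have "supp_X h \<subseteq> C" by (rule D_X_I(2)[OF fam inv C h0])
  moreover have "p \<in> X_space - hat K" if p: "p \<in> C" for p
  proof -
    obtain w s where ws: "p = (w, s)" by fastforce
    have w: "norm w = 1" and s: "A \<le> (norm (s - scalar_product c w))\<^sup>2" using p by (auto simp: C_def ws)
    have "(w, s) \<notin> hat K"
    proof
      assume "(w, s) \<in> hat K"
      then obtain x where x: "x \<in> K" "s = scalar_product x w" by (auto simp: hat_def chyperplane_def)
      have "norm (s - scalar_product c w) \<le> norm (x - c)"
        using norm_scalar_product_le[of "x - c" w] w by (simp add: x scalar_product_simps)
      also have "\<dots> \<le> R + norm c" using x(1) K norm_triangle_ineq4[of x c] by force
      finally have "(norm (s - scalar_product c w))\<^sup>2 \<le> (R + norm c)\<^sup>2" by (intro power_mono) auto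
      then show False using s A by linarith
    qed
    then show ?thesis using w by (simp add: ws X_space_def)
  qed
  ultimately show "supp_X h \<subseteq> X_space - hat K" by blast
qed

locale radon_supported_in_hat = rapidly_decreasing_distribution T
  for T :: "(complex ^ 'n \<Rightarrow> complex) \<Rightarrow> complex" +
  fixes K :: "(complex ^ 'n) set" and R :: real
  assumes radon_supp: "X_supported_in (radon T) (hat K)"
    and K_bound: "K \<subseteq> cball 0 R" and R_nonneg: "0 \<le> R"
begin

lemma radial_vanishes:
  assumes G: "smooth G" "\<And>x. x \<notin> {A..B} \<Longrightarrow> G x = 0" and A: "(R + norm c)\<^sup>2 < A"
  shows "ext T (\<lambda>z. G ((norm (z - c))\<^sup>2)) = 0"
proof -
  \<comment> \<open>Any coordinate will do: it merely names the moment that occurs as a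
    constant.\<close>
  obtain i :: 'n where True by simp
  define m where "m = CARD('n) - 1"
  define F where "F x = of_real (x ^ m) * G x" for x
  have F: "smooth F" unfolding F_def by (rule smooth_power_mult[OF G(1)])
  have F0: "F x = 0" if "x \<notin> {A..B}" for x using G(2)[OF that] by (simp add: F_def)
  define g where "g = (dir_deriv 1 ^^ m) F"
  have g: "smooth g" "\<And>x. x \<notin> {A..B} \<Longrightarrow> g x = 0"
    unfolding g_def by (rule smooth_iterate[OF F], rule iterate_deriv_vanishes[of A B F, OF F0])
  define h where "h = (\<lambda>(w, s). g ((norm (s - scalar_product c w))\<^sup>2))"
  have h: "h \<in> D_X" "supp_X h \<subseteq> X_space - hat K"
    unfolding h_def by (rule radial_D_X[OF g K_bound R_nonneg A]; assumption)+
  have A0: "A > 0" using A zero_le_power2[of "R + norm c"] by linarith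
  define \<kappa> where "\<kappa> = sphere_moment i 0 * fact m"
  have \<kappa>: "\<kappa> \<noteq> 0" using sphere_moment_0[of i] by (simp add: \<kappa>_def)
  have "dual_radon h z = \<kappa> * G ((norm (z - c))\<^sup>2)" for z
  proof -
    have d: "dual_radon h z = (LINT w:sphere 0 1|sphere_borel. g ((norm (scalar_product (z - c) w))\<^sup>2))"
      unfolding dual_radon_integral(1)[OF D_X_smooth_family[OF h(1)]]
      by (simp add: h_def scalar_product_simps)
    define \<rho> where "\<rho> = (norm (z - c))\<^sup>2"
    have avg: "of_real (\<rho> ^ m) * dual_radon h z = \<kappa> * F \<rho>"
      using sphere_radial_average[OF F _ A0, of "z - c" i] F0 unfolding d g_def \<kappa>_def \<rho>_def m_def by simp
    show ?thesis
    \<comment> \<open>At the centre the factor \<open>\<rho> ^ m\<close> may be zero and cannot be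
      cancelled; there both sides vanish because \<open>0 < A\<close>.\<close>
    proof (cases "z = c")
      case True
      have "g 0 = 0" "G 0 = 0" using g(2)[of 0] G(2)[of 0] A0 by auto
      then show ?thesis unfolding d by (simp add: True scalar_product_simps set_lebesgue_integral_def)
    next
      case False
      then have "complex_of_real (\<rho> ^ m) \<noteq> 0" by (simp add: \<rho>_def)
      moreover have "of_real (\<rho> ^ m) * dual_radon h z = of_real (\<rho> ^ m) * (\<kappa> * G \<rho>)"
        unfolding avg F_def by (simp add: mult_ac)
      ultimately have "dual_radon h z = \<kappa> * G \<rho>" using mult_left_cancel by blast
      then show ?thesis by (simp only: \<rho>_def)
    qed
  qed
  then have "dual_radon h = (\<lambda>z. \<kappa> * G ((norm (z - c))\<^sup>2))" by auto
  then have "ext T (\<lambda>z. \<kappa> * G ((norm (z - c))\<^sup>2)) = 0"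
    using radon_supp h radon_ext[OF h(1)] unfolding X_supported_in_def by auto
  moreover have "tempered (\<lambda>z. G ((norm (z - c))\<^sup>2))"
    by (intro tempered_test radial_test_function[OF G(1), of B]) (use G(2) in auto)
  ultimately show ?thesis using \<kappa> by (simp add: ext_cmult)
qed

text \<open>To gain a factor \<open>z \<bullet> b\<close>, \<open>G\<close> is replaced by a
  primitive \<open>H\<close>: moving the centre in direction \<open>b\<close> differentiates
  \<open>H (|z - c|^2)\<close> to \<open>-2 ((z - c) \<bullet> b) G (|z - c|^2)\<close>, and the
  part with \<open>c \<bullet> b\<close> is known by induction. As \<open>H\<close> is constant near
  infinity and not zero, the induction hypothesis reaches it only through a limit of
  cut-offs.\<close>

lemma polynomial_radial_vanishes:
  assumes "cpoly p"
  shows "smooth G \<Longrightarrow> (\<And>x. x \<notin> {A..B} \<Longrightarrow> G x = 0) \<Longrightarrow> (R + norm c)\<^sup>2 < A \<Longrightarrow>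
    ext T (\<lambda>z. p z * G ((norm (z - c))\<^sup>2)) = 0"
  using assms
proof (induction p arbitrary: G A B c rule: cpoly.induct)
  case (const a)
  have "tempered (\<lambda>z. G ((norm (z - c))\<^sup>2))"
    by (intro tempered_test radial_test_function[OF const(1), of B]) (use const(2) in auto)
  then show ?case using radial_vanishes[OF const] by (simp add: ext_cmult)
next
  case (add p q)
  have t: "tempered (\<lambda>z. p z * G ((norm (z - c))\<^sup>2))" "tempered (\<lambda>z. q z * G ((norm (z - c))\<^sup>2))"
    by (intro tempered_family_mult cpoly_tempered add.hyps tempered_test radial_test_function[OF add.prems(1), of B];
      use add.prems(2) in auto)+
  show ?case using add.IH[OF add.prems] ext_add[OF t] by (simp add: distrib_right)
next
  case (coord p b)
  note p = coord.hyps(1) and b = coord.hyps(2)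
  \<comment> \<open>The lemma on primitives needs \<open>A \<le> B'\<close>, which is not assumed of
    \<open>B\<close>.\<close>
  define B' where "B' = max A B"
  have G0: "G x = 0" if "x \<notin> {A..B'}" for x using coord.prems(2)[of x] that by (auto simp: B'_def max_def split: if_splits)
  obtain H where H: "smooth H" "dir_deriv 1 H = G" "\<And>x. x \<le> A \<Longrightarrow> H x = 0"
    "\<And>x. B' \<le> x \<Longrightarrow> H x = integral {A..B'} G"
    using antiderivative_compact_support[OF coord.prems(1) G0, of A B'] by (auto simp: B'_def)
  define \<kappa> where "\<kappa> = integral {A..B'} G"
  define f where "f z = H ((norm (z - c))\<^sup>2)" for z
  \<comment> \<open>Subtracting the value \<open>\<kappa>\<close> at infinity leaves a function of
    compact support; adding it back costs only a constant family.\<close>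
  have "smooth_family (\<lambda>_. 1) {0::real} (\<lambda>_ z. (H ((norm (z - c))\<^sup>2) + (- \<kappa>)) + \<kappa>)"
    by (intro smooth_family_add smooth_family_const smooth_family_radial[where \<phi>="\<lambda>x. H x + (- \<kappa>)" and B=B'] smooth_add smooth_const H(1))
      (use H(4) in \<open>simp add: \<kappa>_def\<close>)
  then have f: "smooth_family (\<lambda>_. 1) {0::real} (\<lambda>_. f)" by (simp add: f_def[abs_def])
  have df: "f differentiable (at x)" for x using smooth_family_differentiable_const[OF f] .
  have fd: "dir_deriv v f z = G ((norm (z - c))\<^sup>2) * of_real (2 * ((z - c) \<bullet> v))" for v z
    unfolding f_def[abs_def] using dir_deriv_radial(1)[OF smooth_differentiable[OF H(1)]] H(2) by simp
  \<comment> \<open>Half of the margin by which the condition on the centre holds, so that centres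
    \<open>c + t b\<close> with \<open>t \<le> e\<close> still satisfy it.\<close>
  define e where "e = (sqrt A - (R + norm c)) / 2"
  have "sqrt ((R + norm c)\<^sup>2) < sqrt A" using coord.prems(3) by (simp only: real_sqrt_less_iff)
  then have sA: "R + norm c < sqrt A" using R_nonneg by simp
  then have e: "e > 0" by (simp add: e_def)
  have A0: "A > 0" using coord.prems(3) zero_le_power2[of "R + norm c"] by linarith
  have z: "ext T (\<lambda>z. p z * f (z + t *\<^sub>R (- b))) = 0" if t: "t \<in> {0..e}" for t
  proof -
    define c' where "c' = c + t *\<^sub>R b"
    have fc: "f (z + t *\<^sub>R (- b)) = H ((norm (z - c'))\<^sup>2)" for z by (simp add: f_def c'_def algebra_simps)
    have "norm (t *\<^sub>R b) = t" using t b by simp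
    then have "norm c' \<le> norm c + t" unfolding c'_def using norm_triangle_ineq[of c "t *\<^sub>R b"] by simp
    then have "R + norm c' < sqrt A" using t sA by (auto simp: e_def field_simps)
    then have "(R + norm c')\<^sup>2 < (sqrt A)\<^sup>2" using R_nonneg by (intro power_strict_mono) auto
    then have c': "(R + norm c')\<^sup>2 < A" using A0 by simp
    have ft: "smooth_family (\<lambda>_. 1) {0..1::real} (\<lambda>_ z. f (z + t *\<^sub>R (- b)))"
      by (rule smooth_family_translate[OF f]) simp
    have "tempered_family {0..1::real} (\<lambda>s z. p z * (bump (s *\<^sub>R (z - c')) * f (z + t *\<^sub>R (- b))))"
      by (rule tempered_family_mult[OF cpoly_tempered[OF p] tempered_familyI[OF smooth_family_mult1[OF smooth_family_bump_scaled ft]]])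
    then have "continuous_on {0..1} (\<lambda>s. ext T (\<lambda>z. p z * (bump (s *\<^sub>R (z - c')) * f (z + t *\<^sub>R (- b)))))"
      by (rule ext_continuous)
    then have "ext T (\<lambda>z. p z * (bump (0 *\<^sub>R (z - c')) * f (z + t *\<^sub>R (- b)))) = 0"
    proof (rule continuous_zero_limit)
      fix s :: real assume s: "0 < s" "s \<le> 1"
      \<comment> \<open>The cut-off is centred at \<open>c'\<close> like \<open>H\<close>, so the
        product is again a radial function about \<open>c'\<close>, now with compact support, and
        the induction hypothesis applies.\<close>
      define Gs where "Gs x = smooth_step (s\<^sup>2 * x + 0) * H x" for x
      have e: "(\<lambda>z. p z * (bump (s *\<^sub>R (z - c')) * f (z + t *\<^sub>R (- b)))) = (\<lambda>z. p z * Gs ((norm (z - c'))\<^sup>2))"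
        unfolding fc by (simp add: Gs_def bump_def power_mult_distrib)
      show "ext T (\<lambda>z. p z * (bump (s *\<^sub>R (z - c')) * f (z + t *\<^sub>R (- b)))) = 0"
        unfolding e
      proof (rule coord.IH[where A=A and B="2 / s\<^sup>2"])
        show "smooth Gs" unfolding Gs_def by (intro smooth_mult smooth_affine_real smooth_step(1) H(1))
        show "Gs x = 0" if "x \<notin> {A..2 / s\<^sup>2}" for x
        proof (cases "x < A")
          case False
          then have "2 \<le> s\<^sup>2 * x + 0" using that s by (simp add: field_simps)
          then show ?thesis by (simp only: Gs_def smooth_step(3)) simp
        qed (simp add: Gs_def H(3))
      qed (rule c')
    qed
    then show ?thesis by (simp add: bump_1)
  qed
  have fb: "smooth_family (\<lambda>_. 1) {0::real} (\<lambda>_. dir_deriv (- b) f)"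
  proof -
    have "dir_deriv (- b) f = (\<lambda>z. -1 * dir_deriv b f z)" by (simp add: fd fun_eq_iff)
    then show ?thesis using smooth_family_cmult_const[OF smooth_family_Basis_deriv[OF f b], of "-1"] by simp
  qed
  have "ext T (\<lambda>z. p z * dir_deriv (- b) f (z + 0 *\<^sub>R (- b))) = 0"
  proof (rule ext_derivative_0[OF e, of "\<lambda>t z. p z * f (z + t *\<^sub>R (- b))" "\<lambda>t z. p z * dir_deriv (- b) f (z + t *\<^sub>R (- b))"])
    show "tempered (\<lambda>z. p z * f (z + t *\<^sub>R (- b)))" for t
      by (rule tempered_family_mult[OF cpoly_tempered[OF p] tempered_familyI[OF smooth_family_translate[OF f]]]) simp
    show "tempered_family {0..e} (\<lambda>t z. p z * dir_deriv (- b) f (z + t *\<^sub>R (- b)))"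
      by (rule tempered_family_mult[OF cpoly_tempered[OF p] tempered_familyI[OF smooth_family_translate[OF fb]]])
        (intro continuous_intros)
    show "((\<lambda>t. p z * f (z + t *\<^sub>R (- b))) has_vector_derivative p z * dir_deriv (- b) f (z + t *\<^sub>R (- b))) (at t within {0..e})" for t z
      by (intro has_vector_derivative_mult_right smooth_line_derivative df)
  qed (rule z)
  \<comment> \<open>The term with \<open>z \<bullet> b\<close> is the new one; the term with
    \<open>c \<bullet> b\<close> vanishes by the induction hypothesis.\<close>
  then have "ext T (\<lambda>z. (- 2) * (p z * of_real (z \<bullet> b) * G ((norm (z - c))\<^sup>2)) + (2 * of_real (c \<bullet> b)) * (p z * G ((norm (z - c))\<^sup>2))) = 0"
    by (simp add: fd algebra_simps)
  moreover have r: "tempered_family {0::real} (\<lambda>_ z. G ((norm (z - c))\<^sup>2))"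
    by (intro tempered_test radial_test_function[OF coord.prems(1), of B]) (use coord.prems(2) in auto)
  have t1: "tempered (\<lambda>z. p z * G ((norm (z - c))\<^sup>2))"
    by (rule tempered_family_mult[OF cpoly_tempered[OF p] r])
  moreover have t2: "tempered (\<lambda>z. p z * of_real (z \<bullet> b) * G ((norm (z - c))\<^sup>2))"
    by (rule tempered_family_mult[OF tempered_family_mult[OF cpoly_tempered[OF p] tempered_family_coord] r])
  moreover have "ext T (\<lambda>z. p z * G ((norm (z - c))\<^sup>2)) = 0"
    by (rule coord.IH[OF coord.prems])
  ultimately show ?case by (simp only: ext_linear[OF t2 t1]) simp
qed

lemma vanishes_outside_ball:
  assumes \<phi>: "\<phi> \<in> test_functions" and supp: "\<And>z. norm z \<le> R + 1 \<Longrightarrow> \<phi> z = 0"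
  shows "T \<phi> = 0"
proof -
  obtain L where L: "\<And>z. z \<in> supp \<phi> \<Longrightarrow> norm z \<le> L"
    using compact_imp_bounded[OF test_functionD(2)[OF \<phi>]] unfolding bounded_iff by blast
  \<comment> \<open>\<open>A\<close>, \<open>A'\<close> and \<open>B\<close> are squared radii.
    Above \<open>A\<close>, which exceeds \<open>R^2\<close>, the radial result about the centre 0
    is available; between \<open>A'\<close> and \<open>B\<close> lie all points at which
    \<open>\<phi>\<close> is nonzero.\<close>
  define A where "A = (R + 1 / 2)\<^sup>2"
  define A' where "A' = (R + 1)\<^sup>2"
  define B where "B = 1 + L\<^sup>2"
  define \<delta> where "\<delta> = A' - A"
  have \<delta>: "\<delta> > 0" using R_nonneg unfolding \<delta>_def A_def A'_def by (simp add: power2_eq_square algebra_simps)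
  have BL: "L\<^sup>2 < B" "B > 0" by (simp_all add: B_def add_pos_nonneg)
  \<comment> \<open>The first factor switches off between \<open>B\<close> and \<open>2 B\<close>;
    the second, with reversed argument, switches on between \<open>A\<close> and
    \<open>A'\<close>.\<close>
  define G where "G x = smooth_step ((1 / B) * x + 0) * smooth_step ((- 1 / \<delta>) * x + (1 + A' / \<delta>))" for x
  have sG: "smooth G" unfolding G_def by (intro smooth_mult smooth_affine_real smooth_step)
  have G0: "G x = 0" if "x \<notin> {A..2 * B}" for x
  proof (cases "x < A")
    case True
    have "2 \<le> (- 1 / \<delta>) * x + (1 + A' / \<delta>)"
    proof -
      have "1 \<le> (A' - x) / \<delta>" using True \<delta> by (simp add: \<delta>_def)
      moreover have "(- 1 / \<delta>) * x + (1 + A' / \<delta>) = 1 + (A' - x) / \<delta>" by (simp add: diff_divide_distrib)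
      ultimately show ?thesis by simp
    qed
    then show ?thesis by (simp only: G_def smooth_step(3)) simp
  next
    case False
    then have "2 \<le> (1 / B) * x + 0" using that BL(2) by (simp add: field_simps)
    then show ?thesis by (simp only: G_def smooth_step(3)) simp
  qed
  have G1: "G x = 1" if "A' \<le> x" "x \<le> B" for x
  proof -
    have "(1 / B) * x + 0 \<le> 1" "(- 1 / \<delta>) * x + (1 + A' / \<delta>) \<le> 1"
      using that \<delta> BL(2) by (simp_all add: field_simps)
    then show ?thesis by (simp only: G_def smooth_step(2)) simp
  qed
  have Gt: "(\<lambda>z. G ((norm (z - (0::complex ^ 'n)))\<^sup>2)) \<in> test_functions"
    by (rule radial_test_function[OF sG, of "2 * B"]) (use G0 in auto)
  have "(R + norm (0 :: complex ^ 'n))\<^sup>2 < A"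
    unfolding A_def using R_nonneg by (intro power_strict_mono) auto
  then have "ext T (\<lambda>z. p z * G ((norm (z - 0))\<^sup>2)) = 0" if "cpoly p" for p
    using polynomial_radial_vanishes[OF that sG G0] by blast
  from annihilates_polynomials[OF Gt this \<phi>]
  have "ext T (\<lambda>z. G ((norm (z - 0))\<^sup>2) * \<phi> z) = 0" .
  moreover have "G ((norm (z - 0))\<^sup>2) * \<phi> z = \<phi> z" for z
  proof (cases "\<phi> z = 0")
    case False
    then have "norm z > R + 1" using supp[of z] by force
    then have 1: "A' \<le> (norm z)\<^sup>2" unfolding A'_def using R_nonneg by (intro power_mono) auto
    have "norm z \<le> L" using L not_in_supp False by blast
    then have "(norm z)\<^sup>2 \<le> L\<^sup>2" by (intro power_mono) auto
    then show ?thesis using G1[of "(norm z)\<^sup>2"] 1 BL(1) by simp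
  qed simp
  then have "(\<lambda>z. G ((norm (z - 0))\<^sup>2) * \<phi> z) = \<phi>" by (rule ext)
  ultimately show ?thesis using ext_test[OF \<phi>] by (simp only:)
qed

end

subsection \<open>Plane waves\<close>

lemma sphere_borel_open_nonzero:
  fixes w :: "'a::euclidean_space"
  assumes U: "open U" "w \<in> U" and w: "norm w = 1"
  shows "emeasure sphere_borel (U \<inter> sphere 0 1) \<noteq> 0"
proof -
  define V where "V = {x \<in> ball 0 1 - {0::'a}. x /\<^sub>R norm x \<in> U \<inter> sphere 0 1}"
  have "continuous_on (ball 0 1 - {0::'a}) (\<lambda>x. x /\<^sub>R norm x)" by (intro continuous_intros) auto
  then have "open ((\<lambda>x. x /\<^sub>R norm x) -` U \<inter> (ball 0 1 - {0::'a}))"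
    using U(1) by (simp add: continuous_on_open_vimage open_delete)
  moreover have "(\<lambda>x. x /\<^sub>R norm x) -` U \<inter> (ball 0 1 - {0::'a}) = V" by (auto simp: V_def)
  ultimately have "open V" by simp
  moreover have "(1/2) *\<^sub>R w \<in> V" using U(2) w by (auto simp: V_def)
  ultimately have "emeasure lborel V \<noteq> 0" by (rule emeasure_lborel_open_nonzero)
  moreover have "U \<inter> sphere 0 1 \<in> sets borel" using U(1) by auto
  ultimately show ?thesis using emeasure_sphere_borel[of "U \<inter> sphere 0 1"] by (simp add: V_def)
qed

lemma dir_deriv_wirtinger:
  fixes g :: "complex \<Rightarrow> complex"
  assumes "g differentiable (at s)"
  shows "dir_deriv u g s = u * wirtinger 1 \<i> g s + cnj u * wirtinger_bar 1 \<i> g s"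
proof -
  have "dir_deriv u g s = of_real (Re u) * dir_deriv 1 g s + of_real (Im u) * dir_deriv \<i> g s"
    using dir_deriv_expand[OF assms, of u] by (simp add: Basis_complex_def)
  also have "\<dots> = (of_real (Re u) + \<i> * of_real (Im u)) * wirtinger 1 \<i> g s +
      (of_real (Re u) - \<i> * of_real (Im u)) * wirtinger_bar 1 \<i> g s"
    unfolding wirtinger_dir_deriv_inverse by (simp add: algebra_simps)
  also have "of_real (Re u) + \<i> * of_real (Im u) = u" by (simp add: complex_eq_iff)
  also have "of_real (Re u) - \<i> * of_real (Im u) = cnj u" by (simp add: complex_eq_iff)
  finally show ?thesis .
qed

text \<open>Short segments stay in \<open>W\<close>, and by continuity of \<open>\<psi>\<close> the
  mean of \<open>\<psi>\<close> over them tends to \<open>\<psi> s\<close>, which is thus the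
  complex derivative. Only increments of \<open>\<phi>\<close> are needed, and these are what
  \<open>ext_ftc\<close> supplies.\<close>

lemma holomorphic_on_line_integrals:
  fixes \<phi> \<psi> :: "complex \<Rightarrow> complex"
  assumes W: "open W" and \<psi>: "continuous_on UNIV \<psi>"
    and int: "\<And>s v. (\<And>t. t \<in> {0..1} \<Longrightarrow> s + of_real t * v \<in> W) \<Longrightarrow>
      \<phi> (s + v) - \<phi> s = integral {0..1} (\<lambda>t. v * \<psi> (s + of_real t * v))"
  shows "\<phi> holomorphic_on W"
proof -
  have "(\<phi> has_field_derivative \<psi> s) (at s)" if s: "s \<in> W" for s
    unfolding has_field_derivative_def has_derivative_at_alt
  proof (intro conjI allI impI bounded_linear_mult_right)
    fix e :: real assume e: "e > 0"
    obtain r where r: "r > 0" "ball s r \<subseteq> W" using W s by (meson open_contains_ball)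
    obtain d where d: "d > 0" "\<And>x. dist x s < d \<Longrightarrow> dist (\<psi> x) (\<psi> s) < e"
      using \<psi> e unfolding continuous_on_iff by (metis UNIV_I)
    show "\<exists>d>0. \<forall>y. norm (y - s) < d \<longrightarrow> norm (\<phi> y - \<phi> s - \<psi> s * (y - s)) \<le> e * norm (y - s)"
    proof (intro exI[of _ "min r d"] conjI allI impI)
      fix y assume y: "norm (y - s) < min r d"
      define v where "v = y - s"
      have small: "norm (of_real t * v) < min r d" if "t \<in> {0..1}" for t :: real
      proof -
        have "norm (of_real t * v) \<le> 1 * norm v"
          unfolding norm_mult using that by (intro mult_right_mono) auto
        then show ?thesis using y by (simp add: v_def)
      qed
      have "s + of_real t * v \<in> W" if "t \<in> {0..1}" for t
        using small[OF that] r(2) by (auto simp: dist_norm subset_iff)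
      then have "\<phi> (s + v) - \<phi> s = integral {0..1} (\<lambda>t. v * \<psi> (s + of_real t * v))" by (rule int)
      moreover have c: "continuous_on {0..1} (\<lambda>t. \<psi> (s + of_real t * v))"
        by (rule continuous_on_compose2[OF \<psi>]) (intro continuous_intros, simp)
      have i: "(\<lambda>t. v * \<psi> (s + of_real t * v)) integrable_on {0..1::real}"
        by (intro integrable_continuous_interval continuous_on_mult continuous_on_const c)
      have "integral {0..1::real} (\<lambda>t. v * \<psi> (s + of_real t * v) - v * \<psi> s) =
          integral {0..1} (\<lambda>t. v * \<psi> (s + of_real t * v)) - v * \<psi> s"
        using Henstock_Kurzweil_Integration.integral_diff[OF i integrable_const_ivl[of "v * \<psi> s" 0 1]] by simp
      moreover have "norm (integral {0..1::real} (\<lambda>t. v * \<psi> (s + of_real t * v) - v * \<psi> s)) \<le> (norm v * e) * (1 - 0)"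
      proof (rule integral_bound)
        show "continuous_on {0..1} (\<lambda>t. v * \<psi> (s + of_real t * v) - v * \<psi> s)"
          by (intro continuous_on_diff continuous_on_mult continuous_on_const c)
        fix t :: real assume t: "t \<in> {0..1}"
        have "dist (\<psi> (s + of_real t * v)) (\<psi> s) < e"
          using small[OF t] by (intro d(2)) (simp add: dist_norm)
        then show "norm (v * \<psi> (s + of_real t * v) - v * \<psi> s) \<le> norm v * e"
          unfolding right_diff_distrib[symmetric] norm_mult by (intro mult_left_mono) (auto simp: dist_norm)
      qed simp
      ultimately show "norm (\<phi> y - \<phi> s - \<psi> s * (y - s)) \<le> e * norm (y - s)"
        by (simp add: v_def mult_ac)
    qed (use r d in auto)
  qed
  then show ?thesis using W by (auto simp: holomorphic_on_open)
qed

lemma zero_by_continuation: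
  assumes "\<phi> holomorphic_on W" "open W" "connected W" "ball s1 r \<subseteq> W" "r > 0"
    "\<And>s. s \<in> ball s1 r \<Longrightarrow> \<phi> s = 0" "s \<in> W"
  shows "\<phi> s = 0"
proof (rule analytic_continuation[OF assms(1-4) _ _ assms(6,7)])
  show "s1 \<in> W" using assms(4,5) by auto
  show "s1 islimpt ball s1 r" using assms(5) by (simp add: islimpt_ball)
qed

text \<open>Wirtinger derivatives keep the radius \<open>\<delta>\<close>, so a profile and its
  derivatives are separated from \<open>K\<close> by the same margin.\<close>

definition small_support :: "real \<Rightarrow> (complex \<Rightarrow> complex) \<Rightarrow> bool" where
  "small_support \<delta> g \<longleftrightarrow> smooth g \<and> (\<forall>s. norm s > \<delta> \<longrightarrow> g s = 0)"

lemma small_support_family: "small_support \<delta> g \<Longrightarrow> smooth_family (\<lambda>_. 1) Y (\<lambda>_. g)"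
  unfolding small_support_def
  by (rule smooth_family_compact_support[where C="cball 0 \<delta>"]) auto

lemma small_support_wirtinger:
  assumes "small_support \<delta> g"
  shows "small_support \<delta> (wirtinger 1 \<i> g)" "small_support \<delta> (wirtinger_bar 1 \<i> g)"
proof -
  have "open {s::complex. norm s > \<delta>}" by (intro open_Collect_less continuous_intros)
  then have "dir_deriv b g s = 0" if "norm s > \<delta>" for b s
    by (rule dir_deriv_eq_0_open) (use assms that in \<open>auto simp: small_support_def\<close>)
  then show "small_support \<delta> (wirtinger 1 \<i> g)" "small_support \<delta> (wirtinger_bar 1 \<i> g)"
    unfolding small_support_def using assms
    by (intro conjI allI impI smooth_wirtinger complex_Basis; simp add: small_support_def wirtinger_dir_deriv)+
qed

lemma small_support_plane_wave:
  fixes \<omega> :: "'y::metric_space \<Rightarrow> complex ^ 'n::finite"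
  assumes "small_support \<delta> g" "continuous_on Y \<omega>" "bounded (\<omega> ` Y)" "continuous_on Y \<tau>"
  shows "tempered_family Y (\<lambda>y z. g (scalar_product z (\<omega> y) - \<tau> y))"
  using smooth_family_plane_wave[OF small_support_family[OF assms(1)] assms(2,3) continuous_on_minus[OF assms(4)]]
  by (intro tempered_familyI) simp

lemma small_support_plane_wave_const:
  fixes \<omega> :: "complex ^ 'n::finite" and \<tau> :: "'y::metric_space \<Rightarrow> complex"
  assumes "small_support \<delta> g" "continuous_on Y \<tau>"
  shows "tempered_family Y (\<lambda>y z. g (scalar_product z \<omega> - \<tau> y))"
  using small_support_plane_wave[OF assms(1) continuous_on_const[of Y \<omega>] _ assms(2)]
  by (simp add: image_constant_conv)

context radon_supported_in_hat
begin

text \<open>A cut-off near \<open>w1\<close> on the sphere would not be invariant under phases. The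
  vector \<open>v w\<close> is the hermitian projection of \<open>w1\<close> onto the complex line
  of \<open>w\<close>; it depends on the line only, and
  \<open>\<iota> w * scalar_product z w\<close> equals \<open>scalar_product z (v w)\<close>. The
  weight \<open>\<eta>\<close> contains the conjugate of \<open>M w\<close>, so the vanishing
  average is an integral of \<open>\<eta>0 |M|^2\<close>, and \<open>M w1 = 0\<close>
  follows.\<close>

lemma unit_plane_wave_vanishes:
  fixes w1 :: "complex ^ 'n"
  assumes cK: "compact K" and g: "smooth g" "\<And>s. s \<notin> C \<Longrightarrow> g s = 0" and C: "compact C"
    and w1: "norm w1 = 1" and disj: "\<And>x. x \<in> K \<Longrightarrow> scalar_product x w1 \<notin> C"
  shows "ext T (\<lambda>z. g (scalar_product z w1)) = 0"
proof -
  let ?S = "sphere (0 :: complex ^ 'n) 1"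
  interpret compact_parameter "sphere_borel" ?S by (rule compact_parameter_sphere)
  define \<iota> where "\<iota> w = scalar_product (vcnj w) w1" for w
  define v where "v w = \<iota> w *s w" for w
  have c_vcnj: "continuous_on A (vcnj :: complex ^ 'n \<Rightarrow> _)" for A
    unfolding vcnj_def[abs_def] by (intro continuous_intros)
  have c\<iota>: "continuous_on A \<iota>" for A unfolding \<iota>_def[abs_def] by (intro continuous_intros c_vcnj)
  have cv: "continuous_on A v" for A
    unfolding v_def[abs_def] vector_scalar_mult_def by (intro continuous_intros c\<iota>)
  have \<iota>_cis: "\<iota> (cis \<theta> *s w) = cnj (cis \<theta>) * \<iota> w" for \<theta> w by (simp add: \<iota>_def scalar_product_simps)
  have cc: "cnj (cis \<theta>) * cis \<theta> = 1" for \<theta> by (simp add: cis_cnj cis_mult)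
  have v_cis: "v (cis \<theta> *s w) = v w" for \<theta> w
  proof -
    have "v (cis \<theta> *s w) = (\<iota> w * (cnj (cis \<theta>) * cis \<theta>)) *s w"
      by (simp add: v_def \<iota>_cis vector_smult_assoc mult_ac)
    then show ?thesis by (simp only: cc) (simp add: v_def)
  qed
  have \<iota>1: "\<iota> w1 = 1" using scalar_product_vcnj[of w1] w1 by (simp add: \<iota>_def scalar_product_commute)
  then have v1: "v w1 = w1" by (simp add: v_def)
  have cD: "compact ((\<lambda>x. scalar_product x w1) ` K)"
    by (intro compact_continuous_image continuous_intros cK)
  have "(\<lambda>x. scalar_product x w1) ` K \<inter> C = {}" using disj by auto
  then obtain \<epsilon> where \<epsilon>: "\<epsilon> > 0" "\<And>x s. x \<in> K \<Longrightarrow> s \<in> C \<Longrightarrow> \<epsilon> \<le> dist (scalar_product x w1) s"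
    using separate_compact_closed[OF cD compact_imp_closed[OF C]] by auto
  \<comment> \<open>The bound 1/2 keeps \<open>|\<iota> w| \<ge> 1/2\<close>, hence \<open>s\<close>
    bounded, on the support of \<open>h\<close>. With the other bound, replacing \<open>w1\<close>
    by \<open>v w\<close> moves the values on \<open>K\<close> by less than their distance
    \<open>\<epsilon>\<close> from \<open>C\<close>.\<close>
  define \<delta> where "\<delta> = min (1/2) (\<epsilon> / (R + 1))"
  have \<delta>: "\<delta> > 0" "\<delta> \<le> 1/2"
    unfolding \<delta>_def using \<epsilon>(1) R_nonneg by (simp, intro min.cobounded1)
  have R\<delta>: "R * \<delta> < \<epsilon>"
  proof -
    have "R * \<delta> \<le> R * (\<epsilon> / (R + 1))" using R_nonneg by (intro mult_left_mono) (auto simp: \<delta>_def)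
    also have "\<dots> < \<epsilon>" using R_nonneg \<epsilon>(1) by (simp add: field_simps)
    finally show ?thesis .
  qed
  \<comment> \<open>A tent function is enough, since elements of \<open>E_X\<close> need only be
    continuous in the direction.\<close>
  define \<eta>0 where "\<eta>0 w = max 0 (\<delta> - norm (v w - w1))" for w
  have gf: "smooth_family (\<lambda>_. 1) ?S (\<lambda>_. g)"
    by (rule smooth_family_compact_support[OF g C]) simp_all
  have "smooth_family (\<lambda>_. 1) ?S (\<lambda>w s. g (\<iota> w * s + 0))"
    by (rule smooth_family_affine[OF gf, where L="\<lambda>w s. \<iota> w * s"])
      (intro bounded_linear_mult_right continuous_intros c\<iota> compact_imp_bounded compact_continuous_image compact_sphere)+
  then have gi: "smooth_family (\<lambda>_. 1) ?S (\<lambda>w s. g (\<iota> w * s))" by simp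
  have kf: "smooth_family (\<lambda>_. 1) ?S (\<lambda>w z. g (\<iota> w * scalar_product z w))"
    using dual_radon_integral(2)[of "\<lambda>(w, s). g (\<iota> w * s)"] gi by simp
  define M where "M w = ext T (\<lambda>z. g (\<iota> w * scalar_product z w))" for w
  have cM: "continuous_on ?S M" unfolding M_def by (rule ext_continuous[OF tempered_familyI[OF kf]])
  have M_cis: "M (cis \<theta> *s w) = M w" for \<theta> w
  proof -
    have "\<iota> (cis \<theta> *s w) * scalar_product z (cis \<theta> *s w) = (cnj (cis \<theta>) * cis \<theta>) * (\<iota> w * scalar_product z w)" for z
      by (simp add: \<iota>_cis scalar_product_simps mult_ac)
    then show ?thesis unfolding M_def by (simp only: cc mult_1)
  qed
  define \<eta> where "\<eta> w = of_real (\<eta>0 w) * cnj (M w)" for w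
  have c\<eta>0: "continuous_on ?S \<eta>0" unfolding \<eta>0_def[abs_def] by (intro continuous_intros cv)
  have c\<eta>: "continuous_on ?S \<eta>" unfolding \<eta>_def[abs_def] by (intro continuous_intros c\<eta>0 cM)
  define h where "h = (\<lambda>(w, s). \<eta> w * g (\<iota> w * s))"
  have fam: "smooth_family (\<lambda>_. 1) ?S (\<lambda>w s. h (w, s))"
    unfolding h_def prod.case
    by (rule smooth_family_cmult[OF gi c\<eta> compact_imp_bounded[OF compact_continuous_image[OF c\<eta> compact_sphere]]])
  have inv: "h (cis \<theta> *s w, s * cis \<theta>) = h (w, s)" for w s \<theta>
  proof -
    have "\<iota> (cis \<theta> *s w) * (s * cis \<theta>) = (cnj (cis \<theta>) * cis \<theta>) * (\<iota> w * s)" by (simp add: \<iota>_cis mult_ac)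
    then show ?thesis by (simp only: h_def prod.case \<eta>_def \<eta>0_def v_cis M_cis cc mult_1)
  qed
  define E where "E = {p \<in> ?S \<times> UNIV. norm (v (fst p) - w1) \<le> \<delta> \<and> \<iota> (fst p) * snd p \<in> C}"
  have nv: "norm (\<iota> w) = norm (v w)" if "w \<in> ?S" for w using that by (simp add: v_def norm_scaleC)
  have "closed (((\<lambda>p. norm (v (fst p) - w1)) -` {..\<delta>}) \<inter> ((\<lambda>p. \<iota> (fst p) * snd p) -` C) \<inter> (?S \<times> UNIV))"
    by (intro closed_Int closed_vimage closed_Times closed_sphere closed_UNIV closed_atMost compact_imp_closed[OF C]
        continuous_intros continuous_on_compose2[OF cv[of UNIV]] continuous_on_compose2[OF c\<iota>[of UNIV]]) auto
  moreover have "E = (((\<lambda>p. norm (v (fst p) - w1)) -` {..\<delta>}) \<inter> ((\<lambda>p. \<iota> (fst p) * snd p) -` C) \<inter> (?S \<times> UNIV))"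
    by (auto simp: E_def)
  ultimately have clE: "closed E" by simp
  obtain c0 where c0: "\<And>s. s \<in> C \<Longrightarrow> norm s \<le> c0" using compact_imp_bounded[OF C] unfolding bounded_iff by blast
  have "E \<subseteq> ?S \<times> cball 0 (2 * c0)"
  proof
    fix p assume p: "p \<in> E"
    obtain w s where ws: "p = (w, s)" by fastforce
    have w: "w \<in> ?S" and vw: "norm (v w - w1) \<le> \<delta>" and s: "\<iota> w * s \<in> C" using p by (auto simp: E_def ws)
    have "1 \<le> norm (v w) + norm (v w - w1)" using norm_triangle_sub[of w1 "v w"] w1 by (simp add: norm_minus_commute)
    then have "1/2 \<le> norm (\<iota> w)" using vw \<delta>(2) nv[OF w] by simp
    then have "(1/2) * norm s \<le> norm (\<iota> w) * norm s" by (intro mult_right_mono) auto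
    also have "\<dots> \<le> c0" using c0[OF s] by (simp add: norm_mult)
    finally show "p \<in> ?S \<times> cball 0 (2 * c0)" using w by (simp add: ws)
  qed
  then have "E = (?S \<times> cball 0 (2 * c0)) \<inter> E" by blast
  moreover have "compact ((?S \<times> cball 0 (2 * c0)) \<inter> E)"
    by (intro compact_Int_closed compact_Times compact_sphere compact_cball clE)
  ultimately have cE: "compact E" by simp
  have h0: "h (w, s) = 0" if "w \<in> ?S" "(w, s) \<notin> E" for w s
  proof (cases "norm (v w - w1) \<le> \<delta>")
    case True
    then show ?thesis using that g(2) by (auto simp: E_def h_def)
  qed (simp add: h_def \<eta>_def \<eta>0_def)
  have hD: "h \<in> D_X" by (rule D_X_I(1)[OF fam inv cE h0])
  have "supp_X h \<subseteq> E" by (rule D_X_I(2)[OF fam inv cE h0])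
  moreover have "p \<in> X_space - hat K" if p: "p \<in> E" for p
  proof -
    obtain w s where ws: "p = (w, s)" by fastforce
    have w: "w \<in> ?S" and vw: "norm (v w - w1) \<le> \<delta>" and s: "\<iota> w * s \<in> C" using p by (auto simp: E_def ws)
    have "(w, s) \<notin> hat K"
    proof
      assume "(w, s) \<in> hat K"
      then obtain x where x: "x \<in> K" "s = scalar_product x w" by (auto simp: hat_def chyperplane_def)
      have "\<iota> w * s = scalar_product x (v w)" by (simp add: x v_def scalar_product_simps)
      then have "dist (scalar_product x w1) (\<iota> w * s) = norm (scalar_product x (w1 - v w))"
        by (simp add: dist_norm scalar_product_simps)
      also have "\<dots> \<le> norm x * norm (w1 - v w)" by (rule norm_scalar_product_le)
      also have "\<dots> \<le> R * \<delta>" using x(1) K_bound vw R_nonneg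
        by (intro mult_mono) (auto simp: norm_minus_commute)
      also have "\<dots> < \<epsilon>" by (rule R\<delta>)
      finally show False using \<epsilon>(2)[OF x(1) s] by simp
    qed
    then show ?thesis using w by (simp add: ws X_space_def)
  qed
  ultimately have "radon T h = 0" using radon_supp hD unfolding X_supported_in_def by blast
  then have "(LINT w:?S|sphere_borel. ext T (\<lambda>z. h (w, scalar_product z w))) = 0"
    by (simp only: radon_swap[OF hD])
  moreover have "ext T (\<lambda>z. h (w, scalar_product z w)) = of_real (\<eta>0 w * (norm (M w))\<^sup>2)" if "w \<in> ?S" for w
  proof -
    have "tempered (\<lambda>z. g (\<iota> w * scalar_product z w))"
      by (rule tempered_family_member[OF tempered_familyI[OF kf] that])
    then have "ext T (\<lambda>z. h (w, scalar_product z w)) = \<eta> w * M w"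
      unfolding h_def prod.case by (subst ext_cmult) (simp_all add: M_def)
    also have "\<dots> = of_real (\<eta>0 w) * (M w * cnj (M w))" by (simp add: \<eta>_def mult_ac)
    also have "\<dots> = of_real (\<eta>0 w * (norm (M w))\<^sup>2)" by (simp only: complex_norm_square[symmetric] of_real_mult)
    finally show ?thesis .
  qed
  then have "(LINT w:?S|sphere_borel. ext T (\<lambda>z. h (w, scalar_product z w))) =
      (LINT w:?S|sphere_borel. complex_of_real (\<eta>0 w * (norm (M w))\<^sup>2))"
    by (intro set_lebesgue_integral_cong Y_sets) blast
  ultimately have I0: "(LINT w:?S|sphere_borel. complex_of_real (\<eta>0 w * (norm (M w))\<^sup>2)) = 0" by simp
  have "\<eta>0 w1 * (norm (M w1))\<^sup>2 = 0"
  proof (rule nonneg_integral_zero[OF _ _ I0])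
    show "continuous_on ?S (\<lambda>w. \<eta>0 w * (norm (M w))\<^sup>2)" by (intro continuous_intros c\<eta>0 cM)
    show "w1 \<in> ?S" using w1 by simp
    show "emeasure sphere_borel (U \<inter> ?S) \<noteq> 0" if "open U" "w1 \<in> U" for U
      by (rule sphere_borel_open_nonzero[OF that w1])
  qed (simp add: \<eta>0_def)
  moreover have "\<eta>0 w1 = \<delta>" using \<delta>(1) by (simp add: \<eta>0_def v1)
  ultimately show ?thesis using \<delta>(1) by (simp add: M_def \<iota>1)
qed

lemma plane_wave_vanishes:
  fixes \<omega> :: "complex ^ 'n"
  assumes cK: "compact K" and g: "small_support \<delta> g" and \<omega>: "\<omega> \<noteq> 0"
    and disj: "\<And>x. x \<in> K \<Longrightarrow> norm (scalar_product x \<omega> - s) > \<delta>"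
  shows "ext T (\<lambda>z. g (scalar_product z \<omega> - s)) = 0"
proof -
  define r where "r = norm \<omega>"
  have r: "r > 0" using \<omega> by (simp add: r_def)
  define w1 where "w1 = (1 / r) *\<^sub>R \<omega>"
  have w1: "norm w1 = 1" using r by (simp add: w1_def r_def)
  have e: "scalar_product z \<omega> = r *\<^sub>R scalar_product z w1" for z
    using r by (simp add: w1_def scalar_product_simps)
  define g' where "g' t = g (r *\<^sub>R t + (- s))" for t
  have "smooth_family (\<lambda>_. 1) {0::real} (\<lambda>_. g')"
    unfolding g'_def[abs_def]
    by (rule smooth_family_affine[OF small_support_family[OF g]])
      (simp_all add: bounded_linear_scaleR_right)
  then have sg: "smooth g'" by (rule smooth_family_smooth) simp
  define C where "C = (\<lambda>t. (1 / r) *\<^sub>R t) ` cball s \<delta>"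
  have C: "compact C" unfolding C_def by (intro compact_continuous_image continuous_intros compact_cball)
  have mem: "t \<in> C" if "norm (r *\<^sub>R t - s) \<le> \<delta>" for t
    unfolding C_def using that r by (intro image_eqI[of _ _ "r *\<^sub>R t"]) (auto simp: dist_norm norm_minus_commute)
  have mem': "norm (r *\<^sub>R t - s) \<le> \<delta>" if "t \<in> C" for t
    using that r by (auto simp: C_def dist_norm norm_minus_commute)
  have "ext T (\<lambda>z. g' (scalar_product z w1)) = 0"
  proof (rule unit_plane_wave_vanishes[OF cK sg _ C w1])
    show "g' t = 0" if "t \<notin> C" for t
      using mem[of t] that g by (force simp: g'_def small_support_def)
    show "scalar_product x w1 \<notin> C" if "x \<in> K" for x
      using mem'[of "scalar_product x w1"] disj[OF that] by (auto simp: e)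
  qed
  then show ?thesis by (simp add: g'_def e)
qed

lemma ext_vanishes_on_ball:
  assumes "tempered f" "\<And>z. norm z \<le> R + 1 \<Longrightarrow> f z = 0"
  shows "ext T f = 0"
proof (rule ext_eq_0I)
  fix t :: real assume "t > 0"
  then have "(\<lambda>x. bump (t *\<^sub>R x) * f x) \<in> test_functions"
    using bump_mult_test(1)[OF assms(1), of t 0] by simp
  then show "T (\<lambda>x. bump (t *\<^sub>R x) * f x) = 0"
    by (rule vanishes_outside_ball) (simp add: assms(2))
qed

text \<open>\<open>T\<close> ignores functions that vanish on the ball of radius
  \<open>R + 1\<close>, and on this ball \<open>|scalar_product z \<omega>|\<close> is at most
  \<open>(R + 1) * norm \<omega>\<close>, too small to come within \<open>\<delta>\<close> of
  \<open>s\<close>.\<close>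

lemma far_plane_wave_vanishes:
  fixes \<omega> :: "complex ^ 'n"
  assumes p: "tempered p" and g: "small_support \<delta> g" and s: "norm s > \<delta> + (R + 1) * norm \<omega>"
  shows "ext T (\<lambda>z. p z * g (scalar_product z \<omega> - s)) = 0"
proof (rule ext_vanishes_on_ball)
  show "tempered (\<lambda>z. p z * g (scalar_product z \<omega> - s))"
    by (rule tempered_family_mult[OF p small_support_plane_wave_const[OF g continuous_on_const]])
  fix z :: "complex ^ 'n" assume z: "norm z \<le> R + 1"
  have "norm (scalar_product z \<omega>) \<le> (R + 1) * norm \<omega>"
    using norm_scalar_product_le[of z \<omega>] mult_right_mono[OF z norm_ge_zero[of \<omega>]] by linarith
  then have "\<delta> < norm (scalar_product z \<omega> - s)"
    using s norm_triangle_ineq2[of s "scalar_product z \<omega>"] by (simp add: norm_minus_commute)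
  then show "p z * g (scalar_product z \<omega> - s) = 0" using g by (simp add: small_support_def)
qed

lemma plane_wave_line_integral:
  fixes \<omega> :: "complex ^ 'n"
  assumes p: "tempered p" and g: "small_support \<delta> g"
  defines "U \<equiv> \<lambda>g s. ext T (\<lambda>z. p z * g (scalar_product z \<omega> - s))"
  shows "U g (s + v) - U g s = integral {0..1}
    (\<lambda>t. - (v * U (wirtinger 1 \<i> g) (s + of_real t * v) + cnj v * U (wirtinger_bar 1 \<i> g) (s + of_real t * v)))"
proof -
  have dg: "g differentiable (at x)" for x using g smooth_differentiable by (auto simp: small_support_def)
  note g' = small_support_wirtinger[OF g]
  have ct: "continuous_on {0..1} (\<lambda>t. s + complex_of_real t * v)" by (intro continuous_intros)
  have tw: "tempered_family {0..1} (\<lambda>t z. p z * G (scalar_product z \<omega> - (s + of_real t * v)))"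
    if "small_support \<delta> G" for G
    by (rule tempered_family_mult[OF tempered_family_of_tempered[OF p] small_support_plane_wave_const[OF that ct]])
  have tw': "tempered (\<lambda>z. p z * G (scalar_product z \<omega> - s))" if "small_support \<delta> G" for G s
    by (rule tempered_family_mult[OF p small_support_plane_wave_const[OF that continuous_on_const]])
  define k where "k t z = (- v) * (p z * wirtinger 1 \<i> g (scalar_product z \<omega> - (s + of_real t * v))) +
    (- cnj v) * (p z * wirtinger_bar 1 \<i> g (scalar_product z \<omega> - (s + of_real t * v)))" for t z
  have "ext T (\<lambda>z. p z * g (scalar_product z \<omega> - (s + of_real 1 * v))) - ext T (\<lambda>z. p z * g (scalar_product z \<omega> - (s + of_real 0 * v))) =
      integral {0..1} (\<lambda>t. ext T (k t))"
  proof (rule ext_ftc[of 1 1 "\<lambda>t z. p z * g (scalar_product z \<omega> - (s + of_real t * v))"])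
    show "tempered_family {0..1} k"
      unfolding k_def by (intro tempered_family_add tempered_family_mult[OF tempered_family_const] tw g')
    fix t z
    have "((\<lambda>t. g ((scalar_product z \<omega> - s) + t *\<^sub>R (- v))) has_vector_derivative
        dir_deriv (- v) g ((scalar_product z \<omega> - s) + t *\<^sub>R (- v))) (at t within {0..1})"
      by (rule smooth_line_derivative[OF dg])
    then have "((\<lambda>t. p z * g (scalar_product z \<omega> - (s + of_real t * v))) has_vector_derivative
        p z * dir_deriv (- v) g (scalar_product z \<omega> - (s + of_real t * v))) (at t within {0..1})"
      by (intro has_vector_derivative_mult_right) (simp add: scaleR_conv_of_real diff_diff_eq)
    then show "((\<lambda>t. p z * g (scalar_product z \<omega> - (s + of_real t * v))) has_vector_derivative k t z) (at t within {0..1})"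
      by (simp add: k_def dir_deriv_wirtinger[OF dg] algebra_simps)
  qed (auto intro: tw'[OF g])
  moreover have "ext T (k t) = - (v * U (wirtinger 1 \<i> g) (s + of_real t * v) + cnj v * U (wirtinger_bar 1 \<i> g) (s + of_real t * v))" for t
    unfolding k_def U_def by (subst ext_linear) (auto intro: tw' g')
  ultimately show ?thesis by (simp add: U_def)
qed

text \<open>If one Wirtinger derivative of the transform vanishes, then the transform is holomorphic or
  antiholomorphic in s. It vanishes for large s, hence on the connected set W.\<close>

lemma peel:
  fixes \<omega> :: "complex ^ 'n"
  assumes p: "tempered p" and g: "small_support \<delta> g"
    and W: "open W" "connected W" "ball s1 r \<subseteq> W" "r > 0"
    and far: "\<And>s. s \<in> ball s1 r \<Longrightarrow> norm s > \<delta> + (R + 1) * norm \<omega>"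
    and D: "D = wirtinger 1 \<i> \<or> D = wirtinger_bar 1 \<i>"
    and z: "\<And>s. s \<in> W \<Longrightarrow> ext T (\<lambda>z. p z * D g (scalar_product z \<omega> - s)) = 0"
    and s: "s \<in> W"
  shows "ext T (\<lambda>z. p z * g (scalar_product z \<omega> - s)) = 0"
proof -
  define U where "U g s = ext T (\<lambda>z. p z * g (scalar_product z \<omega> - s))" for g s
  note g' = small_support_wirtinger[OF g]
  have cU: "continuous_on UNIV (U G)" if "small_support \<delta> G" for G
    unfolding U_def
    by (rule ext_continuous[OF tempered_family_mult[OF tempered_family_of_tempered[OF p] small_support_plane_wave_const[OF that continuous_on_id]]])
  have li: "U g (s + v) - U g s = integral {0..1}
    (\<lambda>t. - (v * U (wirtinger 1 \<i> g) (s + of_real t * v) + cnj v * U (wirtinger_bar 1 \<i> g) (s + of_real t * v)))" for s v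
    unfolding U_def by (rule plane_wave_line_integral[OF p g])
  have f0: "U g s = 0" if "s \<in> ball s1 r" for s
    unfolding U_def by (rule far_plane_wave_vanishes[OF p g far[OF that]])
  from D have "U g s = 0"
  proof
    assume D: "D = wirtinger_bar 1 \<i>"
    have "U g holomorphic_on W"
    proof (rule holomorphic_on_line_integrals[OF W(1), of "\<lambda>s. - U (wirtinger 1 \<i> g) s"])
      show "continuous_on UNIV (\<lambda>s. - U (wirtinger 1 \<i> g) s)" by (intro continuous_intros cU g')
      fix s v assume "\<And>t. t \<in> {0..1} \<Longrightarrow> s + of_real t * v \<in> W"
      then have "U (wirtinger_bar 1 \<i> g) (s + of_real t * v) = 0" if "t \<in> {0..1}" for t
        using z that unfolding D U_def by blast
      then show "U g (s + v) - U g s = integral {0..1} (\<lambda>t. v * - U (wirtinger 1 \<i> g) (s + of_real t * v))"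
        unfolding li by (intro Henstock_Kurzweil_Integration.integral_cong) simp
    qed
    from zero_by_continuation[OF this W f0 s] show ?thesis .
  next
    assume D: "D = wirtinger 1 \<i>"
    \<comment> \<open>In the other case the transform is antiholomorphic, and the identity theorem
      is applied to its conjugate.\<close>
    have "(\<lambda>s. cnj (U g s)) holomorphic_on W"
    proof (rule holomorphic_on_line_integrals[OF W(1), of "\<lambda>s. - cnj (U (wirtinger_bar 1 \<i> g) s)"])
      show "continuous_on UNIV (\<lambda>s. - cnj (U (wirtinger_bar 1 \<i> g) s))" by (intro continuous_intros cU g')
      fix s v assume "\<And>t. t \<in> {0..1} \<Longrightarrow> s + of_real t * v \<in> W"
      then have "U (wirtinger 1 \<i> g) (s + of_real t * v) = 0" if "t \<in> {0..1}" for t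
        using z that unfolding D U_def by blast
      then have "U g (s + v) - U g s = integral {0..1} (\<lambda>t. cnj v * - U (wirtinger_bar 1 \<i> g) (s + of_real t * v))"
        unfolding li by (intro Henstock_Kurzweil_Integration.integral_cong) simp
      then have "cnj (U g (s + v) - U g s) = integral {0..1} (\<lambda>t. cnj (cnj v * - U (wirtinger_bar 1 \<i> g) (s + of_real t * v)))"
        by (simp only: integral_cnj)
      then show "cnj (U g (s + v)) - cnj (U g s) = integral {0..1} (\<lambda>t. v * - cnj (U (wirtinger_bar 1 \<i> g) (s + of_real t * v)))"
        by simp
    qed
    from zero_by_continuation[OF this W _ s] f0 show ?thesis by simp
  qed
  then show ?thesis by (simp add: U_def)
qed

end

lemma inner_axis_complex:
  fixes z :: "complex ^ 'n::finite"
  shows "z \<bullet> axis j 1 = Re (z $ j)" "z \<bullet> axis j \<i> = Im (z $ j)"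
  by (simp_all add: inner_axis inner_complex_def)

lemma tempered_component:
  "tempered (\<lambda>z :: complex ^ 'n::finite. z $ j)" "tempered (\<lambda>z :: complex ^ 'n::finite. cnj (z $ j))"
proof -
  have "tempered (\<lambda>z :: complex ^ 'n. of_real (z \<bullet> axis j 1) + c * of_real (z \<bullet> axis j \<i>))" for c
    by (intro tempered_family_add tempered_family_mult[OF tempered_family_const] tempered_family_coord)
  note this[of \<i>] this[of "- \<i>"]
  moreover have "(\<lambda>z :: complex ^ 'n. of_real (z \<bullet> axis j 1) + \<i> * of_real (z \<bullet> axis j \<i>)) = (\<lambda>z. z $ j)"
    "(\<lambda>z :: complex ^ 'n. of_real (z \<bullet> axis j 1) + - \<i> * of_real (z \<bullet> axis j \<i>)) = (\<lambda>z. cnj (z $ j))"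
    by (auto simp: inner_axis_complex complex_eq_iff)
  ultimately show "tempered (\<lambda>z :: complex ^ 'n. z $ j)" "tempered (\<lambda>z :: complex ^ 'n. cnj (z $ j))" by simp_all
qed

lemma Basis_complex_vec:
  assumes "b \<in> (Basis :: (complex ^ 'n::finite) set)"
  obtains j where "b = axis j 1" | j where "b = axis j \<i>"
  using assms by (auto simp: Basis_vec_def Basis_complex_def)

context radon_supported_in_hat
begin

text \<open>The claim is carried for all \<open>\<omega>\<close> in a ball and all \<open>s\<close>
  in \<open>W\<close>: the induction hypothesis is differentiated in the direction, which needs
  nearby \<open>\<omega>\<close>, and the removal of the derivative needs all of
  \<open>W\<close>.\<close>

lemma polynomial_plane_wave_vanishes:
  fixes w0 :: "complex ^ 'n"
  assumes cK: "compact K" and W: "open W" "connected W" "ball s1 r \<subseteq> W" "r > 0"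
    and far: "\<And>s \<omega>. s \<in> ball s1 r \<Longrightarrow> \<omega> \<in> ball w0 \<epsilon> \<Longrightarrow> norm s > \<delta> + (R + 1) * norm \<omega>"
    and nz: "0 \<notin> ball w0 \<epsilon>"
    and disj: "\<And>s \<omega> x. s \<in> W \<Longrightarrow> \<omega> \<in> ball w0 \<epsilon> \<Longrightarrow> x \<in> K \<Longrightarrow> norm (scalar_product x \<omega> - s) > \<delta>"
    and p: "cpoly p"
  shows "small_support \<delta> g \<Longrightarrow> \<omega> \<in> ball w0 \<epsilon> \<Longrightarrow> s \<in> W \<Longrightarrow> ext T (\<lambda>z. p z * g (scalar_product z \<omega> - s)) = 0"
  using p
proof (induction p arbitrary: g \<omega> s rule: cpoly.induct)
  case (const c)
  have "tempered (\<lambda>z. g (scalar_product z \<omega> - s))"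
    by (rule small_support_plane_wave_const[OF const.prems(1) continuous_on_const])
  moreover have "ext T (\<lambda>z. g (scalar_product z \<omega> - s)) = 0"
    by (rule plane_wave_vanishes[OF cK const.prems(1)]) (use const.prems nz disj in auto)
  ultimately show ?case by (simp add: ext_cmult)
next
  case (add p q)
  have t: "tempered (\<lambda>z. p z * g (scalar_product z \<omega> - s))" if "cpoly p" for p
    by (rule tempered_family_mult[OF cpoly_tempered[OF that] small_support_plane_wave_const[OF add.prems(1) continuous_on_const]])
  show ?case using add.IH[OF add.prems] ext_add[OF t[OF add.hyps(1)] t[OF add.hyps(2)]] by (simp add: distrib_right)
next
  case (coord p b)
  note pt = cpoly_tempered[OF coord.hyps(1)]
  define a where "a g \<omega> s j = ext T (\<lambda>z. (p z * z $ j) * g (scalar_product z \<omega> - s))" for g \<omega> s j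
  define a' where "a' g \<omega> s j = ext T (\<lambda>z. (p z * cnj (z $ j)) * g (scalar_product z \<omega> - s))" for g \<omega> s j
  have t: "tempered (\<lambda>z. (p z * z $ j) * g (scalar_product z \<omega> - s))"
    "tempered (\<lambda>z. (p z * cnj (z $ j)) * g (scalar_product z \<omega> - s))"
    if "small_support \<delta> g" for g \<omega> s j
    by (intro tempered_family_mult pt tempered_component small_support_plane_wave_const[OF that continuous_on_const])+
  have diff: "c * a (wirtinger 1 \<i> g) \<omega> s j + cnj c * a' (wirtinger_bar 1 \<i> g) \<omega> s j = 0"
    if g: "small_support \<delta> g" and \<omega>: "\<omega> \<in> ball w0 \<epsilon>" and s: "s \<in> W" and c: "norm c = 1" for g \<omega> s c j
  proof -
    note g' = small_support_wirtinger[OF g]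
    have dg: "g differentiable (at x)" for x using g smooth_differentiable by (auto simp: small_support_def)
    \<comment> \<open>Moving \<open>\<omega>\<close> along this vector changes
      \<open>scalar_product z \<omega>\<close> at the rate \<open>c * z $ j\<close>, which is the
      source of the new factor.\<close>
    define v where "v = (axis j c :: complex ^ 'n)"
    have sv: "scalar_product z v = c * z $ j" for z
      by (simp add: v_def scalar_product_commute[of z] scalar_product_axis)
    have "axis j c = c *s (axis j 1 :: complex ^ 'n)" by (simp add: vec_eq_iff axis_def)
    then have nv: "norm v = 1" using c by (simp add: v_def norm_scaleC)
    obtain e0 where e0: "e0 > 0" "ball \<omega> e0 \<subseteq> ball w0 \<epsilon>" using \<omega> by (meson open_ball open_contains_ball)
    \<comment> \<open>Half of \<open>e0\<close>, so that the closed segment stays in the open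
      ball.\<close>
    define e where "e = e0 / 2"
    have e: "e > 0" using e0 by (simp add: e_def)
    have mem: "\<omega> + t *\<^sub>R v \<in> ball w0 \<epsilon>" if "t \<in> {0..e}" for t
      using that e0 nv by (intro subsetD[OF e0(2)]) (auto simp: e_def dist_norm)
    have c\<omega>: "continuous_on {0..e} (\<lambda>t. \<omega> + t *\<^sub>R v)" by (intro continuous_intros)
    have tw: "tempered_family {0..e} (\<lambda>t z. G (scalar_product z (\<omega> + t *\<^sub>R v) - s))" if "small_support \<delta> G" for G
      by (rule small_support_plane_wave[OF that c\<omega> compact_imp_bounded[OF compact_continuous_image[OF c\<omega> compact_Icc]] continuous_on_const])
    define k where "k t z = c * ((p z * z $ j) * wirtinger 1 \<i> g (scalar_product z (\<omega> + t *\<^sub>R v) - s)) +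
      cnj c * ((p z * cnj (z $ j)) * wirtinger_bar 1 \<i> g (scalar_product z (\<omega> + t *\<^sub>R v) - s))" for t z
    have "ext T (k 0) = 0"
    proof (rule ext_derivative_0[OF e, of "\<lambda>t z. p z * g (scalar_product z (\<omega> + t *\<^sub>R v) - s)"])
      show "tempered (\<lambda>z. p z * g (scalar_product z (\<omega> + t *\<^sub>R v) - s))" for t
        by (rule tempered_family_mult[OF pt small_support_plane_wave_const[OF g continuous_on_const]])
      show "tempered_family {0..e} k"
        unfolding k_def
        by (intro tempered_family_add tempered_family_mult[OF tempered_family_const] tempered_family_mult[OF _ tw]
            tempered_family_mult[OF cpoly_tempered[OF coord.hyps(1)] tempered_family_of_tempered] tempered_component g')
      show "ext T (\<lambda>z. p z * g (scalar_product z (\<omega> + t *\<^sub>R v) - s)) = 0" if "t \<in> {0..e}" for t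
        by (rule coord.IH[OF g mem[OF that] s])
      fix t z
      have "((\<lambda>t. g ((scalar_product z \<omega> - s) + t *\<^sub>R scalar_product z v)) has_vector_derivative
          dir_deriv (scalar_product z v) g ((scalar_product z \<omega> - s) + t *\<^sub>R scalar_product z v)) (at t within {0..e})"
        by (rule smooth_line_derivative[OF dg])
      moreover have e: "(scalar_product z \<omega> - s) + t *\<^sub>R scalar_product z v = scalar_product z (\<omega> + t *\<^sub>R v) - s" for t
        by (simp add: scalar_product_simps)
      ultimately have "((\<lambda>t. p z * g (scalar_product z (\<omega> + t *\<^sub>R v) - s)) has_vector_derivative
          p z * dir_deriv (scalar_product z v) g (scalar_product z (\<omega> + t *\<^sub>R v) - s)) (at t within {0..e})"
        unfolding e by (intro has_vector_derivative_mult_right)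
      then show "((\<lambda>t. p z * g (scalar_product z (\<omega> + t *\<^sub>R v) - s)) has_vector_derivative k t z) (at t within {0..e})"
        by (simp add: k_def dir_deriv_wirtinger[OF dg] sv algebra_simps)
    qed
    moreover have "ext T (k 0) = c * a (wirtinger 1 \<i> g) \<omega> s j + cnj c * a' (wirtinger_bar 1 \<i> g) \<omega> s j"
      unfolding k_def a_def a'_def by (subst ext_linear[OF t(1)[OF g'(1)] t(2)[OF g'(2)], symmetric]) simp
    ultimately show ?thesis by simp
  qed
  \<comment> \<open>The two terms are separated by the directions \<open>c = 1\<close> and
    \<open>c = \<i>\<close>, which give their sum and their difference.\<close>
  have aw: "a (wirtinger 1 \<i> g) \<omega> s j = 0 \<and> a' (wirtinger_bar 1 \<i> g) \<omega> s j = 0"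
    if "small_support \<delta> g" "\<omega> \<in> ball w0 \<epsilon>" "s \<in> W" for g \<omega> s j
  proof -
    define x where "x = a (wirtinger 1 \<i> g) \<omega> s j"
    define y where "y = a' (wirtinger_bar 1 \<i> g) \<omega> s j"
    have "x + y = 0" using diff[OF that, of 1 j] by (simp add: x_def y_def)
    moreover have "\<i> * (x - y) = 0" using diff[OF that, of \<i> j] by (simp add: x_def y_def right_diff_distrib)
    ultimately have "x = 0" "y = 0" by (auto simp: add_eq_0_iff)
    then show ?thesis by (simp add: x_def y_def)
  qed
  \<comment> \<open>With the factor \<open>z $ j\<close> it is the derivative
    \<open>wirtinger\<close> of \<open>g\<close> that gives zero, with its conjugate it is
    \<open>wirtinger_bar\<close>; \<open>peel\<close> handles both.\<close>
  have a0: "a g \<omega> s j = 0" for j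
    unfolding a_def
    by (rule peel[OF _ coord.prems(1) W far[OF _ coord.prems(2)], of _ "wirtinger 1 \<i>"])
      (use aw[OF coord.prems(1,2)] coord.prems(3) tempered_family_mult[OF pt tempered_component(1)] in \<open>auto simp: a_def\<close>)
  have a'0: "a' g \<omega> s j = 0" for j
    unfolding a'_def
    by (rule peel[OF _ coord.prems(1) W far[OF _ coord.prems(2)], of _ "wirtinger_bar 1 \<i>"])
      (use aw[OF coord.prems(1,2)] coord.prems(3) tempered_family_mult[OF pt tempered_component(2)] in \<open>auto simp: a'_def\<close>)
  note lin = ext_linear[OF t[OF coord.prems(1)]]
  from coord.hyps(2) show ?case
  proof (cases rule: Basis_complex_vec)
    case (1 j)
    have "complex_of_real (Re x) = (1/2) * x + (1/2) * cnj x" for x by (simp add: complex_eq_iff)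
    then have "(\<lambda>z. p z * of_real (z \<bullet> b) * g (scalar_product z \<omega> - s)) =
      (\<lambda>z. (1/2) * ((p z * z $ j) * g (scalar_product z \<omega> - s)) + (1/2) * ((p z * cnj (z $ j)) * g (scalar_product z \<omega> - s)))"
      unfolding 1 inner_axis_complex by (simp only: ring_distribs mult_ac)
    then show ?thesis using a0[of j] a'0[of j] by (simp only: lin a_def a'_def) simp
  next
    case (2 j)
    have "complex_of_real (Im x) = (- \<i>/2) * x + (\<i>/2) * cnj x" for x by (simp add: complex_eq_iff)
    then have "(\<lambda>z. p z * of_real (z \<bullet> b) * g (scalar_product z \<omega> - s)) =
      (\<lambda>z. (- \<i>/2) * ((p z * z $ j) * g (scalar_product z \<omega> - s)) + (\<i>/2) * ((p z * cnj (z $ j)) * g (scalar_product z \<omega> - s)))"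
      unfolding 2 inner_axis_complex by (simp only: ring_distribs mult_ac)
    then show ?thesis using a0[of j] a'0[of j] by (simp only: lin a_def a'_def) simp
  qed
qed

lemma not_in_support:
  fixes w0 :: "complex ^ 'n"
  assumes cK: "compact K" and w0: "w0 \<noteq> 0" and z0: "scalar_product z0 w0 = s0"
    and sK: "\<And>x. x \<in> K \<Longrightarrow> scalar_product x w0 \<noteq> s0"
    and con: "connected (UNIV - (\<lambda>x. scalar_product x w0) ` K)"
  shows "z0 \<notin> distr_support T"
proof -
  define D where "D = (\<lambda>x. scalar_product x w0) ` K"
  have cD: "compact D" unfolding D_def by (intro compact_continuous_image continuous_intros cK)
  \<comment> \<open>Large enough for the whole disc of radius \<open>\<delta> \<le> 1\<close> about
    \<open>s1\<close> and all directions of norm at most \<open>norm w0 + 1\<close>: the summand 3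
    exceeds the loss \<open>2 * \<delta>\<close>.\<close>
  define s1 where "s1 = complex_of_real ((R + 1) * (norm w0 + 1) + 3)"
  have ns1: "norm s1 = (R + 1) * (norm w0 + 1) + 3"
    unfolding s1_def norm_of_real using R_nonneg by (simp add: add_nonneg_nonneg)
  have "s1 \<notin> D"
  proof
    assume "s1 \<in> D"
    then obtain x where x: "x \<in> K" "s1 = scalar_product x w0" by (auto simp: D_def)
    have "norm s1 \<le> R * norm w0"
      using norm_scalar_product_le[of x w0] x(1) K_bound mult_right_mono[of "norm x" R "norm w0"] by (force simp: x(2))
    moreover have "(R + 1) * (norm w0 + 1) + 3 = R * norm w0 + R + norm w0 + 4" by (simp add: algebra_simps)
    ultimately show False using R_nonneg norm_ge_zero[of w0] ns1 by linarith
  qed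
  have "s0 \<notin> D" using sK by (auto simp: D_def)
  have "open (UNIV - D)" using compact_imp_closed[OF cD] by (simp add: open_Diff)
  \<comment> \<open>The complement of \<open>D\<close> comes arbitrarily close to \<open>D\<close>.
    A compact path from \<open>s0\<close> to \<open>s1\<close> has a positive distance from it,
    which leaves room for the support of \<open>g\<close> and for tilting \<open>w0\<close>.\<close>
  then have "path_connected (UNIV - D)" using con connected_open_path_connected unfolding D_def by blast
  then obtain \<gamma> where \<gamma>: "path \<gamma>" "path_image \<gamma> \<subseteq> UNIV - D" "pathstart \<gamma> = s0" "pathfinish \<gamma> = s1"
    using \<open>s0 \<notin> D\<close> \<open>s1 \<notin> D\<close> unfolding path_connected_def by blast
  define \<Gamma> where "\<Gamma> = path_image \<gamma>"
  have \<Gamma>: "compact \<Gamma>" "connected \<Gamma>" "s0 \<in> \<Gamma>" "s1 \<in> \<Gamma>" "\<Gamma> \<inter> D = {}"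
    using \<gamma> compact_path_image connected_path_image pathstart_in_path_image pathfinish_in_path_image
    by (fastforce simp: \<Gamma>_def)+
  obtain d where d: "d > 0" "\<And>t s. t \<in> \<Gamma> \<Longrightarrow> s \<in> D \<Longrightarrow> d \<le> dist t s"
    using separate_compact_closed[OF \<Gamma>(1) compact_imp_closed[OF cD] \<Gamma>(5)] by blast
  \<comment> \<open>A quarter of the gap: one \<open>\<delta>\<close> is spent on the width of
    \<open>W\<close>, one on changing the direction, and more than \<open>\<delta>\<close> remains
    for the support of \<open>g\<close>.\<close>
  define \<delta> where "\<delta> = min 1 (d / 4)"
  have \<delta>: "\<delta> > 0" "\<delta> \<le> 1" "4 * \<delta> \<le> d" using d(1) by (auto simp: \<delta>_def)
  \<comment> \<open>The three bounds give \<open>norm \<omega> \<le> norm w0 + 1\<close>, keep 0 out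
    of the ball of directions, and ensure \<open>R * \<epsilon> \<le> \<delta>\<close>.\<close>
  define \<epsilon> where "\<epsilon> = min (min 1 (norm w0)) (\<delta> / (R + 1))"
  have \<epsilon>: "\<epsilon> > 0" "\<epsilon> \<le> 1" "\<epsilon> \<le> norm w0" using w0 \<delta>(1) R_nonneg by (auto simp: \<epsilon>_def)
  have R\<epsilon>: "R * \<epsilon> \<le> \<delta>"
  proof -
    have "R * \<epsilon> \<le> R * (\<delta> / (R + 1))" using R_nonneg by (intro mult_left_mono) (auto simp: \<epsilon>_def)
    also have "\<dots> = \<delta> * (R / (R + 1))" by simp
    also have "\<dots> \<le> \<delta> * 1" using R_nonneg \<delta>(1) by (intro mult_left_mono) auto
    finally show ?thesis by simp
  qed
  \<comment> \<open>The \<open>\<delta>\<close>-neighbourhood of the path, written as a sum of sets: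
    open as such, and connected as an image of a product.\<close>
  define W where "W = (\<Union>t\<in>\<Gamma>. \<Union>y\<in>ball 0 \<delta>. {t + y})"
  have W: "open W"
    unfolding W_def by (rule open_sums) simp
  have "W = (\<lambda>p. fst p + snd p) ` (\<Gamma> \<times> ball 0 \<delta>)" by (force simp: W_def)
  then have Wc: "connected W"
    by (simp only:) (intro connected_continuous_image continuous_intros connected_Times \<Gamma> convex_connected convex_ball)
  have Wb: "ball t \<delta> \<subseteq> W" if "t \<in> \<Gamma>" for t
  proof
    fix s assume "s \<in> ball t \<delta>"
    then have "s - t \<in> ball 0 \<delta>" by (simp add: dist_norm norm_minus_commute)
    moreover have "s = t + (s - t)" by simp
    ultimately show "s \<in> W" unfolding W_def using that by blast
  qed
  have far: "norm s > \<delta> + (R + 1) * norm \<omega>" if "s \<in> ball s1 \<delta>" "\<omega> \<in> ball w0 \<epsilon>" for s \<omega>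
  proof -
    have "norm \<omega> \<le> norm w0 + 1"
      using that(2) \<epsilon>(2) norm_triangle_sub[of \<omega> w0] by (simp add: dist_norm norm_minus_commute)
    then have "(R + 1) * norm \<omega> \<le> (R + 1) * (norm w0 + 1)" using R_nonneg by (intro mult_left_mono) auto
    moreover have "norm s1 \<le> norm s + \<delta>"
      using that(1) norm_triangle_sub[of s1 s] by (simp add: dist_norm)
    ultimately show ?thesis using ns1 \<delta>(2) by linarith
  qed
  have nz: "0 \<notin> ball w0 \<epsilon>" using \<epsilon>(3) by simp
  have disj: "norm (scalar_product x \<omega> - s) > \<delta>" if s: "s \<in> W" and \<omega>: "\<omega> \<in> ball w0 \<epsilon>" and x: "x \<in> K" for s \<omega> x
  proof -
    obtain t y where t: "t \<in> \<Gamma>" "norm y < \<delta>" "s = t + y" using s by (auto simp: W_def)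
    have "d \<le> norm (t - scalar_product x w0)" using d(2)[OF t(1), of "scalar_product x w0"] x by (simp add: D_def dist_norm)
    moreover have "norm (scalar_product x (w0 - \<omega>)) \<le> R * \<epsilon>"
      using norm_scalar_product_le[of x "w0 - \<omega>"] mult_mono[of "norm x" R "norm (w0 - \<omega>)" \<epsilon>] x \<omega> K_bound R_nonneg
      by (force simp: dist_norm)
    moreover have "t - scalar_product x w0 = - (scalar_product x \<omega> - s) + (- y) + (- scalar_product x (w0 - \<omega>))"
      by (simp add: t(3) scalar_product_simps)
    then have "norm (t - scalar_product x w0) \<le> norm (scalar_product x \<omega> - s) + norm y + norm (scalar_product x (w0 - \<omega>))"
      by (metis norm_minus_cancel norm_triangle_ineq norm_triangle_mono order_refl)
    ultimately show ?thesis using t(2) R\<epsilon> \<delta>(1,3) by linarith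
  qed
  \<comment> \<open>Equal to 1 up to \<open>\<delta> / 2\<close>, the width of the neighbourhood
    \<open>V\<close> of the hyperplane, and zero beyond \<open>\<delta>\<close>.\<close>
  define g where "g s = (bump ((2 / \<delta>) *\<^sub>R (s - (0::complex))))" for s
  have "smooth g"
    by (rule smooth_family_smooth[OF smooth_family_bump_dilate[of "{0::real}" "2 / \<delta>" "0::complex"], of 0, folded g_def]) simp
  moreover have "g s = 0" if "norm s > \<delta>" for s
    unfolding g_def using that \<delta>(1) by (intro bump_0) (simp add: field_simps)
  ultimately have g: "small_support \<delta> g" by (simp add: small_support_def)
  have g1: "g s = 1" if "norm s < \<delta> / 2" for s
    unfolding g_def using that \<delta>(1) by (intro bump_1) (simp add: field_simps)
  define V where "V = {z. norm (scalar_product z w0 - s0) < \<delta> / 2}"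
  have "open V" unfolding V_def by (intro open_Collect_less continuous_intros)
  moreover have "T \<phi> = 0" if \<phi>: "\<phi> \<in> test_functions" and sV: "supp \<phi> \<subseteq> V" for \<phi>
  proof -
    obtain L where L: "\<And>z. z \<in> supp \<phi> \<Longrightarrow> norm z \<le> L"
      using compact_imp_bounded[OF test_functionD(2)[OF \<phi>]] unfolding bounded_iff by blast
    \<comment> \<open>The cut-off is 1 both on the ball of radius \<open>R + 1\<close>, which is all
      that \<open>T\<close> sees, and on the support of \<open>\<phi>\<close>.\<close>
    define a where "a = 1 / (R + 1 + \<bar>L\<bar>)"
    have a: "a > 0" using R_nonneg by (simp add: a_def)
    have b1: "bump (a *\<^sub>R (z - 0)) = 1" if "norm z \<le> R + 1 + \<bar>L\<bar>" for z :: "complex ^ 'n"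
    proof (rule bump_1)
      have "0 < R + 1 + \<bar>L\<bar>" using R_nonneg by simp
      then show "norm (a *\<^sub>R (z - 0)) \<le> 1" using that by (simp add: a_def divide_le_eq_1)
    qed
    define f where "f z = g (scalar_product z w0 - s0)" for z :: "complex ^ 'n"
    have tf: "tempered f"
      unfolding f_def[abs_def] by (rule small_support_plane_wave_const[OF g continuous_on_const])
    define G where "G z = bump (a *\<^sub>R (z - 0)) * f z" for z :: "complex ^ 'n"
    have G: "G \<in> test_functions" unfolding G_def[abs_def] by (rule bump_mult_test(1)[OF tf a])
    have "ext T (\<lambda>z. p z * G z) = 0" if p: "cpoly p" for p
    proof -
      have "w0 \<in> ball w0 \<epsilon>" "s0 \<in> W" using \<epsilon>(1) Wb[OF \<Gamma>(3)] \<delta>(1) by auto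
      then have "ext T (\<lambda>z. p z * f z) = 0"
        unfolding f_def
        using polynomial_plane_wave_vanishes[where \<epsilon>=\<epsilon> and \<delta>=\<delta> and s=s0 and \<omega>=w0,
            OF cK W Wc Wb[OF \<Gamma>(4)] \<delta>(1) _ nz _ p g] far disj by blast
      moreover have tp: "tempered (\<lambda>z. p z * f z)" "tempered (\<lambda>z. p z * G z)"
        by (intro tempered_family_mult cpoly_tempered[OF p] tf tempered_test[OF G])+
      \<comment> \<open>Cutting off the plane wave changes it only outside the ball of radius
        \<open>R + 1\<close>, so the test function \<open>G\<close> inherits the annihilation of
        polynomials.\<close>
      have "ext T (\<lambda>z. p z * f z - p z * G z) = 0"
      proof (rule ext_vanishes_on_ball[OF tempered_family_diff[OF tp]])
        fix z :: "complex ^ 'n" assume "norm z \<le> R + 1"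
        then have "norm z \<le> R + 1 + \<bar>L\<bar>" by simp
        then show "p z * f z - p z * G z = 0" by (simp only: G_def b1) simp
      qed
      ultimately show ?thesis using ext_diff[OF tp] by simp
    qed
    from annihilates_polynomials[OF G this \<phi>] have "ext T (\<lambda>z. G z * \<phi> z) = 0" .
    moreover have "G z * \<phi> z = \<phi> z" for z
    proof (cases "z \<in> supp \<phi>")
      case True
      then have "norm z \<le> R + 1 + \<bar>L\<bar>" using L[OF True] R_nonneg by linarith
      moreover have "norm (scalar_product z w0 - s0) < \<delta> / 2" using True sV by (auto simp: V_def)
      ultimately show ?thesis by (simp only: G_def f_def b1 g1) simp
    qed (simp add: not_in_supp)
    then have "(\<lambda>z. G z * \<phi> z) = \<phi>" by (rule ext)
    ultimately show ?thesis using ext_test[OF \<phi>] by (simp only:)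
  qed
  moreover have "z0 \<in> V" using z0 \<delta>(1) by (simp add: V_def)
  ultimately show ?thesis unfolding distr_support_def by blast
qed

end

theorem theorem1:
  fixes T :: "(complex ^ 'n \<Rightarrow> complex) \<Rightarrow> complex"
    and K :: "(complex ^ 'n) set"
  assumes "rapidly_decreasing T"
    and "compact K"
    and "linearly_convex K"
    and "\<And>z. z \<notin> K \<Longrightarrow> \<exists>w\<^sub>0 s\<^sub>0. w\<^sub>0 \<noteq> 0 \<and>
           z \<in> chyperplane w\<^sub>0 s\<^sub>0 \<and>
           chyperplane w\<^sub>0 s\<^sub>0 \<inter> K = {} \<and>
           connected (UNIV - (\<lambda>l. scalar_product l w\<^sub>0) ` K)"
  shows "distr_support T \<subseteq> K \<longleftrightarrow> X_supported_in (radon T) (hat K)"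
proof
  interpret rapidly_decreasing_distribution T by unfold_locales (rule assms(1))
  show "distr_support T \<subseteq> K \<Longrightarrow> X_supported_in (radon T) (hat K)" by (rule radon_supported)
  assume supp: "X_supported_in (radon T) (hat K)"
  obtain R where R: "R > 0" "\<forall>x\<in>K. norm x \<le> R"
    using compact_imp_bounded[OF assms(2)] unfolding bounded_pos by blast
  interpret radon_supported_in_hat T K R
    by unfold_locales (use supp R in auto)
  show "distr_support T \<subseteq> K"
  proof (rule ccontr)
    assume "\<not> distr_support T \<subseteq> K"
    then obtain z where z: "z \<in> distr_support T" "z \<notin> K" by blast
    obtain w0 s0 where w0: "w0 \<noteq> 0" "z \<in> chyperplane w0 s0" "chyperplane w0 s0 \<inter> K = {}"
      "connected (UNIV - (\<lambda>l. scalar_product l w0) ` K)"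
      using assms(4)[OF z(2)] by blast
    then show False
      using not_in_support[OF assms(2) w0(1) _ _ w0(4), of z s0] z(1) by (auto simp: chyperplane_def)
  qed
qed

end
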